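(* Let $1\le q\le p<\infty$ and $r_{\lambda,p,q}>0$. Then $$\lambda_n\big(\boldsymbol{W}^r_{p,w}(\mathbb{R}),L_{q,w}(\mathbb{R})\big)\asymp d_n\big(\boldsymbol{W}^r_{p,w}(\mathbb{R}),L_{q,w}(\mathbb{R})\big)\asymp n^{-r_{\lambda,p,q}},\qquad n\in\mathbb{N}.$$
   Context: Fix $\lambda>1$, $a>0$, $b\in\mathbb{R}$ and the univariate Freud weight $w(x)=\exp(-a|x|^\lambda+b)$, $x\in\mathbb{R}$. For $1\le p<\infty$, $L_{p,w}(\mathbb{R})$ is the space of measurable functions $f$ on $\mathbb{R}$ with finite norm $\|f\|_{L_{p,w}(\mathbb{R})}=\big(\int_{\mathbb{R}}|f(x)w(x)|^p\,dx\big)^{1/p}$. For $r\in\mathbb{N}$, $W^r_{p,w}(\mathbb{R})$ is the space of all $f\in L_{p,w}(\mathbb{R})$ whose weak derivatives $f^{(k)}$, $0\le k\le r$, belong to $L_{p,w}(\mathbb{R})$, with norm $\|f\|_{W^r_{p,w}(\mathbb{R})}=\big(\sum_{k=0}^r\|f^{(k)}\|_{L_{p,w}(\mathbb{R})}^p\big)^{1/p}$; $\boldsymbol{W}^r_{p,w}(\mathbb{R})$ denotes its unit ball. Notation: $r_\lambda=(1-1/\lambda)r$; $\delta_{\lambda,p,q}=(1-1/\lambda)(1/p-1/q)$ if $p\le q$ and $\delta_{\lambda,p,q}=(1/\lambda)(1/q-1/p)$ if $p>q$; $r_{\lambda,p,q}=r_\lambda-\delta_{\lambda,p,q}$. For a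 Banach space $X$ and $F\subset X$, the Kolmogorov $n$-width is $d_n(F,X)=\inf_{L_n}\sup_{f\in F}\inf_{g\in L_n}\|f-g\|_X$, the infimum being over all linear subspaces $L_n\subset X$ of dimension $\le n$; the linear $n$-width is $\lambda_n(F,X)=\inf_{A_n}\sup_{f\in F}\|f-A_n(f)\|_X$, the infimum being over all linear operators $A_n$ in $X$ with $\operatorname{rank}A_n\le n$. $A_n\asymp B_n$ means that there are constants $c,C>0$ independent of $n$ (they may depend on $\lambda,a,b,r,p,q$) with $cB_n\le A_n\le CB_n$ for all indicated $n$. *)

theory Defs
  imports "HOL-Analysis.Analysis"
begin

section \<open>Lebesgue measurable functions modulo equality almost everywhere\<close>

definition ae_eq :: "(real \<Rightarrow> real) \<Rightarrow> (real \<Rightarrow> real) \<Rightarrow> bool" where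
  "ae_eq f g \<longleftrightarrow> f \<in> borel_measurable lebesgue \<and> g \<in> borel_measurable lebesgue
     \<and> (AE x in lebesgue. f x = g x)"

lemma part_equivp_ae_eq: "part_equivp ae_eq"
proof (rule part_equivpI)
  show "\<exists>f. ae_eq f f"
    by (rule exI[of _ "\<lambda>_. 0"]) (simp add: ae_eq_def)
  show "symp ae_eq"
    by (rule sympI) (auto simp: ae_eq_def elim: eventually_mono)
  show "transp ae_eq"
  proof (rule transpI)
    fix f g h assume fg: "ae_eq f g" and gh: "ae_eq g h"
    have "AE x in lebesgue. f x = h x"
      using fg gh unfolding ae_eq_def by (auto elim: eventually_elim2)
    with fg gh show "ae_eq f h" by (auto simp: ae_eq_def)
  qed
qed

quotient_type meas_fun = "real \<Rightarrow> real" / partial: ae_eq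
  by (rule part_equivp_ae_eq)

instantiation meas_fun :: real_vector
begin

lift_definition zero_meas_fun :: meas_fun is "\<lambda>_. 0"
  by (simp add: ae_eq_def)

lift_definition plus_meas_fun :: "meas_fun \<Rightarrow> meas_fun \<Rightarrow> meas_fun"
  is "\<lambda>f g x. f x + g x"
  by (auto simp: ae_eq_def elim: eventually_elim2)

lift_definition uminus_meas_fun :: "meas_fun \<Rightarrow> meas_fun" is "\<lambda>f x. - f x"
  by (auto simp: ae_eq_def elim: eventually_mono)

lift_definition minus_meas_fun :: "meas_fun \<Rightarrow> meas_fun \<Rightarrow> meas_fun"
  is "\<lambda>f g x. f x - g x"
  by (auto simp: ae_eq_def elim: eventually_elim2)

lift_definition scaleR_meas_fun :: "real \<Rightarrow> meas_fun \<Rightarrow> meas_fun" is "\<lambda>c f x. c * f x"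
  by (auto simp: ae_eq_def elim: eventually_mono)

instance
  by standard (transfer; auto simp: ae_eq_def algebra_simps)+

end


section \<open>Weighted Lebesgue and Sobolev spaces\<close>

definition freud_weight :: "real \<Rightarrow> real \<Rightarrow> real \<Rightarrow> real \<Rightarrow> real" where
  "freud_weight lam a b x = exp (- a * \<bar>x\<bar> powr lam + b)"

lift_definition Lp_weight_integral :: "real \<Rightarrow> (real \<Rightarrow> real) \<Rightarrow> meas_fun \<Rightarrow> ennreal"
  is "\<lambda>p w f. \<integral>\<^sup>+ x. ennreal (\<bar>f x * w x\<bar> powr p) \<partial>lebesgue"
  by (rule nn_integral_cong_AE) (auto simp: ae_eq_def elim: eventually_mono)

text \<open>The norm takes the value \<open>\<infinity>\<close> off the space.\<close>

definition Lp_weight_norm :: "real \<Rightarrow> (real \<Rightarrow> real) \<Rightarrow> meas_fun \<Rightarrow> ennreal" where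
  "Lp_weight_norm p w f =
     (if Lp_weight_integral p w f = \<infinity> then \<infinity>
      else ennreal (enn2real (Lp_weight_integral p w f) powr (1 / p)))"

definition Lp_weight :: "real \<Rightarrow> (real \<Rightarrow> real) \<Rightarrow> meas_fun set" where
  "Lp_weight p w = {f. Lp_weight_norm p w f < \<infinity>}"

definition test_function :: "(real \<Rightarrow> real) \<Rightarrow> bool" where
  "test_function \<phi> \<longleftrightarrow>
     (\<forall>n x. (deriv ^^ n) \<phi> field_differentiable (at x)) \<and> compact (closure {x. \<phi> x \<noteq> 0})"

definition locally_integrable :: "(real \<Rightarrow> real) \<Rightarrow> bool" where
  "locally_integrable f \<longleftrightarrow> (\<forall>K. compact K \<longrightarrow> set_integrable lebesgue K f)"

lemma test_function_deriv_measurable: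
  assumes "test_function \<phi>"
  shows "(deriv ^^ k) \<phi> \<in> borel_measurable lebesgue"
proof -
  have "continuous_on UNIV ((deriv ^^ k) \<phi>)"
    using assms unfolding test_function_def
    by (auto intro!: continuous_at_imp_continuous_on field_differentiable_imp_continuous_at)
  then show ?thesis
    by (intro measurable_completion) (simp add: borel_measurable_continuous_onI)
qed

lemma locally_integrable_ae_eq:
  assumes "ae_eq f g" "locally_integrable f"
  shows "locally_integrable g"
  unfolding locally_integrable_def set_integrable_def
proof (intro allI impI)
  fix K :: "real set" assume K: "compact K"
  then have [measurable]: "K \<in> sets lebesgue"
    by (simp add: borel_compact)
  have [measurable]: "f \<in> borel_measurable lebesgue" "g \<in> borel_measurable lebesgue"
    and ae: "AE x in lebesgue. f x = g x"
    using assms(1) by (auto simp: ae_eq_def)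
  have "integrable lebesgue (\<lambda>x. indicator K x *\<^sub>R f x)"
    using assms(2) K by (auto simp: locally_integrable_def set_integrable_def)
  moreover have "AE x in lebesgue. indicator K x *\<^sub>R f x = indicator K x *\<^sub>R g x"
    using ae by (auto elim: eventually_mono)
  ultimately show "integrable lebesgue (\<lambda>x. indicator K x *\<^sub>R g x)"
    by (subst integrable_cong_AE[where g = "\<lambda>x. indicator K x *\<^sub>R f x"])
       (auto elim: eventually_mono)
qed

lemma ae_eq_integral_mult:
  assumes "ae_eq f g" "\<psi> \<in> borel_measurable lebesgue"
  shows "(\<integral>x. f x * \<psi> x \<partial>lebesgue) = (\<integral>x. g x * \<psi> x \<partial>lebesgue)"
  using assms by (intro integral_cong_AE) (auto simp: ae_eq_def elim: eventually_mono)

lift_definition has_weak_deriv :: "nat \<Rightarrow> meas_fun \<Rightarrow> meas_fun \<Rightarrow> bool"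
  is "\<lambda>k f g. locally_integrable f \<and> locally_integrable g \<and>
        (\<forall>\<phi>. test_function \<phi> \<longrightarrow>
           (\<integral>x. f x * (deriv ^^ k) \<phi> x \<partial>lebesgue) = (- 1) ^ k * (\<integral>x. g x * \<phi> x \<partial>lebesgue))"
proof -
  fix k :: nat and f f' g g' :: "real \<Rightarrow> real"
  assume f: "ae_eq f f'" and g: "ae_eq g g'"
  have sym: "ae_eq f' f" "ae_eq g' g"
    using f g part_equivp_ae_eq by (auto dest: part_equivp_symp)
  have "(\<integral>x. f x * (deriv ^^ k) \<phi> x \<partial>lebesgue) = (\<integral>x. f' x * (deriv ^^ k) \<phi> x \<partial>lebesgue)"
       "(\<integral>x. g x * \<phi> x \<partial>lebesgue) = (\<integral>x. g' x * \<phi> x \<partial>lebesgue)"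
    if "test_function \<phi>" for \<phi>
    using ae_eq_integral_mult[OF f test_function_deriv_measurable[OF that, of k]]
      ae_eq_integral_mult[OF g test_function_deriv_measurable[OF that, of 0]] by simp_all
  moreover have "locally_integrable f = locally_integrable f'"
      "locally_integrable g = locally_integrable g'"
    using f g sym locally_integrable_ae_eq by blast+
  ultimately show "(locally_integrable f \<and> locally_integrable g \<and>
        (\<forall>\<phi>. test_function \<phi> \<longrightarrow>
           (\<integral>x. f x * (deriv ^^ k) \<phi> x \<partial>lebesgue) = (- 1) ^ k * (\<integral>x. g x * \<phi> x \<partial>lebesgue)))
    = (locally_integrable f' \<and> locally_integrable g' \<and>
        (\<forall>\<phi>. test_function \<phi> \<longrightarrow>
           (\<integral>x. f' x * (deriv ^^ k) \<phi> x \<partial>lebesgue) = (- 1) ^ k * (\<integral>x. g' x * \<phi> x \<partial>lebesgue)))"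
    by auto
qed

text \<open>Weak derivatives are unique as elements of \<open>meas_fun\<close>.\<close>

definition weak_deriv :: "nat \<Rightarrow> meas_fun \<Rightarrow> meas_fun" where
  "weak_deriv k f = (THE g. has_weak_deriv k f g)"

definition sobolev_space :: "nat \<Rightarrow> real \<Rightarrow> (real \<Rightarrow> real) \<Rightarrow> meas_fun set" where
  "sobolev_space r p w =
     {f \<in> Lp_weight p w. \<forall>k\<le>r. \<exists>g \<in> Lp_weight p w. has_weak_deriv k f g}"

definition sobolev_norm :: "nat \<Rightarrow> real \<Rightarrow> (real \<Rightarrow> real) \<Rightarrow> meas_fun \<Rightarrow> real" where
  "sobolev_norm r p w f =
     (\<Sum>k\<le>r. enn2real (Lp_weight_norm p w (weak_deriv k f)) powr p) powr (1 / p)"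

definition sobolev_ball :: "nat \<Rightarrow> real \<Rightarrow> (real \<Rightarrow> real) \<Rightarrow> meas_fun set" where
  "sobolev_ball r p w = {f \<in> sobolev_space r p w. sobolev_norm r p w f \<le> 1}"


section \<open>Widths\<close>

text \<open>A normed space is given by its carrier \<open>X\<close>, a subspace of a real vector space, and its norm
  \<open>N\<close>, extended by \<open>\<infinity>\<close> to the vectors outside \<open>X\<close>; the sets \<open>F\<close> to be approximated are meant to be
  subsets of \<open>X\<close>. If \<open>F\<close> is not contained in \<open>X\<close> then \<open>kolmogorov_width X N F n = \<infinity>\<close>, so a finite
  upper bound on it includes the inclusion.\<close>

text \<open>\<open>dim\<close> is not used because it is \<open>0\<close> on infinite-dimensional spaces.\<close>

definition subspace_dim_le :: "nat \<Rightarrow> 'a::real_vector set \<Rightarrow> bool" where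
  "subspace_dim_le n L \<longleftrightarrow> (\<exists>B. finite B \<and> card B \<le> n \<and> L = span B)"

definition kolmogorov_width ::
  "'a::real_vector set \<Rightarrow> ('a \<Rightarrow> ennreal) \<Rightarrow> 'a set \<Rightarrow> nat \<Rightarrow> ennreal" where
  "kolmogorov_width X N F n =
     (INF L \<in> {L. L \<subseteq> X \<and> subspace_dim_le n L}. SUP f \<in> F. INF g \<in> L. N (f - g))"

definition linear_operator_on :: "'a::real_vector set \<Rightarrow> ('a \<Rightarrow> 'a) \<Rightarrow> bool" where
  "linear_operator_on X A \<longleftrightarrow> A ` X \<subseteq> X \<and>
     (\<forall>f\<in>X. \<forall>g\<in>X. A (f + g) = A f + A g) \<and> (\<forall>c. \<forall>f\<in>X. A (c *\<^sub>R f) = c *\<^sub>R A f)"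

definition linear_width ::
  "'a::real_vector set \<Rightarrow> ('a \<Rightarrow> ennreal) \<Rightarrow> 'a set \<Rightarrow> nat \<Rightarrow> ennreal" where
  "linear_width X N F n =
     (INF A \<in> {A. linear_operator_on X A \<and> subspace_dim_le n (A ` X)}. SUP f \<in> F. N (f - A f))"

text \<open>Two-sided bounds for every \<open>n \<ge> 1\<close>, not merely for all large \<open>n\<close>.\<close>

definition same_order :: "(nat \<Rightarrow> ennreal) \<Rightarrow> (nat \<Rightarrow> ennreal) \<Rightarrow> bool" where
  "same_order A B \<longleftrightarrow>
     (\<exists>c>0. \<exists>C>0. \<forall>n\<ge>1. ennreal c * B n \<le> A n \<and> A n \<le> ennreal C * B n)"


section \<open>Exponents\<close>

definition r_lam :: "real \<Rightarrow> nat \<Rightarrow> real" where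
  "r_lam lam r = (1 - 1 / lam) * real r"

definition delta_exponent :: "real \<Rightarrow> real \<Rightarrow> real \<Rightarrow> real" where
  "delta_exponent lam p q =
     (if p \<le> q then (1 - 1 / lam) * (1 / p - 1 / q) else (1 / lam) * (1 / q - 1 / p))"

definition width_exponent :: "real \<Rightarrow> nat \<Rightarrow> real \<Rightarrow> real \<Rightarrow> real" where
  "width_exponent lam r p q = r_lam lam r - delta_exponent lam p q"

end

theory Submission
  imports Defs
begin

text \<open>
Put \<open>\<xi> = n powr (1/lam)\<close> and \<open>\<kappa> = (lam - 1) * r\<close>. On \<open>{-\<xi>..\<xi>}\<close> the weight \<open>w\<close> changes by at most a
bounded factor over any distance of order \<open>\<xi> powr (1 - lam)\<close>, and about \<open>n\<close> intervals of such a length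
\<open>h\<close> cover \<open>{-\<xi>..\<xi>}\<close>. Both bounds live on this grid.

Upper bound. On each grid interval \<open>f\<close> is replaced by its Taylor polynomial of degree less than \<open>r\<close>, and
outside \<open>{-\<xi>..<\<xi>}\<close> by \<open>0\<close>. Inside, the remainder costs a factor \<open>h ^ r\<close>, of the order of
\<open>\<xi> powr (- \<kappa>)\<close>, in the weighted \<open>L\<^sub>p\<close> norm (\<open>piecewise_taylor_error\<close>). Outside, \<open>f\<close> itself is small, because
the rapid decay of \<open>w\<close> turns every derivative in \<open>L\<^sub>p\<close> into a factor \<open>\<bar>x\<bar> powr (lam - 1)\<close>
(\<open>weighted_decay\<close>). Both estimates are cases of the Schur test for the integral form of the Taylor
remainder. Together they place the error in \<open>L\<^sub>p\<close> with the additional weight \<open>max \<xi> \<bar>x\<bar> powr \<kappa>\<close>, and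
from there to \<open>L\<^sub>q\<close> one loses \<open>\<xi> powr (1/q - 1/p)\<close> (\<open>weighted_Lp_to_Lq\<close>). The positivity of the width
exponent says exactly that \<open>\<kappa> > 1/q - 1/p\<close>, which is what makes the tail integral converge. The
resulting order is \<open>\<xi> powr (1/q - 1/p - \<kappa>)\<close>, that is \<open>n\<close> to minus the width exponent. Taylor coefficients
are defined on Sobolev functions only; since a linear width admits every linear operator on \<open>L\<^sub>q\<close>,
bounded or not, the approximation operator is extended from the Sobolev functions along a vector space
basis (\<open>sampling_operator_exists\<close>).

Lower bound. Put one smooth bump, divided by the size of the weight, into each of \<open>2 * n\<close> cells of equal length
in \<open>{0..<\<xi>}\<close>. A subspace spanned by \<open>n\<close> functions imposes \<open>n\<close> linear equations on the weighted cell averages.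
Their solutions in \<open>2 * n\<close> unknowns cut a section out of the cube \<open>{-1..1}\<close> to the power \<open>2 * n\<close>, and a vertex of that section
has at least \<open>n\<close> coordinates \<open>1\<close> or \<open>-1\<close> (\<open>cube_section_vertex\<close>). The combination of the bumps with the
signs of such a vertex is far from the subspace in the weighted \<open>L\<^sub>1\<close> norm on \<open>{0..<\<xi>}\<close>, hence in \<open>L\<^sub>q\<close>
(\<open>kolmogorov_width_lower_bound\<close>).

Both parts use that a measurable function with weak derivatives up to order \<open>r\<close> is the class of the first
member of a sequence of functions each of which is an indefinite integral of the next
(\<open>sobolev_chain\<close>), which rests on the du Bois-Reymond lemma.
\<close>

section \<open>Smooth bump functions\<close>

text \<open>The powers of \<open>inverse x\<close> make the family closed under differentiation, up to linear combinations.\<close>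

definition flat :: "nat \<Rightarrow> real \<Rightarrow> real" where
  "flat k x = (if x > 0 then inverse x ^ k * exp (- inverse x) else 0)"

lemma flat_tendsto_0: "((\<lambda>h. flat k h) \<longlongrightarrow> 0) (at 0)"
proof -
  have *: "((\<lambda>y::real. y ^ k / exp y) \<longlongrightarrow> 0) at_top"
    by (rule tendsto_power_div_exp_0)
  have "((\<lambda>x::real. inverse x ^ k / exp (inverse x)) \<longlongrightarrow> 0) (at_right 0)"
    by (rule filterlim_compose[OF * filterlim_inverse_at_top_right])
  then have "((\<lambda>h. flat k h) \<longlongrightarrow> 0) (at_right 0)"
    by (rule Lim_transform_eventually)
      (auto simp: flat_def eventually_at_filter exp_minus divide_inverse)
  moreover have "((\<lambda>h. flat k h) \<longlongrightarrow> 0) (at_left 0)"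
    by (rule tendsto_eventually) (auto simp: flat_def eventually_at_filter)
  ultimately show ?thesis by (simp add: filterlim_split_at_real)
qed

lemma flat_deriv:
  "(flat k has_real_derivative (flat (k + 2) x - real k * flat (k + 1) x)) (at x)"
proof -
  consider "x > 0" | "x < 0" | "x = 0" by linarith
  then show ?thesis
  proof cases
    case 1
    have inv: "(inverse has_real_derivative - (inverse x ^ 2)) (at x)"
      using DERIV_inverse[of x UNIV] 1 by (simp add: power2_eq_square)
    have pow: "((\<lambda>x. inverse x ^ k) has_real_derivative - (real k * inverse x ^ (k + 1))) (at x)"
    proof (induction k)
      case (Suc k)
      from DERIV_mult[OF inv Suc] show ?case by (simp add: algebra_simps power2_eq_square)
    qed simp
    have "((\<lambda>x. exp (- inverse x)) has_real_derivative inverse x ^ 2 * exp (- inverse x)) (at x)"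
      using DERIV_chain2[OF DERIV_exp DERIV_minus[OF inv]] by (simp add: mult.commute)
    from DERIV_mult[OF pow this]
    have "((\<lambda>x. inverse x ^ k * exp (- inverse x)) has_real_derivative
        (flat (k + 2) x - real k * flat (k + 1) x)) (at x)"
      using 1 by (simp add: flat_def power2_eq_square algebra_simps)
    then show ?thesis
      by (rule has_field_derivative_transform_within_open[of _ _ _ "{0<..}"])
        (use 1 in \<open>auto simp: flat_def\<close>)
  next
    case 2
    have "((\<lambda>x. 0) has_real_derivative (flat (k + 2) x - real k * flat (k + 1) x)) (at x)"
      using 2 by (auto simp: flat_def)
    then show ?thesis
      by (rule has_field_derivative_transform_within_open[of _ _ _ "{..<0}"])
        (use 2 in \<open>auto simp: flat_def\<close>)
  next
    case 3
    have "((\<lambda>h. (flat k (0 + h) - flat k 0) / h) \<longlongrightarrow> 0) (at 0)"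
      by (rule Lim_transform_eventually[OF flat_tendsto_0[of "k + 1"]])
        (auto simp: flat_def eventually_at_filter divide_inverse)
    then show ?thesis using 3 by (simp add: DERIV_def flat_def)
  qed
qed

text \<open>A class of functions that contains the derivatives of its members consists of smooth functions. For this
  class closure under derivatives is an induction over the generating rules, so that no formula for
  higher derivatives of products or compositions is needed.\<close>

inductive smooth_gen :: "(real \<Rightarrow> real) \<Rightarrow> bool" where
  flat: "smooth_gen (flat k)"
| const: "smooth_gen (\<lambda>_. c)"
| add: "smooth_gen f \<Longrightarrow> smooth_gen g \<Longrightarrow> smooth_gen (\<lambda>x. f x + g x)"
| mult: "smooth_gen f \<Longrightarrow> smooth_gen g \<Longrightarrow> smooth_gen (\<lambda>x. f x * g x)"
| affine: "smooth_gen f \<Longrightarrow> smooth_gen (\<lambda>x. f (c * x + d))"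

lemma smooth_gen_deriv_ex:
  assumes "smooth_gen f"
  shows "\<exists>f'. smooth_gen f' \<and> (\<forall>x. (f has_real_derivative f' x) (at x))"
  using assms
proof induction
  case (flat k)
  have "smooth_gen (\<lambda>x. flat (k + 2) x + (- real k) * flat (k + 1) x)"
    by (intro smooth_gen.intros)
  with flat_deriv[of k] show ?case by (intro exI conjI) auto
next
  case (const c)
  show ?case by (rule exI[of _ "\<lambda>_. 0"]) (auto intro: smooth_gen.const)
next
  case (add f g)
  then obtain f' g' where "smooth_gen f'" "smooth_gen g'"
    "\<And>x. (f has_real_derivative f' x) (at x)" "\<And>x. (g has_real_derivative g' x) (at x)" by blast
  then show ?case
    by (intro exI[of _ "\<lambda>x. f' x + g' x"]) (auto intro!: smooth_gen.add DERIV_add)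
next
  case (mult f g)
  then obtain f' g' where *: "smooth_gen f'" "smooth_gen g'"
    "\<And>x. (f has_real_derivative f' x) (at x)" "\<And>x. (g has_real_derivative g' x) (at x)" by blast
  with mult.hyps show ?case
    by (intro exI[of _ "\<lambda>x. f' x * g x + g' x * f x"])
      (auto intro!: smooth_gen.add smooth_gen.mult DERIV_mult)
next
  case (affine f c d)
  then obtain f' where *: "smooth_gen f'" "\<And>x. (f has_real_derivative f' x) (at x)" by blast
  have "((\<lambda>x. f (c * x + d)) has_real_derivative f' (c * x + d) * c) (at x)" for x
    by (rule DERIV_chain2[OF *(2)]) (auto intro!: derivative_eq_intros)
  moreover have "smooth_gen (\<lambda>x. f' (c * x + d) * c)"
    by (rule smooth_gen.mult[OF smooth_gen.affine[OF *(1)] smooth_gen.const])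
  ultimately show ?case by blast
qed

lemma smooth_gen_deriv:
  assumes "smooth_gen f"
  shows "smooth_gen (deriv f)" "(f has_real_derivative deriv f x) (at x)"
proof -
  obtain f' where f': "smooth_gen f'" "\<And>x. (f has_real_derivative f' x) (at x)"
    using smooth_gen_deriv_ex[OF assms] by blast
  then have "deriv f = f'" by (auto intro!: DERIV_imp_deriv)
  with f' show "smooth_gen (deriv f)" "(f has_real_derivative deriv f x) (at x)" by auto
qed

lemma smooth_gen_derivs: "smooth_gen f \<Longrightarrow> smooth_gen ((deriv ^^ k) f)"
  by (induction k) (auto intro: smooth_gen_deriv)

lemma test_functionI:
  assumes "\<And>n x. (deriv ^^ n) \<phi> field_differentiable (at x)" "\<And>x. x \<notin> {c..d} \<Longrightarrow> \<phi> x = 0"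
  shows "test_function \<phi>"
proof -
  have "{x. \<phi> x \<noteq> 0} \<subseteq> {c..d}" using assms(2) by blast
  then have "bounded {x. \<phi> x \<noteq> 0}" using bounded_subset bounded_closed_interval by blast
  with assms(1) show ?thesis by (auto simp: test_function_def compact_closure)
qed

lemma smooth_gen_test_function:
  assumes "smooth_gen \<phi>" "\<And>x. x \<notin> {c..d} \<Longrightarrow> \<phi> x = 0"
  shows "test_function \<phi>"
  using smooth_gen_deriv(2)[OF smooth_gen_derivs[OF assms(1)]]
  by (intro test_functionI[of _ c d] assms(2)) (auto simp: field_differentiable_def)

lemma test_function_deriv:
  assumes "test_function \<phi>"
  shows "test_function (deriv \<phi>)" "\<And>x. (\<phi> has_real_derivative deriv \<phi> x) (at x)"
    "continuous_on S \<phi>"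
proof -
  have d: "(deriv ^^ n) \<phi> field_differentiable (at x)" for n x
    using assms by (auto simp: test_function_def)
  show 1: "(\<phi> has_real_derivative deriv \<phi> x) (at x)" for x
    using d[of 0 x] by (auto simp: field_differentiable_derivI)
  show "continuous_on S \<phi>"
    using 1 by (meson DERIV_isCont continuous_at_imp_continuous_on)
  have z: "deriv \<phi> x = 0" if "x \<notin> closure {x. \<phi> x \<noteq> 0}" for x
  proof -
    have "((\<lambda>_. 0) has_real_derivative 0) (at x)" by simp
    then have "(\<phi> has_real_derivative 0) (at x)"
      by (rule has_field_derivative_transform_within_open[of _ _ _ "- closure {x. \<phi> x \<noteq> 0}"])
        (use that closure_subset[of "{x. \<phi> x \<noteq> 0}"] in auto)
    then show ?thesis by (rule DERIV_imp_deriv)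
  qed
  then have "{x. deriv \<phi> x \<noteq> 0} \<subseteq> closure {x. \<phi> x \<noteq> 0}"
    by blast
  moreover have "bounded (closure {x. \<phi> x \<noteq> 0})"
    using assms by (simp add: test_function_def compact_imp_bounded)
  ultimately have "bounded {x. deriv \<phi> x \<noteq> 0}" by (rule bounded_subset[rotated])
  then have "compact (closure {x. deriv \<phi> x \<noteq> 0})" by (simp only: compact_closure)
  moreover have "(deriv ^^ n) (deriv \<phi>) field_differentiable (at x)" for n x
    using d[of "Suc n" x] by (simp only: funpow_Suc_right o_def)
  ultimately show "test_function (deriv \<phi>)" by (auto simp: test_function_def)
qed

lemma test_function_derivs: "test_function \<phi> \<Longrightarrow> test_function ((deriv ^^ k) \<phi>)"
  by (induction k) (auto intro: test_function_deriv)

text \<open>The open interval leaves room at the end points, where boundary terms of integrations by parts vanish.\<close>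

lemma test_function_support:
  assumes "test_function \<phi>"
  obtains R where "R > 0" "\<And>x. x \<notin> {-R<..<R} \<Longrightarrow> \<phi> x = 0" "\<And>x. x \<notin> {-R<..<R} \<Longrightarrow> deriv \<phi> x = 0"
proof -
  have "bounded {x. \<phi> x \<noteq> 0}" "bounded {x. deriv \<phi> x \<noteq> 0}"
    using assms test_function_deriv(1)[OF assms]
    by (simp_all add: test_function_def)
  then have "bounded ({x. \<phi> x \<noteq> 0} \<union> {x. deriv \<phi> x \<noteq> 0})" by simp
  then obtain R where "R > 0" "\<forall>x\<in>{x. \<phi> x \<noteq> 0} \<union> {x. deriv \<phi> x \<noteq> 0}. norm x < R"
    using bounded_pos_less by metis
  then show ?thesis by (intro that[of R]) force+
qed

text \<open>The parameter \<open>m\<close> sharpens the flanks: the bumps increase to the indicator of the interval as \<open>m\<close> grows.\<close>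

definition bump :: "real \<Rightarrow> real \<Rightarrow> nat \<Rightarrow> real \<Rightarrow> real" where
  "bump c d m x = flat 0 (real m * x + - real m * c) * flat 0 (- real m * x + real m * d)"

lemma smooth_gen_bump: "smooth_gen (bump c d m)"
  unfolding bump_def by (intro smooth_gen.intros)

lemma flat_0_bounds: "0 \<le> flat 0 x" "flat 0 x \<le> 1"
  by (auto simp: flat_def)

lemma bump_nonneg: "0 \<le> bump c d m x" and bump_le_1: "bump c d m x \<le> 1"
  unfolding bump_def by (intro mult_nonneg_nonneg mult_le_one flat_0_bounds)+

lemma bump_eq_0: "x \<notin> {c<..<d} \<Longrightarrow> bump c d m x = 0"
proof -
  assume "x \<notin> {c<..<d}"
  then consider "x \<le> c" | "x \<ge> d" by force
  then show ?thesis
  proof cases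
    case 1
    then have "real m * x \<le> real m * c" by (intro mult_left_mono) auto
    then show ?thesis by (simp add: bump_def flat_def)
  next
    case 2
    then have "real m * x \<ge> real m * d" by (intro mult_left_mono) auto
    then show ?thesis by (simp add: bump_def flat_def)
  qed
qed

lemma bump_tendsto: "(\<lambda>m. bump c d m x) \<longlonglongrightarrow> indicator {c<..<d} x"
proof (cases "x \<in> {c<..<d}")
  case True
  have *: "(\<lambda>m. flat 0 (real m * y)) \<longlonglongrightarrow> 1" if "y > 0" for y
  proof -
    have "(\<lambda>m. exp (- (inverse (real m) * inverse y))) \<longlonglongrightarrow> exp (- (0 * inverse y))"
      by (intro tendsto_intros lim_inverse_n)
    then have "(\<lambda>m. exp (- inverse (real m * y))) \<longlonglongrightarrow> 1"
      by (simp add: inverse_mult_distrib mult.commute)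
    then show ?thesis
      by (rule Lim_transform_eventually)
        (use that in \<open>auto simp: flat_def eventually_sequentially intro!: exI[of _ 1]\<close>)
  qed
  have "(\<lambda>m. flat 0 (real m * (x - c)) * flat 0 (real m * (d - x))) \<longlonglongrightarrow> 1 * 1"
    using True by (intro tendsto_mult *) auto
  then show ?thesis using True by (simp add: bump_def algebra_simps)
next
  case False
  then show ?thesis by (simp add: bump_eq_0)
qed

lemma test_function_bump: "test_function (bump c d m)"
  by (rule smooth_gen_test_function[OF smooth_gen_bump, of c d]) (auto simp: bump_eq_0)

section \<open>Weak derivatives and indefinite integrals\<close>

definition loc_int :: "(real \<Rightarrow> real) \<Rightarrow> bool" where
  "loc_int G \<longleftrightarrow> G \<in> borel_measurable borel \<and> (\<forall>a b. set_integrable lborel {a..b} G)"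

lemma loc_int_Icc: "loc_int G \<Longrightarrow> set_integrable lborel {a..b} G"
  by (simp add: loc_int_def)

lemma loc_int_subset:
  assumes "loc_int G" "A \<in> sets borel" "A \<subseteq> {a..b}"
  shows "set_integrable lborel A G"
  by (rule set_integrable_subset[OF loc_int_Icc[OF assms(1)]]) (use assms in auto)

lemma loc_int_continuous: "continuous_on UNIV G \<Longrightarrow> loc_int G"
  unfolding loc_int_def
  by (auto intro!: borel_measurable_continuous_onI borel_integrable_atLeastAtMost'
      intro: continuous_on_subset)

lemma loc_int_iff_locally_integrable:
  assumes [measurable]: "G \<in> borel_measurable borel"
  shows "loc_int G \<longleftrightarrow> locally_integrable G"
proof
  assume G: "loc_int G"
  show "locally_integrable G" unfolding locally_integrable_def
  proof (intro allI impI)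
    fix K :: "real set" assume K: "compact K"
    then obtain R where R: "K \<subseteq> {-R..R}"
      by (metis bounded_subset_cbox_symmetric cbox_interval compact_imp_bounded)
    have [measurable]: "K \<in> sets borel" using K by (simp add: borel_compact)
    have "set_integrable lborel K G" by (rule loc_int_subset[OF G _ R]) simp
    then show "set_integrable lebesgue K G"
      by (simp add: set_integrable_def integrable_completion)
  qed
next
  assume "locally_integrable G"
  then show "loc_int G"
    by (auto simp: locally_integrable_def loc_int_def set_integrable_def integrable_completion)
qed

lemma loc_int_lin:
  assumes "loc_int F" "loc_int G"
  shows "loc_int (\<lambda>x. F x + G x)" "loc_int (\<lambda>x. c * F x)" "loc_int (\<lambda>x. F x - G x)"
  using assms by (auto simp: loc_int_def)

text \<open>The continuous factor is bounded on its support, so \<open>G\<close> restricted to a bounded interval dominates.\<close>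

lemma loc_int_times_integrable:
  assumes "loc_int G" "continuous_on UNIV \<phi>" "\<And>x. x \<notin> {-R<..<R} \<Longrightarrow> \<phi> x = 0"
  shows "integrable lborel (\<lambda>x. G x * \<phi> x)"
proof -
  have [measurable]: "G \<in> borel_measurable borel" "\<phi> \<in> borel_measurable borel"
    using assms by (auto simp: loc_int_def borel_measurable_continuous_onI)
  have "compact (\<phi> ` {-R..R})"
    using assms(2) by (intro compact_continuous_image) (auto intro: continuous_on_subset)
  then obtain B where B: "\<And>x. x \<in> {-R..R} \<Longrightarrow> \<bar>\<phi> x\<bar> \<le> B"
    by (metis (no_types, lifting) bounded_iff compact_imp_bounded image_eqI real_norm_def)
  have "integrable lborel (\<lambda>x. B * (indicator {-R..R} x *\<^sub>R G x))"
    using loc_int_Icc[OF assms(1)] by (auto simp: set_integrable_def)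
  then show ?thesis
  proof (rule Bochner_Integration.integrable_bound)
    show "AE x in lborel. norm (G x * \<phi> x) \<le> norm (B * (indicator {-R..R} x *\<^sub>R G x))"
    proof (intro AE_I2)
      fix x
      show "norm (G x * \<phi> x) \<le> norm (B * (indicator {-R..R} x *\<^sub>R G x))"
      proof (cases "x \<in> {-R..R}")
        case True
        with B[OF True] have "\<bar>G x\<bar> * \<bar>\<phi> x\<bar> \<le> \<bar>G x\<bar> * \<bar>B\<bar>" by (intro mult_left_mono) auto
        with True show ?thesis by (simp add: abs_mult mult.commute)
      next
        case False
        then have "\<phi> x = 0" by (intro assms(3)) auto
        then show ?thesis by simp
      qed
    qed
  qed measurable
qed

text \<open>Bumps converge boundedly to indicators of intervals, so \<open>u\<close> has integral \<open>0\<close> over every bounded interval.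
  Then the measures with densities \<open>max u 0\<close> and \<open>max (- u) 0\<close>, cut off to a bounded interval, agree on half-lines
  and hence everywhere.\<close>

lemma fundamental_lemma:
  assumes u: "loc_int u"
    and 0: "\<And>c d m. (\<integral>x. u x * bump c d m x \<partial>lborel) = 0"
  shows "AE x in lborel. u x = 0"
proof -
  have [measurable]: "u \<in> borel_measurable borel" using u by (simp add: loc_int_def)
  have [measurable]: "bump c d m \<in> borel_measurable borel" for c d m
    using test_function_deriv(3)[OF test_function_bump]
    by (intro borel_measurable_continuous_onI)
  have int0: "(\<integral>x. u x * indicator {c<..<d} x \<partial>lborel) = 0" for c d
  proof -
    have "(\<lambda>m. \<integral>x. u x * bump c d m x \<partial>lborel) \<longlonglongrightarrow> (\<integral>x. u x * indicator {c<..<d} x \<partial>lborel)"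
    proof (rule integral_dominated_convergence)
      show "integrable lborel (\<lambda>x. norm (indicator {c..d} x *\<^sub>R u x))"
        using loc_int_Icc[OF u] by (intro integrable_norm) (simp add: set_integrable_def)
      show "AE x in lborel. (\<lambda>m. u x * bump c d m x) \<longlonglongrightarrow> u x * indicator {c<..<d} x"
        by (intro AE_I2 tendsto_intros bump_tendsto)
      show "AE x in lborel. norm (u x * bump c d m x) \<le> norm (indicator {c..d} x *\<^sub>R u x)" for m
      proof (intro AE_I2)
        fix x
        have "\<bar>u x\<bar> * bump c d m x \<le> \<bar>u x\<bar> * 1"
          by (intro mult_left_mono bump_le_1) auto
        then show "norm (u x * bump c d m x) \<le> norm (indicator {c..d} x *\<^sub>R u x)"
          using bump_eq_0[of x c d m] bump_nonneg[of c d m x]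
          by (auto simp: indicator_def abs_mult)
      qed
    qed measurable
    then show ?thesis by (simp add: 0 LIMSEQ_const_iff)
  qed
  have "AE x in lborel. u x * indicator {-real R<..<real R} x = 0" for R :: nat
  proof -
    define v where "v x = u x * indicator {-real R<..<real R} x" for x
    have [measurable]: "v \<in> borel_measurable borel" unfolding v_def by measurable
    have "set_integrable lborel {-real R<..<real R} u"
      by (rule loc_int_subset[OF u, of _ "-real R" "real R"]) auto
    then have iv: "integrable lborel v"
      by (simp add: v_def[abs_def] set_integrable_def mult.commute)
    (* ennreal truncates negative values to 0, so these are the densities of the positive and the negative part. *)
    let ?M = "density lborel (\<lambda>x. ennreal (v x))" and ?N = "density lborel (\<lambda>x. ennreal (- v x))"
    have "?M = ?N"
    proof (rule measure_eqI_lessThan)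
      fix x
      have fin: "(\<integral>\<^sup>+ y. ennreal (s * v y * indicator {x<..} y) \<partial>lborel) < \<infinity>" if "\<bar>s\<bar> = 1" for s
      proof -
        have "(\<integral>\<^sup>+ y. ennreal (s * v y * indicator {x<..} y) \<partial>lborel) \<le> (\<integral>\<^sup>+ y. ennreal (norm (v y)) \<partial>lborel)"
          using that by (intro nn_integral_mono ennreal_leI) (auto simp: indicator_def abs_if split: if_splits)
        also have "\<dots> < \<infinity>" using iv by (simp add: integrable_iff_bounded)
        finally show ?thesis .
      qed
      have e: "emeasure (density lborel (\<lambda>x. ennreal (s * v x))) {x<..}
          = (\<integral>\<^sup>+ y. ennreal (s * v y * indicator {x<..} y) \<partial>lborel)" for s
        by (subst emeasure_density) (auto intro!: nn_integral_cong simp: indicator_def)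
      have 1: "emeasure ?M {x<..} = (\<integral>\<^sup>+ y. ennreal (v y * indicator {x<..} y) \<partial>lborel)"
        using e[of 1] by simp
      have 2: "emeasure ?N {x<..} = (\<integral>\<^sup>+ y. ennreal (- (v y * indicator {x<..} y)) \<partial>lborel)"
        using e[of "-1"] by simp
      have f1: "(\<integral>\<^sup>+ y. ennreal (v y * indicator {x<..} y) \<partial>lborel) < \<infinity>" using fin[of 1] by simp
      have f2: "(\<integral>\<^sup>+ y. ennreal (- (v y * indicator {x<..} y)) \<partial>lborel) < \<infinity>"
        using fin[of "-1"] by simp
      show "emeasure ?M {x <..} < \<infinity>" using f1 1 by simp
      have ii: "integrable lborel (\<lambda>y. v y * indicator {x<..} y)"
        using iv by (rule integrable_mult_indicator[of "{x<..}" lborel v, simplified mult.commute real_scaleR_def, rotated]) simp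
      have "(\<lambda>y. v y * indicator {x<..} y) = (\<lambda>y. u y * indicator {max x (- real R)<..<real R} y)"
        by (auto simp: v_def indicator_def fun_eq_iff)
      then have "(\<integral>y. v y * indicator {x<..} y \<partial>lborel) = 0" by (simp only: int0)
      with real_lebesgue_integral_def[OF ii]
      have "enn2real (\<integral>\<^sup>+ y. ennreal (v y * indicator {x<..} y) \<partial>lborel)
          = enn2real (\<integral>\<^sup>+ y. ennreal (- (v y * indicator {x<..} y)) \<partial>lborel)" by simp
      then show "emeasure ?M {x <..} = emeasure ?N {x <..}"
        unfolding 1 2 using f1 f2 by (metis ennreal_enn2real infinity_ennreal_def)
    qed simp_all
    then have "AE x in lborel. ennreal (v x) = ennreal (- v x)"
      by (intro sigma_finite_measure.density_unique[OF sigma_finite_lborel]) auto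
    then have "AE x in lborel. v x = 0"
    proof eventually_elim
      fix x assume *: "ennreal (v x) = ennreal (- v x)"
      show "v x = 0"
      proof (rule ccontr)
        assume "v x \<noteq> 0"
        then consider "v x > 0" | "v x < 0" by linarith
        then show False
        proof cases
          case 1 with * show False by (simp add: ennreal_neg)
        next
          case 2 with * show False by (simp add: ennreal_neg)
        qed
      qed
    qed
    then show ?thesis by (simp add: v_def)
  qed
  then have "AE x in lborel. \<forall>R::nat. u x * indicator {-real R<..<real R} x = 0"
    unfolding AE_all_countable by blast
  then show ?thesis
  proof eventually_elim
    fix x assume *: "\<forall>R::nat. u x * indicator {-real R<..<real R} x = 0"
    obtain R :: nat where "\<bar>x\<bar> < real R" using reals_Archimedean2 by blast
    then have "x \<in> {-real R<..<real R}" by auto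
    with *[rule_format, of R] show "u x = 0" by simp
  qed
qed

text \<open>Absolute continuity of \<open>F\<close> with almost everywhere derivative \<open>G\<close>, in integrated form.\<close>

definition primitive :: "(real \<Rightarrow> real) \<Rightarrow> (real \<Rightarrow> real) \<Rightarrow> bool" where
  "primitive F G \<longleftrightarrow> loc_int G \<and> (\<forall>x y. x \<le> y \<longrightarrow> F y - F x = (LINT t:{x..y}|lborel. G t))"

lemma primitiveD:
  assumes "primitive F G"
  shows "loc_int G" "x \<le> y \<Longrightarrow> F y = F x + (LINT t:{x..y}|lborel. G t)"
  using assms unfolding primitive_def by (auto simp: field_simps)

lemma primitive_continuous:
  assumes "primitive F G"
  shows "continuous_on UNIV F"
proof -
  have "isCont F x" for x
  proof -
    define a b where "a = x - 1" and "b = x + 1"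
    note G = primitiveD(1)[OF assms]
    have i: "G integrable_on {a..b}" by (rule set_borel_integral_eq_integral(1)[OF loc_int_Icc[OF G]])
    have "continuous_on {a..b} (\<lambda>y. F a + integral {a..y} G)"
      by (intro continuous_intros indefinite_integral_continuous_1 i)
    moreover have "F y = F a + integral {a..y} G" if "y \<in> {a..b}" for y
      using primitiveD(2)[OF assms, of a y] that set_borel_integral_eq_integral(2)[OF loc_int_Icc[OF G]]
      by simp
    ultimately have "continuous_on {a..b} F" by (metis (no_types, lifting) continuous_on_cong)
    then show ?thesis
      by (rule continuous_on_interior) (simp add: a_def b_def)
  qed
  then show ?thesis by (simp add: continuous_at_imp_continuous_on)
qed

lemma primitive_exists:
  assumes G: "loc_int G"
  obtains F where "primitive F G"
proof -
  define F where "F x = (LBINT t=0..x. G t)" for x :: real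
  have ii: "interval_lebesgue_integrable lborel (ereal a) (ereal b) G" if "a \<le> b" for a b
    unfolding interval_lebesgue_integrable_def using that
    by (auto intro!: loc_int_subset[OF G, of _ a b])
  have "F y - F x = (LINT t:{x..y}|lborel. G t)" if "x \<le> y" for x y
  proof -
    have m: "min 0 (min (ereal x) (ereal y)) = ereal (min 0 (min x y))"
      "max 0 (max (ereal x) (ereal y)) = ereal (max 0 (max x y))"
      by (auto simp: min_def max_def)
    have "(LBINT t=0..x. G t) + (LBINT t=x..y. G t) = (LBINT t=0..y. G t)"
      by (rule interval_integral_sum) (unfold m, rule ii, simp)
    then show ?thesis using that by (simp add: F_def interval_integral_Icc)
  qed
  with G have "primitive F G" by (auto simp: primitive_def)
  then show ?thesis by (rule that)
qed

lemma primitive_C1: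
  assumes "\<And>x. (F has_real_derivative G x) (at x)" "continuous_on UNIV G"
  shows "primitive F G"
  unfolding primitive_def
proof (intro conjI allI impI)
  fix x y :: real assume "x \<le> y"
  then show "F y - F x = (LINT t:{x..y}|lborel. G t)"
    unfolding set_lebesgue_integral_def
    by (intro integral_FTC_atLeastAtMost[symmetric])
      (auto intro: continuous_on_subset[OF assms(2)] has_field_derivative_at_within[OF assms(1)]
        simp flip: has_real_derivative_iff_has_vector_derivative)
qed (rule loc_int_continuous[OF assms(2)])

text \<open>Fubini on the triangle \<open>t \<le> x\<close> with integrand \<open>deriv \<phi> x * G t\<close>: one order of integration produces
  \<open>F\<close> and the other \<open>- \<phi>\<close>.\<close>

lemma primitive_by_parts:
  assumes FG: "primitive F G" and \<phi>: "test_function \<phi>"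
  shows "(\<integral>x. F x * deriv \<phi> x \<partial>lborel) = - (\<integral>x. G x * \<phi> x \<partial>lborel)"
proof -
  obtain R where R: "R > 0" "\<And>x. x \<notin> {-R<..<R} \<Longrightarrow> \<phi> x = 0" "\<And>x. x \<notin> {-R<..<R} \<Longrightarrow> deriv \<phi> x = 0"
    using test_function_support[OF \<phi>] by blast
  note G = primitiveD(1)[OF FG]
  note d\<phi> = test_function_deriv[OF \<phi>] test_function_deriv(3)[OF test_function_deriv(1)[OF \<phi>]]
  have p\<phi>: "primitive \<phi> (deriv \<phi>)" by (rule primitive_C1) (use d\<phi> in auto)
  have li: "loc_int (deriv \<phi>)" by (rule primitiveD(1)[OF p\<phi>])
  have [measurable]: "G \<in> borel_measurable borel" "deriv \<phi> \<in> borel_measurable borel"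
    using G li by (auto simp: loc_int_def)
  define f where "f x t = (indicator {-R..R} x * deriv \<phi> x) * (indicator {-R..R} t * G t) * (if t \<le> x then 1 else 0)"
    for x t :: real
  have i1: "integrable lborel (\<lambda>x. indicator {-R..R} x * deriv \<phi> x)"
    "integrable lborel (\<lambda>x. indicator {-R..R} x * G x)"
    using loc_int_Icc[OF li] loc_int_Icc[OF G] by (auto simp: set_integrable_def)
  have "integrable (lborel \<Otimes>\<^sub>M lborel) (\<lambda>(x,t). (indicator {-R..R} x * deriv \<phi> x) * (indicator {-R..R} t * G t))"
  proof (rule lborel_pair.Fubini_integrable)
    show "integrable lborel (\<lambda>x. LBINT y. norm (case (x, y) of (x, t) \<Rightarrow> indicat_real {- R..R} x * deriv \<phi> x * (indicat_real {- R..R} t * G t)))"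
      using i1[THEN integrable_abs] by (simp add: abs_mult)
    show "AE x in lborel. integrable lborel (\<lambda>y. case (x, y) of (x, t) \<Rightarrow> indicat_real {- R..R} x * deriv \<phi> x * (indicat_real {- R..R} t * G t))"
      using i1 by auto
  qed measurable
  then have int: "integrable (lborel \<Otimes>\<^sub>M lborel) (case_prod f)"
    by (rule Bochner_Integration.integrable_bound) (auto simp: f_def[abs_def] intro!: AE_I2)
  have A: "(\<integral>t. f x t \<partial>lborel) = F x * deriv \<phi> x - F (-R) * (indicator {-R..R} x * deriv \<phi> x)" for x
  proof (cases "x \<in> {-R..R}")
    case True
    then have "(\<lambda>t. f x t) = (\<lambda>t. deriv \<phi> x * (indicator {-R..x} t *\<^sub>R G t))"
      by (auto simp: f_def indicator_def fun_eq_iff)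
    moreover have "(\<integral>t. indicator {-R..x} t *\<^sub>R G t \<partial>lborel) = F x - F (-R)"
      using True primitiveD(2)[OF FG, of "-R" x] by (simp add: set_lebesgue_integral_def)
    ultimately have "(\<integral>t. f x t \<partial>lborel) = deriv \<phi> x * (F x - F (-R))"
      by (simp only: integral_mult_right_zero)
    then show ?thesis using True by (simp add: algebra_simps)
  next
    case False
    then have "deriv \<phi> x = 0" by (intro R(3)) auto
    then show ?thesis by (simp add: f_def)
  qed
  have B: "(\<integral>x. f x t \<partial>lborel) = - (G t * \<phi> t)" for t
  proof (cases "t \<in> {-R..R}")
    case True
    then have "(\<lambda>x. f x t) = (\<lambda>x. G t * (indicator {t..R} x *\<^sub>R deriv \<phi> x))"
      by (auto simp: f_def indicator_def fun_eq_iff)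
    moreover have "(\<integral>x. indicator {t..R} x *\<^sub>R deriv \<phi> x \<partial>lborel) = \<phi> R - \<phi> t"
      using True primitiveD(2)[OF p\<phi>, of t R] by (simp add: set_lebesgue_integral_def)
    ultimately have "(\<integral>x. f x t \<partial>lborel) = G t * (\<phi> R - \<phi> t)"
      by (simp only: integral_mult_right_zero)
    then show ?thesis using R(2)[of R] by simp
  next
    case False
    then have "\<phi> t = 0" by (intro R(2)) auto
    with False show ?thesis by (simp add: f_def)
  qed
  have F\<phi>: "integrable lborel (\<lambda>x. F x * deriv \<phi> x)"
    by (rule loc_int_times_integrable[OF loc_int_continuous[OF primitive_continuous[OF FG]] d\<phi>(4) R(3)])
  have "(\<integral>x. indicator {-R..R} x * deriv \<phi> x \<partial>lborel) = \<phi> R - \<phi> (-R)"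
    using R(1) primitiveD(2)[OF p\<phi>, of "-R" R] by (simp add: set_lebesgue_integral_def)
  then have z: "(\<integral>x. indicator {-R..R} x * deriv \<phi> x \<partial>lborel) = 0" using R(2)[of R] R(2)[of "-R"] by simp
  have "(\<integral>x. F x * deriv \<phi> x \<partial>lborel) = (\<integral>x. F x * deriv \<phi> x - F (-R) * (indicator {-R..R} x * deriv \<phi> x) \<partial>lborel)"
    using F\<phi> i1 z by simp
  also have "\<dots> = (\<integral>x. (\<integral>t. f x t \<partial>lborel) \<partial>lborel)" by (simp add: A)
  also have "\<dots> = (\<integral>t. (\<integral>x. f x t \<partial>lborel) \<partial>lborel)"
    by (rule lborel_pair.Fubini_integral[OF int, symmetric])
  also have "\<dots> = - (\<integral>x. G x * \<phi> x \<partial>lborel)" by (simp add: B)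
  finally show ?thesis .
qed

text \<open>Any bump becomes, after subtraction of a multiple of a fixed bump \<open>\<eta>\<close>, a function \<open>\<theta>\<close> with integral \<open>0\<close>, that is
  the derivative of a test function \<open>\<psi>\<close>. Testing with \<open>\<psi>\<close> shows that \<open>u\<close> minus its \<open>\<eta>\<close>-average is orthogonal to all bumps.\<close>

lemma du_Bois_Reymond:
  assumes u: "loc_int u"
    and 0: "\<And>\<phi>. test_function \<phi> \<Longrightarrow> (\<integral>x. u x * deriv \<phi> x \<partial>lborel) = 0"
  obtains c where "AE x in lborel. u x = c"
proof -
  define \<eta> where "\<eta> = bump 0 1 1"
  have \<eta>: "test_function \<eta>" by (simp add: \<eta>_def test_function_bump)
  have cont: "continuous_on UNIV (bump c d m)" for c d m
    using test_function_deriv(3)[OF test_function_bump] .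
  have int: "integrable lborel (\<lambda>x. v x * bump c d m x)" if "loc_int v" for v c d m
    using that cont
    by (rule loc_int_times_integrable[where R = "max \<bar>c\<bar> \<bar>d\<bar>"]) (rule bump_eq_0, auto)
  have one: "loc_int (\<lambda>_. 1)" by (simp add: loc_int_continuous)
  define I where "I = (\<integral>x. \<eta> x \<partial>lborel)"
  have "I \<noteq> 0"
  proof
    assume "I = 0"
    then have "AE x in lborel. \<eta> x = 0"
      using integral_nonneg_eq_0_iff_AE[of lborel \<eta>] int[OF one, of 0 1 1] bump_nonneg
      by (simp add: I_def \<eta>_def)
    then have "AE x\<in>{0<..<1::real} in lborel. False"
      by eventually_elim (auto simp: \<eta>_def bump_def flat_def)
    then have "emeasure lborel {0<..<1::real} = 0"
      by (subst (asm) AE_iff_measurable[of "{0<..<1}"]) auto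
    then show False by simp
  qed
  define c where "c = (\<integral>x. u x * \<eta> x \<partial>lborel) / I"
  have "(\<integral>x. (u x - c) * bump a b m x \<partial>lborel) = 0" for a b m
  proof -
    define \<phi> where "\<phi> = bump a b m"
    define J where "J = (\<integral>x. \<phi> x \<partial>lborel)"
    define \<theta> where "\<theta> x = \<phi> x + (- (J / I)) * \<eta> x" for x
    have sm\<theta>: "smooth_gen \<theta>" unfolding \<theta>_def \<phi>_def \<eta>_def
      by (intro smooth_gen.intros smooth_gen_bump)
    define R where "R = \<bar>a\<bar> + \<bar>b\<bar> + 1"
    have z: "\<theta> x = 0" if "x \<notin> {-R..R}" for x
    proof -
      have "x \<notin> {a<..<b}" "x \<notin> {0<..<1}" using that by (auto simp: R_def)
      then show ?thesis by (simp add: \<theta>_def \<phi>_def \<eta>_def bump_eq_0)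
    qed
    have c\<theta>: "continuous_on UNIV \<theta>"
      using smooth_gen_deriv(2)[OF sm\<theta>] by (meson DERIV_isCont continuous_at_imp_continuous_on)
    obtain \<psi>0 where p0: "primitive \<psi>0 \<theta>"
      using primitive_exists[OF loc_int_continuous[OF c\<theta>]] .
    define \<psi> where "\<psi> x = \<psi>0 x - \<psi>0 (-R)" for x
    have p: "primitive \<psi> \<theta>" using p0 by (simp add: primitive_def \<psi>_def)
    have "(\<integral>x. \<theta> x \<partial>lborel) = J + (- (J / I)) * I"
      unfolding \<theta>_def[abs_def] J_def I_def using int[OF one, of a b m] int[OF one, of 0 1 1]
      by (subst Bochner_Integration.integral_add) (auto simp: \<phi>_def \<eta>_def)
    then have int\<theta>: "(\<integral>x. \<theta> x \<partial>lborel) = 0" using \<open>I \<noteq> 0\<close> by simp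
    have "(LINT t:{-R..y}|lborel. \<theta> t) = 0" if "y \<ge> R" for y
    proof -
      have "(\<lambda>t. indicator {-R..y} t *\<^sub>R \<theta> t) = \<theta>"
      proof
        fix t show "indicator {-R..y} t *\<^sub>R \<theta> t = \<theta> t"
          using z[of t] that by (cases "t \<in> {-R..R}") (simp_all add: indicator_def)
      qed
      then show ?thesis by (simp add: set_lebesgue_integral_def int\<theta>)
    qed
    then have \<psi>R: "\<psi> y = 0" if "y \<ge> R" for y
      using primitiveD(2)[OF p, of "-R" y] that by (auto simp: \<psi>_def R_def)
    have \<psi>L: "\<psi> y = 0" if "y \<le> -R" for y
    proof -
      have "-R \<notin> {a<..<b}" "-R \<notin> {0<..<1}" by (auto simp: R_def)
      then have R0: "\<theta> (-R) = 0" by (simp add: \<theta>_def \<phi>_def \<eta>_def bump_eq_0)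
      have "(\<lambda>t. indicator {y..-R} t *\<^sub>R \<theta> t) = (\<lambda>t. 0)"
      proof
        fix t
        show "indicator {y..-R} t *\<^sub>R \<theta> t = 0"
        proof (cases "t < -R")
          case True then show ?thesis by (simp add: z)
        next
          case False
          then have "t = -R \<or> t \<notin> {y..-R}" by auto
          then show ?thesis using R0 by (auto simp: indicator_def)
        qed
      qed
      then have "(LINT t:{y..-R}|lborel. \<theta> t) = 0" by (simp only: set_lebesgue_integral_def) simp
      then show ?thesis
        using primitiveD(2)[OF p that] by (simp add: \<psi>_def)
    qed
    have d\<psi>: "(\<psi> has_real_derivative \<theta> x) (at x)" for x
    proof -
      define A B where "A = x - 1" and "B = x + 1"
      have AB: "x \<in> {A<..<B}" by (auto simp: A_def B_def)
      have "((\<lambda>y. integral {A..y} \<theta>) has_real_derivative \<theta> x) (at x within {A..B})"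
        using AB by (intro integral_has_real_derivative) (auto intro: continuous_on_subset[OF c\<theta>])
      then have "((\<lambda>y. integral {A..y} \<theta>) has_real_derivative \<theta> x) (at x within {A<..<B})"
        by (rule DERIV_subset) auto
      from DERIV_add[OF DERIV_const[of "\<psi> A"] this] have "((\<lambda>y. \<psi> A + integral {A..y} \<theta>) has_real_derivative \<theta> x) (at x)"
        by (simp only: at_within_open[OF AB open_greaterThanLessThan] add_0)
      then show ?thesis
      proof (rule has_field_derivative_transform_within_open[of _ _ _ "{A<..<B}"])
        fix y assume "y \<in> {A<..<B}"
        then show "\<psi> A + integral {A..y} \<theta> = \<psi> y"
          using primitiveD(2)[OF p, of A y]
            set_borel_integral_eq_integral(2)[OF loc_int_Icc[OF primitiveD(1)[OF p]], of A y] by simp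
      qed (use AB in auto)
    qed
    have dd: "deriv \<psi> = \<theta>" using d\<psi> by (auto intro!: DERIV_imp_deriv)
    have "test_function \<psi>"
    proof (rule test_functionI)
      show "\<psi> x = 0" if "x \<notin> {-R..R}" for x using that \<psi>L[of x] \<psi>R[of x] by force
      fix n x
      show "(deriv ^^ n) \<psi> field_differentiable (at x)"
      proof (cases n)
        case 0 then show ?thesis using d\<psi> by (auto simp: field_differentiable_def)
      next
        case (Suc k)
        then have "(deriv ^^ n) \<psi> = (deriv ^^ k) \<theta>" by (simp add: funpow_Suc_right dd del: funpow.simps)
        then show ?thesis using smooth_gen_deriv(2)[OF smooth_gen_derivs[OF sm\<theta>]]
          by (auto simp: field_differentiable_def)
      qed
    qed
    from 0[OF this] have "(\<integral>x. u x * \<theta> x \<partial>lborel) = 0" by (simp add: dd)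
    moreover have "(\<integral>x. u x * \<theta> x \<partial>lborel) = (\<integral>x. u x * \<phi> x \<partial>lborel) - (J / I) * (\<integral>x. u x * \<eta> x \<partial>lborel)"
    proof -
      have "(\<lambda>x. u x * \<theta> x) = (\<lambda>x. u x * \<phi> x - (J / I) * (u x * \<eta> x))"
        by (simp add: \<theta>_def algebra_simps)
      then show ?thesis
        using int[OF u, of a b m] int[OF u, of 0 1 1] by (simp add: \<phi>_def \<eta>_def)
    qed
    moreover have "(\<integral>x. (u x - c) * \<phi> x \<partial>lborel) = (\<integral>x. u x * \<phi> x \<partial>lborel) - c * J"
      using int[OF u, of a b m] int[OF one, of a b m]
      by (simp add: J_def left_diff_distrib \<phi>_def)
    ultimately show ?thesis by (simp add: c_def \<phi>_def)
  qed
  moreover have "loc_int (\<lambda>x. u x - c)"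
    using loc_int_lin(3)[OF u, of "\<lambda>_. c"] by (simp add: loc_int_continuous)
  ultimately have "AE x in lborel. u x - c = 0" by (intro fundamental_lemma) auto
  then have "AE x in lborel. u x = c" by simp
  then show ?thesis by (rule that)
qed

text \<open>An indefinite integral of \<open>G\<close> has the same weak derivative as \<open>u\<close>, so the two differ by a constant.\<close>

lemma weak_imp_primitive:
  assumes G: "loc_int G" and u: "loc_int u"
    and w: "\<And>\<phi>. test_function \<phi> \<Longrightarrow> (\<integral>x. u x * deriv \<phi> x \<partial>lborel) = - (\<integral>x. G x * \<phi> x \<partial>lborel)"
  obtains F where "primitive F G" "AE x in lborel. u x = F x"
proof -
  obtain F0 where F0: "primitive F0 G" using primitive_exists[OF G] .
  note lF = loc_int_continuous[OF primitive_continuous[OF F0]]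
  have "(\<integral>x. (u x - F0 x) * deriv \<phi> x \<partial>lborel) = 0" if \<phi>: "test_function \<phi>" for \<phi>
  proof -
    obtain R where R: "R > 0" "\<And>x. x \<notin> {-R<..<R} \<Longrightarrow> \<phi> x = 0"
        "\<And>x. x \<notin> {-R<..<R} \<Longrightarrow> deriv \<phi> x = 0"
      using test_function_support[OF \<phi>] by blast
    note c = test_function_deriv(3)[OF test_function_deriv(1)[OF \<phi>]]
    show ?thesis
      using loc_int_times_integrable[OF u c R(3)] loc_int_times_integrable[OF lF c R(3)]
        w[OF \<phi>] primitive_by_parts[OF F0 \<phi>]
      by (simp add: left_diff_distrib)
  qed
  then obtain c where c: "AE x in lborel. u x - F0 x = c"
    using du_Bois_Reymond[OF loc_int_lin(3)[OF u lF]] by blast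
  show ?thesis
  proof
    show "primitive (\<lambda>x. F0 x + c) G" using F0 by (simp add: primitive_def)
    show "AE x in lborel. u x = F0 x + c" using c by eventually_elim auto
  qed
qed

section \<open>Borel representatives of Sobolev functions\<close>

abbreviation mf :: "(real \<Rightarrow> real) \<Rightarrow> meas_fun" where "mf \<equiv> abs_meas_fun"

lemma ae_eq_borel:
  "F \<in> borel_measurable borel \<Longrightarrow> G \<in> borel_measurable borel \<Longrightarrow>
    ae_eq F G \<longleftrightarrow> (AE x in lborel. F x = G x)"
  by (simp add: ae_eq_def measurable_completion AE_completion_iff)

lemma ae_eq_refl_borel: "F \<in> borel_measurable borel \<Longrightarrow> ae_eq F F"
  by (simp add: ae_eq_borel)

lemma mf_eq_iff:
  assumes "F \<in> borel_measurable borel" "G \<in> borel_measurable borel"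
  shows "mf F = mf G \<longleftrightarrow> (AE x in lborel. F x = G x)"
  using Quotient_rel[OF Quotient_meas_fun, of F G] assms
  by (simp add: ae_eq_borel)

text \<open>Arguments with product measures then take place over \<open>lborel\<close> rather than over its completion.\<close>

lemma borel_representative:
  obtains F where "F \<in> borel_measurable borel" "f = mf F"
proof -
  obtain G where G: "ae_eq G G" "f = mf G"
    using Quotient_abs_rep[OF Quotient_meas_fun, of f] Quotient_rep_reflp[OF Quotient_meas_fun, of f]
    by metis
  then have "G \<in> borel_measurable (completion lborel)" by (simp add: ae_eq_def)
  from completion_ex_borel_measurable_real[OF this]
  obtain F where F: "F \<in> borel_measurable borel" "AE x in lborel. G x = F x"
    by auto
  then have "ae_eq G F"
    using G by (simp add: ae_eq_def AE_completion measurable_completion)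
  then have "mf G = mf F" by (rule Quotient_rel_abs[OF Quotient_meas_fun])
  with F G show ?thesis by (intro that) auto
qed

lemma mf_arith:
  assumes "F \<in> borel_measurable borel" "G \<in> borel_measurable borel"
  shows "mf F + mf G = mf (\<lambda>x. F x + G x)" "mf F - mf G = mf (\<lambda>x. F x - G x)"
  using assms by (simp_all add: plus_meas_fun.abs_eq minus_meas_fun.abs_eq ae_eq_refl_borel)

lemma mf_scaleR:
  "F \<in> borel_measurable borel \<Longrightarrow> c *\<^sub>R mf F = mf (\<lambda>x. c * F x)"
  by (simp add: scaleR_meas_fun.abs_eq ae_eq_refl_borel)

lemma mf_zero: "mf (\<lambda>_. 0) = 0"
  by (simp add: zero_meas_fun.abs_eq)

text \<open>The \<open>p\<close>-th power of the \<open>L\<^sub>p\<close> norm of \<open>f\<close>, possibly infinite.\<close>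

abbreviation pow_int :: "real \<Rightarrow> (real \<Rightarrow> real) \<Rightarrow> ennreal" where
  "pow_int p f \<equiv> \<integral>\<^sup>+ x. ennreal (\<bar>f x\<bar> powr p) \<partial>lborel"

lemma Lp_weight_integral_mf:
  "F \<in> borel_measurable borel \<Longrightarrow>
    Lp_weight_integral p w (mf F) = pow_int p (\<lambda>x. F x * w x)"
  by (simp add: Lp_weight_integral.abs_eq ae_eq_refl_borel nn_integral_completion)

lemma Lp_weight_norm_le:
  assumes "Lp_weight_integral q w f \<le> ennreal (c powr q)" "c \<ge> 0" "q > 0"
  shows "Lp_weight_norm q w f \<le> ennreal c"
proof -
  have "enn2real (Lp_weight_integral q w f) \<le> c powr q"
    using assms(1) by (simp add: enn2real_leI)
  then have "enn2real (Lp_weight_integral q w f) powr (1/q) \<le> (c powr q) powr (1/q)"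
    using assms by (intro powr_mono2) auto
  then show ?thesis
    using assms by (auto simp: Lp_weight_norm_def powr_powr top_unique intro!: ennreal_leI)
qed

lemma Lp_weight_norm_ge:
  assumes "ennreal (c powr q) \<le> Lp_weight_integral q w f" "c \<ge> 0" "q > 0"
  shows "ennreal c \<le> Lp_weight_norm q w f"
proof (cases "Lp_weight_integral q w f = \<infinity>")
  case False
  then have "c powr q \<le> enn2real (Lp_weight_integral q w f)"
    using assms(1) by (metis enn2real_ennreal enn2real_mono ennreal_enn2real_if infinity_ennreal_def powr_ge_zero top.not_eq_extremum)
  then have "(c powr q) powr (1/q) \<le> enn2real (Lp_weight_integral q w f) powr (1/q)"
    using assms by (intro powr_mono2) auto
  with False show ?thesis
    using assms by (auto simp: Lp_weight_norm_def powr_powr intro!: ennreal_leI)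
qed (simp add: Lp_weight_norm_def)

lemma Lp_weight_iff: "f \<in> Lp_weight q w \<longleftrightarrow> Lp_weight_integral q w f < \<infinity>"
  by (auto simp: Lp_weight_def Lp_weight_norm_def less_top)

lemma powr_add_le:
  fixes x y :: real
  assumes "0 \<le> x" "0 \<le> y" "0 < q"
  shows "(x + y) powr q \<le> 2 powr q * (x powr q + y powr q)"
proof -
  have "(x + y) powr q \<le> (2 * max x y) powr q" using assms by (intro powr_mono2) auto
  also have "\<dots> = 2 powr q * max x y powr q" using assms by (simp add: powr_mult)
  also have "\<dots> \<le> 2 powr q * (x powr q + y powr q)"
    by (intro mult_left_mono) (auto simp: max_def)
  finally show ?thesis .
qed

lemma subspace_Lp_weight:
  assumes [measurable]: "w \<in> borel_measurable borel" and q: "q > 0"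
  shows "subspace (Lp_weight q w)"
  unfolding subspace_def
proof (intro conjI ballI allI)
  show "0 \<in> Lp_weight q w"
    using q by (simp add: Lp_weight_iff Lp_weight_integral_mf flip: mf_zero)
next
  fix f g assume fg: "f \<in> Lp_weight q w" "g \<in> Lp_weight q w"
  obtain F where F[measurable]: "F \<in> borel_measurable borel" and f: "f = mf F"
    by (rule borel_representative)
  obtain G where G[measurable]: "G \<in> borel_measurable borel" and g: "g = mf G"
    by (rule borel_representative)
  have "pow_int q (\<lambda>x. (F x + G x) * w x)
    \<le> (\<integral>\<^sup>+ x. ennreal (2 powr q) * (ennreal (\<bar>F x * w x\<bar> powr q) + ennreal (\<bar>G x * w x\<bar> powr q)) \<partial>lborel)"
  proof (intro nn_integral_mono)
    fix x
    have "\<bar>(F x + G x) * w x\<bar> powr q \<le> (\<bar>F x * w x\<bar> + \<bar>G x * w x\<bar>) powr q"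
      using q by (intro powr_mono2) (auto simp: distrib_right abs_triangle_ineq)
    also have "\<dots> \<le> 2 powr q * (\<bar>F x * w x\<bar> powr q + \<bar>G x * w x\<bar> powr q)"
      using q by (intro powr_add_le) auto
    finally show "ennreal (\<bar>(F x + G x) * w x\<bar> powr q) \<le> ennreal (2 powr q) * (ennreal (\<bar>F x * w x\<bar> powr q) + ennreal (\<bar>G x * w x\<bar> powr q))"
      by (simp add: ennreal_leI flip: ennreal_plus ennreal_mult)
  qed
  also have "\<dots> = ennreal (2 powr q) * (Lp_weight_integral q w f + Lp_weight_integral q w g)"
    by (simp add: f g Lp_weight_integral_mf nn_integral_cmult nn_integral_add)
  also have "\<dots> < \<infinity>" using fg by (simp add: Lp_weight_iff ennreal_mult_less_top)
  finally show "f + g \<in> Lp_weight q w"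
    by (simp add: Lp_weight_iff f g mf_arith Lp_weight_integral_mf)
next
  fix c f assume f: "f \<in> Lp_weight q w"
  obtain F where F[measurable]: "F \<in> borel_measurable borel" and fF: "f = mf F"
    by (rule borel_representative)
  have "pow_int q (\<lambda>x. c * F x * w x)
      = ennreal (\<bar>c\<bar> powr q) * Lp_weight_integral q w f"
    by (simp add: fF Lp_weight_integral_mf abs_mult powr_mult ennreal_mult mult.assoc flip: nn_integral_cmult)
  then show "c *\<^sub>R f \<in> Lp_weight q w"
    using f by (simp add: Lp_weight_iff fF mf_scaleR Lp_weight_integral_mf ennreal_mult_less_top)
qed

lemma has_weak_deriv_mf:
  assumes F: "F \<in> borel_measurable borel" and G: "G \<in> borel_measurable borel"
  shows "has_weak_deriv k (mf F) (mf G) \<longleftrightarrow> loc_int F \<and> loc_int G \<and>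
    (\<forall>\<phi>. test_function \<phi> \<longrightarrow>
      (\<integral>x. F x * (deriv ^^ k) \<phi> x \<partial>lborel) = (- 1) ^ k * (\<integral>x. G x * \<phi> x \<partial>lborel))"
proof -
  have [simp]: "(\<integral>x. H x * (deriv ^^ j) \<phi> x \<partial>lebesgue) = (\<integral>x. H x * (deriv ^^ j) \<phi> x \<partial>lborel)"
    if "test_function \<phi>" and [measurable]: "H \<in> borel_measurable borel" for \<phi> H j
  proof -
    have [measurable]: "(deriv ^^ j) \<phi> \<in> borel_measurable borel"
      using test_function_deriv(3)[OF test_function_derivs[OF that(1)]]
      by (intro borel_measurable_continuous_onI)
    show ?thesis by (intro integral_completion) measurable
  qed
  from this[where j = 0] have [simp]: "(\<integral>x. H x * \<phi> x \<partial>lebesgue) = (\<integral>x. H x * \<phi> x \<partial>lborel)"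
    if "test_function \<phi>" "H \<in> borel_measurable borel" for \<phi> H using that by simp
  show ?thesis
    using assms by (simp add: has_weak_deriv.abs_eq ae_eq_refl_borel loc_int_iff_locally_integrable)
qed

text \<open>Two weak derivatives of the same order have the same integrals against all test functions.\<close>

lemma weak_deriv_unique:
  assumes "has_weak_deriv k f g" "has_weak_deriv k f g'"
  shows "g = g'"
proof -
  obtain F where F: "F \<in> borel_measurable borel" "f = mf F" by (rule borel_representative)
  obtain G where G: "G \<in> borel_measurable borel" "g = mf G" by (rule borel_representative)
  obtain G' where G': "G' \<in> borel_measurable borel" "g' = mf G'" by (rule borel_representative)
  note w = assms(1)[unfolded F(2) G(2) has_weak_deriv_mf[OF F(1) G(1)]]
    and w' = assms(2)[unfolded F(2) G'(2) has_weak_deriv_mf[OF F(1) G'(1)]]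
  from w w' have l: "loc_int G" "loc_int G'" by blast+
  have "AE x in lborel. G x - G' x = 0"
  proof (rule fundamental_lemma)
    fix c d m
    have eq: "(\<integral>x. G x * bump c d m x \<partial>lborel) = (\<integral>x. G' x * bump c d m x \<partial>lborel)"
    proof -
      have "(-1) ^ k * (\<integral>x. G x * bump c d m x \<partial>lborel) = (-1) ^ k * (\<integral>x. G' x * bump c d m x \<partial>lborel)"
        using w w' test_function_bump[of c d m] by metis
      then show ?thesis by (simp only: mult_cancel_left) simp
    qed
    have b: "integrable lborel (\<lambda>x. H x * bump c d m x)" if "loc_int H" for H
      by (rule loc_int_times_integrable[OF that test_function_deriv(3)[OF test_function_bump],
            where R = "\<bar>c\<bar> + \<bar>d\<bar> + 1"]) (rule bump_eq_0, auto)
    show "(\<integral>x. (G x - G' x) * bump c d m x \<partial>lborel) = 0"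
      using b[OF l(1)] b[OF l(2)] eq by (simp add: left_diff_distrib)
  qed (rule loc_int_lin(3)[OF l])
  then have "AE x in lborel. G x = G' x" by simp
  then show ?thesis using G G' by (simp add: mf_eq_iff)
qed

lemma weak_deriv_eqI: "has_weak_deriv k f g \<Longrightarrow> weak_deriv k f = g"
  unfolding weak_deriv_def by (rule the_equality) (auto intro: weak_deriv_unique)

text \<open>Sobolev functions are handled through such sequences of honest functions: \<open>F k\<close> represents the \<open>k\<close>-th weak
  derivative, and below \<open>r\<close> it is continuous, so that its point values make sense.\<close>

definition sobolev_chain :: "nat \<Rightarrow> (nat \<Rightarrow> real \<Rightarrow> real) \<Rightarrow> bool" where
  "sobolev_chain r F \<longleftrightarrow> loc_int (F r) \<and> (\<forall>k<r. primitive (F k) (F (Suc k)))"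

lemma sobolev_chain_loc_int:
  assumes "sobolev_chain r F" "k \<le> r"
  shows "loc_int (F k)"
proof (cases "k = r")
  case False
  then show ?thesis
    using assms by (intro loc_int_continuous primitive_continuous[of _ "F (Suc k)"])
      (auto simp: sobolev_chain_def)
qed (use assms in \<open>simp add: sobolev_chain_def\<close>)

lemma sobolev_chain_measurable:
  "sobolev_chain r F \<Longrightarrow> k \<le> r \<Longrightarrow> F k \<in> borel_measurable borel"
  using sobolev_chain_loc_int loc_int_def by blast

lemma sobolev_chain_has_weak_deriv:
  assumes c: "sobolev_chain r F" and "k \<le> r"
  shows "has_weak_deriv k (mf (F 0)) (mf (F k))"
proof -
  have "(\<integral>x. F 0 x * (deriv ^^ k) \<phi> x \<partial>lborel) = (- 1) ^ k * (\<integral>x. F k x * \<phi> x \<partial>lborel)"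
    if "test_function \<phi>" for \<phi>
    using \<open>k \<le> r\<close> that
  proof (induction k arbitrary: \<phi>)
    case (Suc k)
    have "(\<integral>x. F 0 x * (deriv ^^ Suc k) \<phi> x \<partial>lborel) = (\<integral>x. F 0 x * (deriv ^^ k) (deriv \<phi>) x \<partial>lborel)"
      by (simp only: funpow_Suc_right o_def)
    also have "\<dots> = (- 1) ^ k * (\<integral>x. F k x * deriv \<phi> x \<partial>lborel)"
      using Suc.prems by (intro Suc.IH test_function_deriv(1)) auto
    also have "(\<integral>x. F k x * deriv \<phi> x \<partial>lborel) = - (\<integral>x. F (Suc k) x * \<phi> x \<partial>lborel)"
      using Suc.prems c by (intro primitive_by_parts) (auto simp: sobolev_chain_def)
    finally show ?case by simp
  qed simp
  moreover have "loc_int (F 0)" "loc_int (F k)"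
    using sobolev_chain_loc_int[OF c] assms(2) by auto
  moreover have "F 0 \<in> borel_measurable borel" "F k \<in> borel_measurable borel"
    using sobolev_chain_measurable[OF c] assms(2) by auto
  ultimately show ?thesis by (simp only: has_weak_deriv_mf) blast
qed

lemma sobolev_chain_weak_deriv:
  "sobolev_chain r F \<Longrightarrow> k \<le> r \<Longrightarrow> weak_deriv k (mf (F 0)) = mf (F k)"
  by (rule weak_deriv_eqI[OF sobolev_chain_has_weak_deriv])

text \<open>Only the derivatives of order \<open>k\<close> and \<open>Suc k\<close> of \<open>f\<close> are compared: testing the former with \<open>deriv \<phi>\<close> shows
  that the latter is its first weak derivative. Representatives are then corrected on null sets from one order to the next.\<close>

lemma sobolev_chain_exists:
  assumes "\<And>k. k \<le> r \<Longrightarrow> \<exists>g. has_weak_deriv k f g"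
  obtains F where "sobolev_chain r F" "f = mf (F 0)"
proof -
  obtain H where H: "H \<in> borel_measurable borel" "f = mf H" by (rule borel_representative)
  have "\<exists>G. G \<in> borel_measurable borel \<and> has_weak_deriv k f (mf G)" if "k \<le> r" for k
    using assms[OF that] borel_representative by metis
  then obtain G where G: "\<And>k. k \<le> r \<Longrightarrow> G k \<in> borel_measurable borel"
      "\<And>k. k \<le> r \<Longrightarrow> has_weak_deriv k f (mf (G k))" by metis
  have w: "loc_int H" "loc_int (G k)" "test_function \<phi> \<Longrightarrow>
      (\<integral>x. H x * (deriv ^^ k) \<phi> x \<partial>lborel) = (- 1) ^ k * (\<integral>x. G k x * \<phi> x \<partial>lborel)"
    if "k \<le> r" for k \<phi>
    using G(2)[OF that] by (simp_all add: H(2) has_weak_deriv_mf[OF H(1) G(1)[OF that]])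
  have H0: "mf H = mf (G 0)"
  proof (rule weak_deriv_unique)
    show "has_weak_deriv 0 f (mf H)" unfolding H(2) has_weak_deriv_mf[OF H(1) H(1)]
      using w(1)[of 0] by simp
    show "has_weak_deriv 0 f (mf (G 0))" using G(2)[of 0] by simp
  qed
  have "\<exists>F. primitive F (G (Suc k)) \<and> (AE x in lborel. G k x = F x)" if k: "k < r" for k
  proof -
    have "(\<integral>x. G k x * deriv \<phi> x \<partial>lborel) = - (\<integral>x. G (Suc k) x * \<phi> x \<partial>lborel)"
      if \<phi>: "test_function \<phi>" for \<phi>
    proof -
      have "(- 1) ^ k * (\<integral>x. G k x * deriv \<phi> x \<partial>lborel) = (\<integral>x. H x * (deriv ^^ k) (deriv \<phi>) x \<partial>lborel)"
        using k w(3)[of k "deriv \<phi>"] test_function_deriv(1)[OF \<phi>] by simp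
      also have "\<dots> = (\<integral>x. H x * (deriv ^^ Suc k) \<phi> x \<partial>lborel)"
        by (simp only: funpow_Suc_right o_def)
      also have "\<dots> = (- 1) ^ k * - (\<integral>x. G (Suc k) x * \<phi> x \<partial>lborel)"
        using k w(3)[of "Suc k" \<phi>] \<phi> by simp
      finally show ?thesis by (simp only: mult_cancel_left) simp
    qed
    then show ?thesis
      using weak_imp_primitive[of "G (Suc k)" "G k"] w(2) k by (metis Suc_leI less_imp_le)
  qed
  then obtain F where F: "\<And>k. k < r \<Longrightarrow> primitive (F k) (G (Suc k))"
      "\<And>k. k < r \<Longrightarrow> AE x in lborel. G k x = F k x" by metis
  define F' where "F' k = (if k < r then F k else G k)" for k
  have ae: "AE x in lborel. G k x = F' k x" for k
    using F(2)[of k] by (auto simp: F'_def)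
  have pc: "primitive K M'" if "primitive K M" "loc_int M'" "AE x in lborel. M x = M' x" for K M M'
    using that unfolding primitive_def loc_int_def set_lebesgue_integral_def
    by (auto intro!: integral_cong_AE elim!: eventually_mono simp: loc_int_def set_integrable_def)
  have m: "loc_int (F' k)" if "k \<le> r" for k
    unfolding F'_def using that w(2)[of k] loc_int_continuous[OF primitive_continuous[OF F(1)]] by auto
  have "sobolev_chain r F'"
    unfolding sobolev_chain_def
  proof (intro conjI allI impI)
    show "loc_int (F' r)" by (rule m) simp
    fix k assume k: "k < r"
    then have "primitive (F' k) (G (Suc k))" using F(1) by (simp add: F'_def)
    then show "primitive (F' k) (F' (Suc k))" using k by (intro pc[OF _ m ae]) auto
  qed
  moreover have "mf (G 0) = mf (F' 0)"
    using ae[of 0] G(1)[of 0] m[of 0] by (simp add: mf_eq_iff loc_int_def)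
  ultimately show ?thesis using H0 H(2) by (intro that) simp_all
qed

lemma sobolev_ball_chain:
  assumes f: "f \<in> sobolev_ball r p w" and p: "p \<ge> 1"
  obtains F where "sobolev_chain r F" "f = mf (F 0)"
    "\<And>k. k \<le> r \<Longrightarrow> pow_int p (\<lambda>x. F k x * w x) \<le> 1"
proof -
  have sp: "\<exists>g \<in> Lp_weight p w. has_weak_deriv k f g" if "k \<le> r" for k
    using f that by (auto simp: sobolev_ball_def sobolev_space_def)
  then obtain F where F: "sobolev_chain r F" "f = mf (F 0)"
    using sobolev_chain_exists[of r f] by blast
  have "pow_int p (\<lambda>x. F k x * w x) \<le> 1" if k: "k \<le> r" for k
  proof -
    let ?N = "\<lambda>k. enn2real (Lp_weight_norm p w (weak_deriv k f)) powr p"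
    have wk: "weak_deriv k f = mf (F k)" using sobolev_chain_weak_deriv[OF F(1) k] F(2) by simp
    have fin: "Lp_weight_integral p w (mf (F k)) < \<infinity>"
      using sp[OF k] weak_deriv_eqI wk Lp_weight_iff by metis
    have "(\<Sum>k\<le>r. ?N k) powr (1/p) \<le> 1"
      using f by (simp add: sobolev_ball_def sobolev_norm_def)
    then have "((\<Sum>k\<le>r. ?N k) powr (1/p)) powr p \<le> 1 powr p"
      using p by (intro powr_mono2) auto
    then have "(\<Sum>k\<le>r. ?N k) \<le> 1" using p by (simp add: powr_powr sum_nonneg)
    moreover have "?N k \<le> (\<Sum>k\<le>r. ?N k)" using k by (intro member_le_sum) auto
    ultimately have "?N k \<le> 1" by linarith
    moreover have "Lp_weight_integral p w (mf (F k)) \<noteq> \<infinity>" using fin by auto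
    ultimately have "enn2real (Lp_weight_integral p w (mf (F k))) \<le> 1"
      using p by (simp add: wk Lp_weight_norm_def powr_powr)
    then have "Lp_weight_integral p w (mf (F k)) \<le> 1"
      using fin by (metis ennreal_1 ennreal_enn2real ennreal_leI infinity_ennreal_def)
    then show ?thesis
      by (simp add: Lp_weight_integral_mf sobolev_chain_measurable[OF F(1) k])
  qed
  with F show ?thesis by (rule that)
qed

text \<open>The \<open>Suc r\<close> summands of the Sobolev norm share the bound \<open>1\<close> equally.\<close>

lemma sobolev_chain_in_ball:
  assumes F: "sobolev_chain r F" and p: "p \<ge> 1"
    and I: "\<And>k. k \<le> r \<Longrightarrow> pow_int p (\<lambda>x. F k x * w x) \<le> ennreal (1 / real (Suc r))"
  shows "mf (F 0) \<in> sobolev_ball r p w"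
proof -
  have I': "Lp_weight_integral p w (mf (F k)) \<le> ennreal (1 / real (Suc r))" if "k \<le> r" for k
    using I[OF that] by (simp add: Lp_weight_integral_mf sobolev_chain_measurable[OF F that])
  have L: "mf (F k) \<in> Lp_weight p w" if "k \<le> r" for k
    using le_less_trans[OF I'[OF that], of \<infinity>] by (simp add: Lp_weight_iff)
  have n: "enn2real (Lp_weight_norm p w (weak_deriv k (mf (F 0)))) powr p \<le> 1 / real (Suc r)"
    if k: "k \<le> r" for k
  proof -
    have "enn2real (Lp_weight_integral p w (mf (F k))) \<le> 1 / real (Suc r)"
      using I'[OF k] by (intro enn2real_leI) auto
    then show ?thesis using p L[OF k]
      by (simp add: sobolev_chain_weak_deriv[OF F k] Lp_weight_norm_def Lp_weight_iff powr_powr)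
  qed
  have "(\<Sum>k\<le>r. enn2real (Lp_weight_norm p w (weak_deriv k (mf (F 0)))) powr p) \<le> real (card {..r}) * (1 / real (Suc r))"
    by (rule sum_bounded_above) (use n in auto)
  then have "(\<Sum>k\<le>r. enn2real (Lp_weight_norm p w (weak_deriv k (mf (F 0)))) powr p) \<le> 1"
    by simp
  then have "sobolev_norm r p w (mf (F 0)) \<le> 1 powr (1/p)"
    unfolding sobolev_norm_def using p by (intro powr_mono2) (auto intro: sum_nonneg)
  moreover have "mf (F 0) \<in> sobolev_space r p w"
    unfolding sobolev_space_def using L sobolev_chain_has_weak_deriv[OF F] by blast
  ultimately show ?thesis by (simp add: sobolev_ball_def)
qed

section \<open>The Schur test and the Taylor remainder\<close>

text \<open>A substitute for Hoelder's inequality: \<open>t powr q\<close> is at most \<open>\<mu> powr q\<close> below the level \<open>\<mu>\<close> and at most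
  \<open>\<mu> powr (q - p) * t powr p\<close> above it. Choosing \<open>\<mu>\<close>, possibly depending on a point, and integrating gives the sharp
  order of growth.\<close>

lemma powr_le_split:
  fixes t \<mu> p q :: real
  assumes "0 \<le> t" "0 < \<mu>" "0 < q" "q \<le> p"
  shows "t powr q \<le> \<mu> powr q + \<mu> powr (q - p) * t powr p"
proof (cases "t \<le> \<mu>")
  case True
  then have "t powr q \<le> \<mu> powr q" using assms by (intro powr_mono2) auto
  then show ?thesis by (smt (verit) mult_nonneg_nonneg powr_ge_zero)
next
  case False
  then have "t powr (q - p) \<le> \<mu> powr (q - p)" using assms by (intro powr_mono2') auto
  then have "t powr (q - p) * t powr p \<le> \<mu> powr (q - p) * t powr p"
    by (intro mult_right_mono) auto
  then show ?thesis using False assms by (simp flip: powr_add) (smt (verit) powr_ge_zero)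
qed

text \<open>The splitting at the level \<open>m = u / (2 * A)\<close> bounds \<open>u = 2 * A * m\<close> by \<open>m * A\<close>, which is half of it, plus
  \<open>m powr (1 - p)\<close> times the integral on the right.\<close>

lemma Jensen_kernel:
  fixes k g :: "real \<Rightarrow> real"
  assumes [measurable]: "k \<in> borel_measurable borel" "g \<in> borel_measurable borel"
    and k: "\<And>t. 0 \<le> k t" and g: "\<And>t. 0 \<le> g t" and p: "p \<ge> 1" and A: "A > 0"
    and mass: "(\<integral>\<^sup>+ t. ennreal (k t) \<partial>lborel) \<le> ennreal A"
    and u: "ennreal u \<le> (\<integral>\<^sup>+ t. ennreal (k t * g t) \<partial>lborel)" "u \<ge> 0"
  shows "ennreal (u powr p) \<le> ennreal (2 powr p * A powr (p - 1)) * (\<integral>\<^sup>+ t. ennreal (k t * g t powr p) \<partial>lborel)"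
proof (cases "u = 0 \<or> (\<integral>\<^sup>+ t. ennreal (k t * g t powr p) \<partial>lborel) = \<infinity>")
  case True
  then show ?thesis using p A by (auto simp: ennreal_mult_top)
next
  case False
  define J where "J = (\<integral>\<^sup>+ t. ennreal (k t * g t powr p) \<partial>lborel)"
  obtain j where j: "J = ennreal j" "j \<ge> 0" using False by (cases J) (auto simp: J_def)
  define m where "m = u / (2 * A)"
  have m: "m > 0" using False u(2) A by (auto simp: m_def)
  have "ennreal u \<le> (\<integral>\<^sup>+ t. ennreal (k t * g t) \<partial>lborel)" by (rule u)
  also have "\<dots> \<le> (\<integral>\<^sup>+ t. ennreal m * ennreal (k t) + ennreal (m powr (1 - p)) * ennreal (k t * g t powr p) \<partial>lborel)"
  proof (intro nn_integral_mono)
    fix t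
    have "g t \<le> m + m powr (1 - p) * g t powr p"
      using powr_le_split[of "g t" m 1 p] g[of t] m p by (cases "g t = 0") auto
    then have "k t * g t \<le> k t * (m + m powr (1 - p) * g t powr p)"
      by (intro mult_left_mono k)
    also have "\<dots> = m * k t + m powr (1 - p) * (k t * g t powr p)" by (simp add: algebra_simps)
    finally show "ennreal (k t * g t) \<le> ennreal m * ennreal (k t) + ennreal (m powr (1 - p)) * ennreal (k t * g t powr p)"
      using m k[of t] by (simp add: ennreal_leI flip: ennreal_mult' ennreal_plus)
  qed
  also have "\<dots> = ennreal m * (\<integral>\<^sup>+ t. ennreal (k t) \<partial>lborel) + ennreal (m powr (1 - p)) * J"
    by (simp add: nn_integral_add nn_integral_cmult J_def)
  also have "\<dots> \<le> ennreal m * ennreal A + ennreal (m powr (1 - p)) * ennreal j"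
    unfolding j by (intro add_mono mult_left_mono mass) auto
  also have "\<dots> = ennreal (m * A + m powr (1 - p) * j)"
    using m A j by (simp add: ennreal_mult ennreal_plus)
  finally have "u \<le> m * A + m powr (1 - p) * j"
    using m A j by (subst (asm) ennreal_le_iff) auto
  then have "m * A \<le> m powr (1 - p) * j" using A by (simp add: m_def field_simps)
  then have "m powr (p - 1) * (m * A) \<le> m powr (p - 1) * (m powr (1 - p) * j)"
    by (intro mult_left_mono) auto
  also have "\<dots> = j" using m by (simp add: mult.assoc[symmetric] flip: powr_add)
  finally have *: "m powr p * A \<le> j"
    using m by (simp add: powr_diff field_simps)
  have "u powr p = (2 * A * m) powr p" using A by (simp add: m_def)
  also have "\<dots> = 2 powr p * A powr p * m powr p" using A m by (simp add: powr_mult)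
  also have "\<dots> = 2 powr p * A powr (p - 1) * (m powr p * A)"
    using A by (simp add: powr_diff field_simps)
  also have "\<dots> \<le> 2 powr p * A powr (p - 1) * j" by (intro mult_left_mono *) auto
  finally show ?thesis unfolding J_def[symmetric] j(1) using j(2)
    by (simp add: ennreal_leI flip: ennreal_mult)
qed

text \<open>Jensen in the variable \<open>t\<close> uses the row bound; after exchanging the integrals the column bound remains.\<close>

lemma Schur_test:
  fixes K :: "real \<Rightarrow> real \<Rightarrow> real" and g u :: "real \<Rightarrow> real"
  assumes K[measurable]: "case_prod K \<in> borel_measurable (borel \<Otimes>\<^sub>M borel)" and g[measurable]: "g \<in> borel_measurable borel"
    and K0: "\<And>x t. 0 \<le> K x t" and g0: "\<And>t. 0 \<le> g t" and p: "p \<ge> 1" and A: "A > 0" and B: "B \<ge> 0"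
    and row: "\<And>x. (\<integral>\<^sup>+ t. ennreal (K x t) \<partial>lborel) \<le> ennreal A"
    and col: "\<And>t. (\<integral>\<^sup>+ x. ennreal (K x t) \<partial>lborel) \<le> ennreal B"
    and u: "\<And>x. ennreal \<bar>u x\<bar> \<le> (\<integral>\<^sup>+ t. ennreal (K x t * g t) \<partial>lborel)"
  shows "pow_int p u
    \<le> ennreal (2 powr p * A powr (p - 1) * B) * (\<integral>\<^sup>+ t. ennreal (g t powr p) \<partial>lborel)"
proof -
  have [measurable]: "(\<lambda>(x,t). K x t) \<in> borel_measurable (lborel \<Otimes>\<^sub>M lborel)" using K by (simp cong: measurable_cong_sets)
  have [measurable]: "K x \<in> borel_measurable borel" "(\<lambda>x. K x t) \<in> borel_measurable borel" for x t
    using measurable_Pair2[OF K, of x] measurable_Pair1[OF K, of t] by auto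
  have "pow_int p u
    \<le> (\<integral>\<^sup>+ x. ennreal (2 powr p * A powr (p - 1)) * (\<integral>\<^sup>+ t. ennreal (K x t * g t powr p) \<partial>lborel) \<partial>lborel)"
    by (intro nn_integral_mono Jensen_kernel[OF _ g K0 g0 p A row u]) auto
  also have "\<dots> = ennreal (2 powr p * A powr (p - 1)) * (\<integral>\<^sup>+ x. (\<integral>\<^sup>+ t. ennreal (K x t * g t powr p) \<partial>lborel) \<partial>lborel)"
    by (intro nn_integral_cmult) measurable
  also have "(\<integral>\<^sup>+ x. (\<integral>\<^sup>+ t. ennreal (K x t * g t powr p) \<partial>lborel) \<partial>lborel)
      = (\<integral>\<^sup>+ t. (\<integral>\<^sup>+ x. ennreal (K x t * g t powr p) \<partial>lborel) \<partial>lborel)"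
    by (rule lborel_pair.Fubini'[symmetric]) measurable
  also have "\<dots> = (\<integral>\<^sup>+ t. (\<integral>\<^sup>+ x. ennreal (K x t) \<partial>lborel) * ennreal (g t powr p) \<partial>lborel)"
    by (simp add: ennreal_mult K0 nn_integral_multc)
  also have "\<dots> \<le> (\<integral>\<^sup>+ t. ennreal B * ennreal (g t powr p) \<partial>lborel)"
    by (intro nn_integral_mono mult_right_mono col) auto
  also have "\<dots> = ennreal B * (\<integral>\<^sup>+ t. ennreal (g t powr p) \<partial>lborel)"
    by (intro nn_integral_cmult) measurable
  finally show ?thesis using B
    by (simp add: ennreal_mult mult.assoc mult_left_mono)
qed

lemma primitive_increment_le:
  assumes P: "primitive F G" and "c \<le> x"
  shows "ennreal \<bar>F x - F c\<bar> \<le> (\<integral>\<^sup>+ t. ennreal (indicator {c<..x} t * \<bar>G t\<bar>) \<partial>lborel)"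
proof -
  have i: "integrable lborel (\<lambda>t. indicator {c..x} t *\<^sub>R G t)"
    using loc_int_Icc[OF primitiveD(1)[OF P]] by (simp add: set_integrable_def)
  have "ennreal \<bar>F x - F c\<bar> = ennreal (norm (\<integral>t. indicator {c..x} t *\<^sub>R G t \<partial>lborel))"
    using primitiveD(2)[OF P \<open>c \<le> x\<close>] by (simp add: set_lebesgue_integral_def)
  also have "\<dots> \<le> (\<integral>\<^sup>+ t. norm (indicator {c..x} t *\<^sub>R G t) \<partial>lborel)"
    by (rule integral_norm_bound_ennreal[OF i])
  also have "\<dots> = (\<integral>\<^sup>+ t. ennreal (indicator {c<..x} t * \<bar>G t\<bar>) \<partial>lborel)"
    using AE_lborel_singleton[of c]
    by (intro nn_integral_cong_AE, eventually_elim) (auto simp: indicator_def)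
  finally show ?thesis .
qed

lemma DERIV_power_fact:
  "((\<lambda>x. (x - c) ^ Suc j / fact (Suc j)) has_real_derivative (x - c) ^ j / fact j) (at (x::real))"
proof -
  have "((\<lambda>x. (x - c) ^ Suc j) has_real_derivative real (Suc j) * (x - c) ^ j) (at x)"
    by (auto intro!: derivative_eq_intros simp del: of_nat_Suc power_Suc)
  from DERIV_cdivide[OF this, of "fact (Suc j)"] show ?thesis
    by (simp add: fact_Suc del: of_nat_Suc power_Suc)
qed

text \<open>Each step of the induction integrates the bound for the shifted chain and exchanges the two integrals; the inner one
  is then the integral of \<open>(s - t) ^ r / fact r\<close> over \<open>{t..x}\<close>.\<close>

lemma vanishing_chain_bound:
  assumes "sobolev_chain (Suc r) R" "\<And>k. k \<le> r \<Longrightarrow> R k c = 0" "c \<le> x"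
  shows "ennreal \<bar>R 0 x\<bar> \<le> (\<integral>\<^sup>+ t. ennreal (indicator {c<..x} t * (x - t) ^ r / fact r * \<bar>R (Suc r) t\<bar>) \<partial>lborel)"
  using assms
proof (induction r arbitrary: R x)
  case 0
  then have "primitive (R 0) (R 1)" by (simp add: sobolev_chain_def)
  from primitive_increment_le[OF this 0(3)] 0(2)[of 0] show ?case by simp
next
  case (Suc r)
  define G where "G = R (Suc (Suc r))"
  let ?k = "\<lambda>s t. indicator {c<..x} s * (indicator {c<..x} t * (if t \<le> s then (s - t) ^ r / fact r else 0) * \<bar>G t\<bar>)"
  have [measurable]: "G \<in> borel_measurable borel"
    using sobolev_chain_measurable[OF Suc.prems(1)] by (simp add: G_def)
  have "primitive (R 0) (R 1)" using Suc.prems(1) by (simp add: sobolev_chain_def)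
  from primitive_increment_le[OF this Suc.prems(3)] Suc.prems(2)[of 0]
  have "ennreal \<bar>R 0 x\<bar> \<le> (\<integral>\<^sup>+ s. ennreal (indicator {c<..x} s * \<bar>R 1 s\<bar>) \<partial>lborel)" by simp
  also have "\<dots> \<le> (\<integral>\<^sup>+ s. (\<integral>\<^sup>+ t. ennreal (?k s t) \<partial>lborel) \<partial>lborel)"
  proof (intro nn_integral_mono)
    fix s
    show "ennreal (indicator {c<..x} s * \<bar>R 1 s\<bar>) \<le> (\<integral>\<^sup>+ t. ennreal (?k s t) \<partial>lborel)"
    proof (cases "s \<in> {c<..x}")
      case True
      have "ennreal \<bar>R (Suc 0) s\<bar> \<le> (\<integral>\<^sup>+ t. ennreal (indicator {c<..s} t * (s - t) ^ r / fact r * \<bar>G t\<bar>) \<partial>lborel)"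
        unfolding G_def
        by (rule Suc.IH[of "\<lambda>k. R (Suc k)"])
          (use Suc.prems True in \<open>auto simp: sobolev_chain_def\<close>)
      also have "\<dots> = (\<integral>\<^sup>+ t. ennreal (indicator {c<..x} t * (if t \<le> s then (s - t) ^ r / fact r else 0) * \<bar>G t\<bar>) \<partial>lborel)"
        using True by (intro nn_integral_cong) (auto simp: indicator_def)
      finally show ?thesis using True by simp
    qed simp
  qed
  also have "\<dots> = (\<integral>\<^sup>+ t. (\<integral>\<^sup>+ s. ennreal (?k s t) \<partial>lborel) \<partial>lborel)"
    by (rule lborel_pair.Fubini') measurable
  also have "\<dots> = (\<integral>\<^sup>+ t. ennreal (indicator {c<..x} t * (x - t) ^ Suc r / fact (Suc r) * \<bar>G t\<bar>) \<partial>lborel)"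
  proof (intro nn_integral_cong)
    fix t
    show "(\<integral>\<^sup>+ s. ennreal (?k s t) \<partial>lborel)
      = ennreal (indicator {c<..x} t * (x - t) ^ Suc r / fact (Suc r) * \<bar>G t\<bar>)"
    proof (cases "t \<in> {c<..x}")
      case True
      have "(\<integral>\<^sup>+ s. ennreal (?k s t) \<partial>lborel)
        = (\<integral>\<^sup>+ s. ennreal \<bar>G t\<bar> * (ennreal ((s - t) ^ r / fact r) * indicator {t..x} s) \<partial>lborel)"
        using True by (intro nn_integral_cong) (auto simp: indicator_def mult.commute simp flip: ennreal_mult)
      also have "\<dots> = ennreal \<bar>G t\<bar> * (\<integral>\<^sup>+ s. ennreal ((s - t) ^ r / fact r) * indicator {t..x} s \<partial>lborel)"
        by (intro nn_integral_cmult) measurable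
      also have "(\<integral>\<^sup>+ s. ennreal ((s - t) ^ r / fact r) * indicator {t..x} s \<partial>lborel) = (x - t) ^ Suc r / fact (Suc r) - (t - t) ^ Suc r / fact (Suc r)"
        using True by (intro nn_integral_FTC_Icc) (auto intro!: DERIV_power_fact simp del: fact_Suc power_Suc)
      finally show ?thesis using True
        by (simp add: mult.commute flip: ennreal_mult del: fact_Suc power_Suc)
    qed simp
  qed
  finally show ?case by (simp add: G_def)
qed

definition taylor :: "nat \<Rightarrow> (nat \<Rightarrow> real \<Rightarrow> real) \<Rightarrow> real \<Rightarrow> real \<Rightarrow> real" where
  "taylor r F c x = (\<Sum>j<r. F j c * (x - c) ^ j / fact j)"

lemma taylor_deriv:
  "((taylor (Suc n) F c) has_real_derivative taylor n (\<lambda>j. F (Suc j)) c x) (at x)"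
proof -
  have "((\<lambda>x. F 0 c + (\<Sum>j<n. F (Suc j) c * (x - c) ^ Suc j / fact (Suc j))) has_real_derivative
      0 + (\<Sum>j<n. F (Suc j) c * (x - c) ^ j / fact j)) (at x)"
  proof (intro DERIV_add DERIV_const DERIV_sum)
    fix j
    show "((\<lambda>x. F (Suc j) c * (x - c) ^ Suc j / fact (Suc j)) has_real_derivative F (Suc j) c * (x - c) ^ j / fact j) (at x)"
      using DERIV_cmult[OF DERIV_power_fact, of "F (Suc j) c" c j x]
      by (simp del: fact_Suc power_Suc)
  qed
  moreover have "taylor (Suc n) F c = (\<lambda>x. F 0 c + (\<Sum>j<n. F (Suc j) c * (x - c) ^ Suc j / fact (Suc j)))"
    by (simp add: taylor_def fun_eq_iff sum.lessThan_Suc_shift del: sum.lessThan_Suc fact_Suc power_Suc)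
  ultimately show ?thesis by (simp add: taylor_def)
qed

lemma taylor_continuous: "continuous_on UNIV (taylor n F c)"
  unfolding taylor_def by (intro continuous_intros) auto

text \<open>Subtracting the Taylor polynomials of all orders from a chain leaves a chain that vanishes at \<open>c\<close>.\<close>

lemma taylor_remainder:
  assumes F: "sobolev_chain (Suc r) F" and "c \<le> x"
  shows "ennreal \<bar>F 0 x - taylor (Suc r) F c x\<bar>
    \<le> (\<integral>\<^sup>+ t. ennreal (indicator {c<..x} t * (x - t) ^ r / fact r * \<bar>F (Suc r) t\<bar>) \<partial>lborel)"
proof -
  define R where "R k x = F k x - taylor (Suc r - k) (\<lambda>j. F (k + j)) c x" for k x
  have "sobolev_chain (Suc r) R"
    unfolding sobolev_chain_def
  proof (intro conjI allI impI)
    show "loc_int (R (Suc r))"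
      using F by (simp add: R_def[abs_def] taylor_def sobolev_chain_def)
    fix k assume k: "k < Suc r"
    then obtain n where n: "Suc r - k = Suc n" "Suc r - Suc k = n" by (metis Suc_diff_Suc)
    have 1: "primitive (F k) (F (Suc k))" using F k by (simp add: sobolev_chain_def)
    have 2: "primitive (taylor (Suc n) (\<lambda>j. F (k + j)) c) (taylor n (\<lambda>j. F (Suc k + j)) c)"
      using taylor_deriv[of n "\<lambda>j. F (k + j)" c]
      by (intro primitive_C1 taylor_continuous) simp
    have "(LINT t:{x..y}|lborel. F (Suc k) t - taylor n (\<lambda>j. F (Suc k + j)) c t)
      = (LINT t:{x..y}|lborel. F (Suc k) t) - (LINT t:{x..y}|lborel. taylor n (\<lambda>j. F (Suc k + j)) c t)" for x y
      by (rule set_integral_diff(2)[OF loc_int_Icc[OF primitiveD(1)[OF 1]] loc_int_Icc[OF primitiveD(1)[OF 2]]])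
    then show "primitive (R k) (R (Suc k))"
      using loc_int_lin(3)[OF primitiveD(1)[OF 1] primitiveD(1)[OF 2]]
        primitiveD(2)[OF 1] primitiveD(2)[OF 2]
      unfolding primitive_def R_def[abs_def] n by simp
  qed
  moreover have "R k c = 0" if "k \<le> r" for k
    unfolding R_def Suc_diff_le[OF that] taylor_def sum.lessThan_Suc_shift by simp
  ultimately have "ennreal \<bar>R 0 x\<bar> \<le> (\<integral>\<^sup>+ t. ennreal (indicator {c<..x} t * (x - t) ^ r / fact r * \<bar>R (Suc r) t\<bar>) \<partial>lborel)"
    using \<open>c \<le> x\<close> by (rule vanishing_chain_bound)
  then show ?thesis by (simp add: R_def taylor_def del: fact_Suc sum.lessThan_Suc)
qed

section \<open>Operations on chains and bounds for the weight\<close>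

lemma primitive_cmult:
  assumes "primitive F G"
  shows "primitive (\<lambda>x. c * F x) (\<lambda>x. c * G x)"
  using assms unfolding primitive_def
  by (auto simp: loc_int_lin simp flip: right_diff_distrib)

lemma primitive_add:
  assumes "primitive F G" "primitive F' G'"
  shows "primitive (\<lambda>x. F x + F' x) (\<lambda>x. G x + G' x)"
  unfolding primitive_def
proof (intro conjI allI impI)
  note l = primitiveD(1)[OF assms(1)] primitiveD(1)[OF assms(2)]
  show "loc_int (\<lambda>x. G x + G' x)" by (rule loc_int_lin(1)[OF l])
  fix x y :: real assume "x \<le> y"
  show "F y + F' y - (F x + F' x) = (LINT t:{x..y}|lborel. G t + G' t)"
    unfolding set_integral_add(2)[OF loc_int_Icc[OF l(1)] loc_int_Icc[OF l(2)]]
    using primitiveD(2)[OF assms(1) \<open>x \<le> y\<close>] primitiveD(2)[OF assms(2) \<open>x \<le> y\<close>] by simp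
qed

lemma sobolev_chain_cmult: "sobolev_chain r F \<Longrightarrow> sobolev_chain r (\<lambda>k x. c * F k x)"
  by (auto simp: sobolev_chain_def intro: primitive_cmult loc_int_lin)

lemma sobolev_chain_add:
  "sobolev_chain r F \<Longrightarrow> sobolev_chain r G \<Longrightarrow> sobolev_chain r (\<lambda>k x. F k x + G k x)"
  by (auto simp: sobolev_chain_def intro: primitive_add loc_int_lin)

lemma primitive_reflect:
  assumes P: "primitive F G"
  shows "primitive (\<lambda>x. F (- x)) (\<lambda>x. - G (- x))"
proof -
  note G = primitiveD(1)[OF P]
  have [measurable]: "G \<in> borel_measurable borel" using G by (simp add: loc_int_def)
  have ind: "(\<lambda>x. indicator {c..d} x *\<^sub>R - G (- x)) = (\<lambda>x. - (indicator {- d..- c} (0 + (-1) * x) *\<^sub>R G (0 + (-1) * x)))"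
    for c d :: real by (auto simp: indicator_def fun_eq_iff)
  have "set_integrable lborel {c..d} (\<lambda>x. - G (- x))" for c d
    unfolding set_integrable_def ind
    using loc_int_Icc[OF G, of "-d" "-c"]
    by (intro integrable_minus lborel_integrable_real_affine) (auto simp: set_integrable_def)
  then have "loc_int (\<lambda>x. - G (- x))" by (simp add: loc_int_def)
  moreover have "F (- y) - F (- x) = (LINT t:{x..y}|lborel. - G (- t))" if "x \<le> y" for x y
  proof -
    have "(LINT t:{x..y}|lborel. - G (- t)) = - (LINT t:{-y..-x}|lborel. G t)"
      unfolding set_lebesgue_integral_def ind
      by (subst (2) lborel_integral_real_affine[of "-1" _ 0]) auto
    also have "\<dots> = F (- y) - F (- x)"
      using primitiveD(2)[OF P, of "-y" "-x"] that by simp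
    finally show ?thesis by simp
  qed
  ultimately show ?thesis by (auto simp: primitive_def)
qed

lemma sobolev_chain_reflect:
  assumes "sobolev_chain r F"
  shows "sobolev_chain r (\<lambda>k x. (-1) ^ k * F k (- x))"
  unfolding sobolev_chain_def
proof (intro conjI allI impI)
  fix k assume "k < r"
  then have "primitive (F k) (F (Suc k))" using assms by (simp add: sobolev_chain_def)
  from primitive_cmult[OF primitive_reflect[OF this], of "(-1) ^ k"]
  show "primitive (\<lambda>x. (-1) ^ k * F k (- x)) (\<lambda>x. (-1) ^ Suc k * F (Suc k) (- x))" by simp
next
  obtain H where "primitive H (F r)"
    using primitive_exists assms by (auto simp: sobolev_chain_def)
  from primitiveD(1)[OF primitive_cmult[OF primitive_reflect[OF this], of "(-1) ^ Suc r"]]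
  show "loc_int (\<lambda>x. (-1) ^ r * F r (- x))" by simp
qed

lemma nn_integral_reflect:
  fixes f :: "real \<Rightarrow> ennreal"
  assumes [measurable]: "f \<in> borel_measurable borel"
  shows "(\<integral>\<^sup>+ x. f (- x) \<partial>lborel) = (\<integral>\<^sup>+ x. f x \<partial>lborel)"
  by (subst (2) nn_integral_real_affine[where c = "-1" and t = 0]) auto

text \<open>The inequality \<open>z \<le> exp z\<close> at \<open>z = a / (2 * s) * (1 + y)\<close>, raised to the power \<open>s\<close>, uses up half of the decay.\<close>

lemma exp_decay_absorbs_power:
  fixes a s :: real
  assumes "a > 0" "s \<ge> 0"
  obtains M where "M > 0" "\<And>y. y \<ge> 0 \<Longrightarrow> (1 + y) powr s * exp (- a * y) \<le> M * exp (- (a / 2) * y)"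
proof (cases "s = 0")
  case True
  have "(1 + y) powr s * exp (- a * y) \<le> 1 * exp (- (a / 2) * y)" if "y \<ge> 0" for y
    using that assms True by simp
  then show ?thesis by (intro that[of 1]) auto
next
  case False
  then have s: "s > 0" using assms by simp
  define M where "M = (2 * s / a) powr s * exp (a / 2)"
  show ?thesis
  proof
    show "M > 0" using s assms by (simp add: M_def)
    fix y :: real assume y: "y \<ge> 0"
    define z where "z = a / (2 * s) * (1 + y)"
    have "z \<le> exp z" using exp_ge_add_one_self[of z] by linarith
    then have "(2 * s / a) * z \<le> (2 * s / a) * exp z"
      using s assms by (intro mult_left_mono) auto
    then have "1 + y \<le> (2 * s / a) * exp z" using s assms by (simp add: z_def)
    then have "(1 + y) powr s \<le> ((2 * s / a) * exp z) powr s"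
      using s y by (intro powr_mono2) auto
    also have "\<dots> = (2 * s / a) powr s * exp (s * z)"
    proof -
      have "exp z powr s = exp (s * z)" by (simp add: exp_powr_real mult.commute)
      moreover have "((2 * s / a) * exp z) powr s = (2 * s / a) powr s * exp z powr s"
        by (rule powr_mult)
      ultimately show ?thesis by simp
    qed
    also have "s * z = a / 2 + (a / 2) * y" using s by (simp add: z_def field_simps)
    finally have "(1 + y) powr s * exp (- a * y) \<le> (2 * s / a) powr s * exp (a / 2 + (a / 2) * y) * exp (- a * y)"
      by (intro mult_right_mono) auto
    also have "\<dots> = M * exp (- (a / 2) * y)"
      by (simp add: M_def mult.assoc flip: exp_add)
    finally show "(1 + y) powr s * exp (- a * y) \<le> M * exp (- (a / 2) * y)" .
  qed
qed

text \<open>Together with the upper bound below, this fixes \<open>x powr (1 - lam)\<close> as the scale on which the weight varies.\<close>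

lemma powr_diff_lower:
  fixes t x lam :: real
  assumes "0 \<le> t" "t \<le> x" "lam > 1"
  shows "x powr (lam - 1) * (x - t) \<le> x powr lam - t powr lam"
proof -
  have e: "z powr lam = z powr (lam - 1) * z" if "z \<ge> 0" for z :: real
    using that by (cases "z = 0") (auto simp: powr_diff)
  have "t powr (lam - 1) * t \<le> x powr (lam - 1) * t"
    using assms by (intro mult_right_mono powr_mono2) auto
  then show ?thesis using assms by (simp add: e algebra_simps)
qed

lemma powr_diff_upper:
  fixes t x lam :: real
  assumes "0 \<le> t" "t \<le> x" "lam > 1"
  shows "x powr lam - t powr lam \<le> lam * x powr (lam - 1) * (x - t)"
proof -
  consider "t = x" | "t = 0" "x > 0" | "0 < t" "t < x" using assms by linarith
  then show ?thesis
  proof cases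
    case 2
    then have "x powr lam = x powr (lam - 1) * x" by (simp add: powr_diff)
    also have "\<dots> \<le> lam * (x powr (lam - 1) * x)"
      using 2 assms mult_right_mono[of 1 lam "x powr (lam - 1) * x"] by simp
    finally show ?thesis using 2 assms by (simp add: mult.assoc)
  next
    case 3
    have "\<exists>z. t < z \<and> z < x \<and> x powr lam - t powr lam = (x - t) * (lam * z powr (lam - 1))"
      using 3 by (intro MVT2) (auto intro!: derivative_eq_intros)
    then obtain z where z: "t < z" "z < x" "x powr lam - t powr lam = (x - t) * (lam * z powr (lam - 1))"
      by blast
    have "(x - t) * (lam * z powr (lam - 1)) \<le> (x - t) * (lam * x powr (lam - 1))"
      using z 3 assms by (intro mult_left_mono powr_mono2) auto
    then show ?thesis using z by (simp add: mult_ac)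
  qed simp
qed

lemma freud_weight_measurable [measurable]: "freud_weight lam a b \<in> borel_measurable borel"
  unfolding freud_weight_def[abs_def] by measurable

lemma freud_weight_pos: "freud_weight lam a b x > 0"
  by (simp add: freud_weight_def)

text \<open>For \<open>d\<close> of order \<open>1\<close> the hypothesis describes the distances over which the weight is constant up to a factor. This
  determines the mesh of the grids.\<close>

lemma freud_weight_comparable:
  assumes lam: "lam > 1" "a > 0" and x: "\<bar>x\<bar> \<le> X" "\<bar>t\<bar> \<le> X" and d: "X powr (lam - 1) * \<bar>x - t\<bar> \<le> d"
  shows "freud_weight lam a b x \<le> exp (a * lam * d) * freud_weight lam a b t"
proof -
  have *: "u powr lam - v powr lam \<le> lam * d" if "0 \<le> v" "v \<le> u" "u \<le> X" "u - v \<le> \<bar>x - t\<bar>" for u v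
  proof -
    have "u powr lam - v powr lam \<le> lam * u powr (lam - 1) * (u - v)"
      using that lam by (intro powr_diff_upper) auto
    also have "\<dots> \<le> lam * X powr (lam - 1) * \<bar>x - t\<bar>"
      using that lam by (intro mult_mono powr_mono2) auto
    also have "\<dots> \<le> lam * d" using d lam by (simp add: mult.assoc)
    finally show ?thesis .
  qed
  have "\<bar>t\<bar> powr lam - \<bar>x\<bar> powr lam \<le> lam * d"
  proof (cases "\<bar>x\<bar> \<le> \<bar>t\<bar>")
    case False
    then have "\<bar>t\<bar> powr lam \<le> \<bar>x\<bar> powr lam" using lam by (intro powr_mono2) auto
    moreover have "0 \<le> lam * d"
    proof -
      have "0 \<le> X powr (lam - 1) * \<bar>x - t\<bar>" by simp
      with d have "0 \<le> d" by linarith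
      with lam show ?thesis by simp
    qed
    ultimately show ?thesis by linarith
  qed (intro *, use x in auto)
  then have "a * (\<bar>t\<bar> powr lam - \<bar>x\<bar> powr lam) \<le> a * (lam * d)"
    using lam by (intro mult_left_mono) auto
  then show ?thesis by (simp add: freud_weight_def algebra_simps flip: exp_add)
qed

text \<open>The value at \<open>0\<close> is at most the mean of \<open>\<bar>F\<bar>\<close> over \<open>{0<..1}\<close> plus the variation of \<open>F\<close> there. On this interval the weight
  is at least its value at \<open>1\<close>, and \<open>t \<le> 1 + t powr p\<close>.\<close>

lemma primitive_value_at_0:
  assumes lam: "lam > 1" "a > 0" and p: "p \<ge> 1" and P: "primitive F G"
    and F: "pow_int p (\<lambda>x. F x * freud_weight lam a b x) \<le> 1"
    and G: "pow_int p (\<lambda>x. G x * freud_weight lam a b x) \<le> 1"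
  shows "\<bar>F 0\<bar> \<le> 2 * (1 + freud_weight lam a b 1 powr (- p))"
proof -
  let ?w = "freud_weight lam a b"
  define V where "V = 1 + ?w 1 powr (- p)"
  have [measurable]: "F \<in> borel_measurable borel" "G \<in> borel_measurable borel"
    using primitive_continuous[OF P] primitiveD(1)[OF P]
    by (auto simp: loc_int_def borel_measurable_continuous_onI)
  have *: "(\<integral>\<^sup>+ x. ennreal (indicator {0<..1} x * \<bar>H x\<bar>) \<partial>lborel) \<le> ennreal V"
    if [measurable]: "H \<in> borel_measurable borel" and
      H: "pow_int p (\<lambda>x. H x * ?w x) \<le> 1" for H
  proof -
    have "(\<integral>\<^sup>+ x. ennreal (indicator {0<..1} x * \<bar>H x\<bar>) \<partial>lborel)
      \<le> (\<integral>\<^sup>+ x. indicator {0<..1::real} x + ennreal (?w 1 powr (- p)) * ennreal (\<bar>H x * ?w x\<bar> powr p) \<partial>lborel)"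
    proof (intro nn_integral_mono)
      fix x :: real
      show "ennreal (indicator {0<..1} x * \<bar>H x\<bar>)
        \<le> indicator {0<..1} x + ennreal (?w 1 powr (- p)) * ennreal (\<bar>H x * ?w x\<bar> powr p)"
      proof (cases "x \<in> {0<..1}")
        case True
        then have "x powr lam \<le> 1" using lam by (intro powr_le1) auto
        then have w: "?w 1 \<le> ?w x" using True lam by (auto simp: freud_weight_def)
        have "\<bar>H x\<bar> \<le> 1 + \<bar>H x\<bar> powr p"
          using powr_le_split[of "\<bar>H x\<bar>" 1 1 p] p by (cases "H x = 0") auto
        also have "\<bar>H x\<bar> powr p = ?w 1 powr (- p) * (\<bar>H x\<bar> * ?w 1) powr p"
          using freud_weight_pos[of lam a b 1] by (simp add: powr_mult powr_minus)
        also have "\<dots> \<le> ?w 1 powr (- p) * (\<bar>H x * ?w x\<bar>) powr p"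
          using w p freud_weight_pos[of lam a b 1]
          by (intro mult_left_mono powr_mono2) (auto simp: abs_mult intro!: mult_left_mono)
        finally have "\<bar>H x\<bar> \<le> 1 + ?w 1 powr (- p) * \<bar>H x * ?w x\<bar> powr p" by simp
        then have "ennreal \<bar>H x\<bar> \<le> ennreal (1 + ?w 1 powr (- p) * \<bar>H x * ?w x\<bar> powr p)"
          by (rule ennreal_leI)
        then show ?thesis using True by (simp add: ennreal_mult)
      qed simp
    qed
    also have "\<dots> = 1 + ennreal (?w 1 powr (- p)) * pow_int p (\<lambda>x. H x * ?w x)"
      by (simp add: nn_integral_add nn_integral_cmult)
    also have "\<dots> \<le> 1 + ennreal (?w 1 powr (- p)) * 1"
      by (intro add_mono mult_left_mono H) auto
    finally show ?thesis by (simp add: V_def)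
  qed
  have "ennreal \<bar>F 0\<bar> = (\<integral>\<^sup>+ x. ennreal \<bar>F 0\<bar> * indicator {0<..1::real} x \<partial>lborel)"
    by (simp add: nn_integral_cmult)
  also have "\<dots> \<le> (\<integral>\<^sup>+ x. ennreal (indicator {0<..1} x * \<bar>F x\<bar>)
      + (\<integral>\<^sup>+ t. ennreal (indicator {0<..1} t * \<bar>G t\<bar>) \<partial>lborel) * indicator {0<..1} x \<partial>lborel)"
  proof (intro nn_integral_mono)
    fix x :: real
    show "ennreal \<bar>F 0\<bar> * indicator {0<..1} x \<le> ennreal (indicator {0<..1} x * \<bar>F x\<bar>)
      + (\<integral>\<^sup>+ t. ennreal (indicator {0<..1} t * \<bar>G t\<bar>) \<partial>lborel) * indicator {0<..1} x"
    proof (cases "x \<in> {0<..1}")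
      case True
      have "ennreal \<bar>F 0\<bar> \<le> ennreal (\<bar>F x\<bar> + \<bar>F x - F 0\<bar>)" by (intro ennreal_leI) linarith
      also have "\<dots> = ennreal \<bar>F x\<bar> + ennreal \<bar>F x - F 0\<bar>" by (simp add: ennreal_plus)
      also have "ennreal \<bar>F x - F 0\<bar> \<le> (\<integral>\<^sup>+ t. ennreal (indicator {0<..x} t * \<bar>G t\<bar>) \<partial>lborel)"
        using True by (intro primitive_increment_le[OF P]) auto
      also have "\<dots> \<le> (\<integral>\<^sup>+ t. ennreal (indicator {0<..1} t * \<bar>G t\<bar>) \<partial>lborel)"
        using True by (intro nn_integral_mono ennreal_leI mult_right_mono) (auto simp: indicator_def)
      finally show ?thesis using True by (simp add: add_left_mono)
    qed simp
  qed
  also have "\<dots> = (\<integral>\<^sup>+ x. ennreal (indicator {0<..1} x * \<bar>F x\<bar>) \<partial>lborel)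
      + (\<integral>\<^sup>+ t. ennreal (indicator {0<..1} t * \<bar>G t\<bar>) \<partial>lborel)"
    by (subst nn_integral_add) (auto simp: nn_integral_cmult)
  also have "\<dots> \<le> ennreal V + ennreal V" by (intro add_mono * F G) auto
  also have "\<dots> = ennreal (2 * V)" by (simp add: V_def flip: ennreal_plus)
  finally have "\<bar>F 0\<bar> \<le> 2 * V" by (subst (asm) ennreal_le_iff) (auto simp: V_def)
  then show ?thesis by (simp add: V_def)
qed

section \<open>Decay of Sobolev functions at infinity\<close>

text \<open>For \<open>0 < t \<le> x\<close> and \<open>y = x powr lam - t powr lam\<close> the kernel
  \<open>x powr ((lam - 1) * Suc r) * (x - t) ^ r * w x / w t\<close> is at most
  \<open>x powr (lam - 1) * y ^ r * exp (- a * y)\<close>, because \<open>x powr (lam - 1) * (x - t) \<le> y\<close>. Half of the exponential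
  absorbs \<open>y ^ r\<close>, and what remains is integrable in \<open>x\<close> and in \<open>t\<close> with explicit antiderivatives, so the Schur
  test applies with constants independent of the chain.\<close>

lemma tail_right_remainder:
  fixes lam a b p :: real and r :: nat
  assumes lam: "lam > 1" "a > 0" and p: "p \<ge> 1"
  shows "\<exists>C>0. \<forall>F. sobolev_chain (Suc r) F \<longrightarrow>
     pow_int p (\<lambda>x. F (Suc r) x * freud_weight lam a b x) \<le> 1 \<longrightarrow>
     pow_int p (\<lambda>x. indicator {0<..} x * (x powr ((lam - 1) * Suc r) * (F 0 x - taylor (Suc r) F 0 x) * freud_weight lam a b x)) \<le> ennreal C"
proof -
  let ?w = "freud_weight lam a b"
  obtain M where M: "M > 0" "\<And>y. y \<ge> 0 \<Longrightarrow> (1 + y) powr real r * exp (- a * y) \<le> M * exp (- (a / 2) * y)"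
    using exp_decay_absorbs_power[of a "real r"] lam by auto
  (* Starting at 0 < t avoids differentiating x powr lam at 0 in the column integral. *)
  define K where "K x t = (if 0 < t \<and> t \<le> x then M * x powr (lam - 1) * exp (- (a / 2) * (x powr lam - t powr lam)) else 0)"
    for x t :: real
  have Km: "case_prod K \<in> borel_measurable (borel \<Otimes>\<^sub>M borel)" unfolding K_def[abs_def] by measurable
  have K0: "0 \<le> K x t" for x t using M by (simp add: K_def)
  define A where "A = 2 * M / a"
  define B where "B = 2 * M / (a * lam)"
  have AB: "A > 0" "B > 0" using M lam by (auto simp: A_def B_def)
  have row: "(\<integral>\<^sup>+ t. ennreal (K x t) \<partial>lborel) \<le> ennreal A" for x
  proof (cases "x > 0")
    case True
    define c where "c = (a / 2) * x powr (lam - 1)"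
    have c: "c > 0" using True lam by (simp add: c_def)
    have "(\<integral>\<^sup>+ t. ennreal (K x t) \<partial>lborel)
      \<le> (\<integral>\<^sup>+ t. ennreal (M * x powr (lam - 1) * exp (- c * (x - t))) * indicator {0..x} t \<partial>lborel)"
    proof (intro nn_integral_mono)
      fix t
      show "ennreal (K x t) \<le> ennreal (M * x powr (lam - 1) * exp (- c * (x - t))) * indicator {0..x} t"
      proof (cases "0 < t \<and> t \<le> x")
        case True
        have "(a / 2) * (x powr (lam - 1) * (x - t)) \<le> (a / 2) * (x powr lam - t powr lam)"
          using powr_diff_lower[of t x lam] True lam by (intro mult_left_mono) auto
        then have "c * (x - t) \<le> (a / 2) * (x powr lam - t powr lam)"
          by (simp only: c_def mult.assoc)
        then have "M * x powr (lam - 1) * exp (- (a / 2) * (x powr lam - t powr lam)) \<le> M * x powr (lam - 1) * exp (- c * (x - t))"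
          using M by (intro mult_left_mono) auto
        then show ?thesis using True by (simp add: K_def ennreal_leI)
      qed (auto simp: K_def)
    qed
    also have "\<dots> = A * exp (- c * (x - x)) - A * exp (- c * (x - 0))"
    proof (rule nn_integral_FTC_Icc[where F = "\<lambda>t. A * exp (- c * (x - t))"])
      fix t
      have Ac: "A * c = M * x powr (lam - 1)" using lam by (simp add: A_def c_def)
      have "((\<lambda>t. exp (- c * (x - t))) has_real_derivative exp (- c * (x - t)) * c) (at t)"
        by (auto intro!: derivative_eq_intros)
      from DERIV_cmult[OF this, of A]
      show "((\<lambda>t. A * exp (- c * (x - t))) has_real_derivative M * x powr (lam - 1) * exp (- c * (x - t))) (at t)"
        unfolding Ac[symmetric] by (simp add: mult_ac)
    next
      show "0 \<le> x" using True by simp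
      show "0 \<le> M * x powr (lam - 1) * exp (- c * (x - t))" for t using M(1) by simp
    qed simp
    also have "\<dots> \<le> ennreal A"
      using AB by (intro ennreal_leI) simp
    finally show ?thesis .
  next
    case False
    then have "K x t = 0" for t by (simp add: K_def)
    then show ?thesis by simp
  qed
  have col: "(\<integral>\<^sup>+ x. ennreal (K x t) \<partial>lborel) \<le> ennreal B" for t
  proof (cases "t > 0")
    case True
    define G where "G x = - (B * exp (- (a / 2) * (x powr lam - t powr lam)))" for x
    have "(\<integral>\<^sup>+ x. ennreal (K x t) \<partial>lborel)
      = (\<integral>\<^sup>+ x. ennreal (M * x powr (lam - 1) * exp (- (a / 2) * (x powr lam - t powr lam))) * indicator {t..} x \<partial>lborel)"
      using True by (intro nn_integral_cong) (auto simp: K_def)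
    also have "\<dots> = ennreal (0 - G t)"
    proof (rule nn_integral_FTC_atLeast[where F = G])
      fix x assume x: "t \<le> x"
      then have "x > 0" using True by simp
      then have "(G has_real_derivative B * (exp (- (a / 2) * (x powr lam - t powr lam)) * ((a / 2) * (lam * x powr (lam - 1))))) (at x)"
      proof -
        have "((\<lambda>x. x powr lam) has_real_derivative lam * x powr (lam - 1)) (at x)"
          by (rule has_real_derivative_powr[OF \<open>x > 0\<close>])
        then have "((\<lambda>x. - (a / 2) * (x powr lam - t powr lam)) has_real_derivative - (a / 2) * (lam * x powr (lam - 1) - 0)) (at x)"
          by (intro DERIV_cmult DERIV_diff DERIV_const)
        from DERIV_minus[OF DERIV_cmult[OF DERIV_chain2[OF DERIV_exp this], of B]]
        show ?thesis by (simp add: G_def[abs_def] mult_ac)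
      qed
      also have "B * (exp (- (a / 2) * (x powr lam - t powr lam)) * ((a / 2) * (lam * x powr (lam - 1))))
        = M * x powr (lam - 1) * exp (- (a / 2) * (x powr lam - t powr lam))"
        using lam by (simp add: B_def)
      finally show "(G has_real_derivative M * x powr (lam - 1) * exp (- (a / 2) * (x powr lam - t powr lam))) (at x)" .
    next
      have "eventually (\<lambda>x. x \<le> x powr lam) at_top"
        using eventually_ge_at_top[of 1]
      proof eventually_elim
        fix x :: real assume "1 \<le> x"
        then have "x powr 1 \<le> x powr lam" using lam by (intro powr_mono) auto
        then show "x \<le> x powr lam" using \<open>1 \<le> x\<close> by simp
      qed
      with filterlim_ident have "filterlim (\<lambda>x. x powr lam) at_top at_top"
        by (rule filterlim_at_top_mono)
      then have "filterlim (\<lambda>x. x powr lam - t powr lam) at_top at_top"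
        using filterlim_tendsto_add_at_top[OF tendsto_const[of "- (t powr lam)"]] by fastforce
      then have "filterlim (\<lambda>x. (a / 2) * (x powr lam - t powr lam)) at_top at_top"
        using lam by (intro filterlim_tendsto_pos_mult_at_top[OF tendsto_const]) auto
      then have "filterlim (\<lambda>x. - ((a / 2) * (x powr lam - t powr lam))) at_bot at_top"
        by (simp add: filterlim_uminus_at_top)
      from filterlim_compose[OF exp_at_bot this]
      have "((\<lambda>x. - (B * exp (- ((a / 2) * (x powr lam - t powr lam))))) \<longlongrightarrow> - (B * 0)) at_top"
        by (intro tendsto_intros)
      then show "(G \<longlongrightarrow> 0) at_top" by (simp add: G_def[abs_def] algebra_simps)
    qed (use M in auto)
    finally show ?thesis by (simp add: G_def)
  next
    case False
    then have "K x t = 0" for x by (simp add: K_def)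
    then show ?thesis by simp
  qed
  show ?thesis
  proof (intro exI[of _ "2 powr p * A powr (p - 1) * B"] conjI allI impI)
    show "0 < 2 powr p * A powr (p - 1) * B" using AB by simp
    fix F assume F: "sobolev_chain (Suc r) F"
      and n: "pow_int p (\<lambda>x. F (Suc r) x * ?w x) \<le> 1"
    have [measurable]: "F (Suc r) \<in> borel_measurable borel"
      by (rule sobolev_chain_measurable[OF F]) simp
    let ?u = "\<lambda>x. indicator {0<..} x * (x powr ((lam - 1) * Suc r) * (F 0 x - taylor (Suc r) F 0 x) * ?w x)"
    have "pow_int p ?u
      \<le> ennreal (2 powr p * A powr (p - 1) * B) * pow_int p (\<lambda>t. F (Suc r) t * ?w t)"
    proof (rule Schur_test[OF Km _ K0 _ p AB(1) less_imp_le[OF AB(2)] row col])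
      fix x
      show "ennreal \<bar>?u x\<bar> \<le> (\<integral>\<^sup>+ t. ennreal (K x t * \<bar>F (Suc r) t * ?w t\<bar>) \<partial>lborel)"
      proof (cases "x > 0")
        case x: True
        define k where "k = x powr ((lam - 1) * Suc r) * ?w x"
        have k: "k \<ge> 0" using freud_weight_pos[of lam a b x] by (simp add: k_def less_imp_le)
        have "ennreal \<bar>?u x\<bar> = ennreal k * ennreal \<bar>F 0 x - taylor (Suc r) F 0 x\<bar>"
          using x k freud_weight_pos[of lam a b x]
          by (simp add: k_def abs_mult mult_ac flip: ennreal_mult)
        also have "\<dots> \<le> ennreal k * (\<integral>\<^sup>+ t. ennreal (indicator {0<..x} t * (x - t) ^ r / fact r * \<bar>F (Suc r) t\<bar>) \<partial>lborel)"
          using x by (intro mult_left_mono taylor_remainder[OF F]) auto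
        also have "\<dots> = (\<integral>\<^sup>+ t. ennreal k * ennreal (indicator {0<..x} t * (x - t) ^ r / fact r * \<bar>F (Suc r) t\<bar>) \<partial>lborel)"
          by (intro nn_integral_cmult[symmetric]) measurable
        also have "\<dots> \<le> (\<integral>\<^sup>+ t. ennreal (K x t * \<bar>F (Suc r) t * ?w t\<bar>) \<partial>lborel)"
        proof (intro nn_integral_mono)
          fix t
          show "ennreal k * ennreal (indicator {0<..x} t * (x - t) ^ r / fact r * \<bar>F (Suc r) t\<bar>)
            \<le> ennreal (K x t * \<bar>F (Suc r) t * ?w t\<bar>)"
          proof (cases "t \<in> {0<..x}")
            case t: True
            define y where "y = x powr lam - t powr lam"
            have y: "x powr (lam - 1) * (x - t) \<le> y"
              using powr_diff_lower[of t x lam] t lam by (simp add: y_def)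
            have y0: "0 \<le> y" using y t by (smt (verit) greaterThanAtMost_iff mult_nonneg_nonneg powr_ge_zero)
            have wx: "?w x = ?w t * exp (- a * y)"
              using x t by (simp add: freud_weight_def y_def algebra_simps flip: exp_add)
            have "x powr ((lam - 1) * Suc r) = x powr (lam - 1) * (x powr (lam - 1)) ^ r"
              using x by (simp add: powr_power distrib_left powr_add mult.commute)
            then have "k * ((x - t) ^ r) = x powr (lam - 1) * ((x powr (lam - 1) * (x - t)) ^ r * exp (- a * y)) * ?w t"
              by (simp add: k_def wx power_mult_distrib mult_ac)
            also have "\<dots> \<le> x powr (lam - 1) * ((1 + y) powr r * exp (- a * y)) * ?w t"
            proof -
              have "(x powr (lam - 1) * (x - t)) ^ r \<le> (1 + y) ^ r"
                using y t by (intro power_mono) auto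
              then show ?thesis using y0 freud_weight_pos[of lam a b t]
                by (intro mult_right_mono mult_left_mono) (auto simp: powr_realpow)
            qed
            also have "\<dots> \<le> x powr (lam - 1) * (M * exp (- (a / 2) * y)) * ?w t"
              using M(2)[OF y0] freud_weight_pos[of lam a b t]
              by (intro mult_right_mono mult_left_mono) auto
            also have "\<dots> = K x t * ?w t" using t by (simp add: K_def y_def)
            finally have *: "k * (x - t) ^ r \<le> K x t * ?w t" .
            have "k * ((x - t) ^ r / fact r * \<bar>F (Suc r) t\<bar>) \<le> k * ((x - t) ^ r / 1 * \<bar>F (Suc r) t\<bar>)"
              using k t by (intro mult_left_mono mult_right_mono divide_left_mono) (auto simp: fact_ge_1)
            also have "\<dots> \<le> K x t * ?w t * \<bar>F (Suc r) t\<bar>"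
              using mult_right_mono[OF *, of "\<bar>F (Suc r) t\<bar>"] by (simp add: mult.assoc)
            finally have "k * ((x - t) ^ r / fact r * \<bar>F (Suc r) t\<bar>) \<le> K x t * \<bar>F (Suc r) t * ?w t\<bar>"
              using freud_weight_pos[of lam a b t] by (simp add: abs_mult mult_ac)
            then show ?thesis using t k by (simp add: ennreal_leI flip: ennreal_mult')
          qed (simp add: K_def)
        qed
        finally show ?thesis .
      qed simp
    qed auto
    also have "\<dots> \<le> ennreal (2 powr p * A powr (p - 1) * B) * 1"
      by (intro mult_left_mono n) auto
    finally show "pow_int p ?u \<le> ennreal (2 powr p * A powr (p - 1) * B)"
      by simp
  qed
qed

text \<open>The Taylor polynomial at \<open>0\<close> grows polynomially. The weight beats it and still leaves \<open>exp (- (a / 2) * x)\<close>, since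
  \<open>x \<le> 1 + x powr lam\<close>.\<close>

lemma tail_right_polynomial:
  fixes lam a b p D \<kappa> :: real and r :: nat
  assumes lam: "lam > 1" "a > 0" and p: "p \<ge> 1" and D: "D \<ge> 0" and \<kappa>: "\<kappa> \<ge> 0"
  shows "\<exists>C>0. \<forall>F. (\<forall>k<r. \<bar>F k 0\<bar> \<le> D) \<longrightarrow>
     pow_int p (\<lambda>x. indicator {0<..} x * (x powr \<kappa> * taylor r F 0 x * freud_weight lam a b x)) \<le> ennreal C"
proof -
  let ?w = "freud_weight lam a b"
  obtain M where M: "M > 0" "\<And>y. y \<ge> 0 \<Longrightarrow> (1 + y) powr (\<kappa> + r) * exp (- a * y) \<le> M * exp (- (a / 2) * y)"
    using exp_decay_absorbs_power[of a "\<kappa> + r"] lam \<kappa> by auto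
  define Q where "Q = real r * D * exp b * M * exp (a / 2)"
  have Q: "Q \<ge> 0" using M D by (simp add: Q_def)
  define e where "e = a * p / 2"
  have e: "e > 0" using lam p by (simp add: e_def)
  have le: "pow_int p (\<lambda>x. indicator {0<..} x * (x powr \<kappa> * taylor r F 0 x * ?w x)) \<le> ennreal (Q powr p / e + 1)"
    if F: "\<forall>k<r. \<bar>F k 0\<bar> \<le> D" for F
  proof -
    have "pow_int p (\<lambda>x. indicator {0<..} x * (x powr \<kappa> * taylor r F 0 x * ?w x))
      \<le> (\<integral>\<^sup>+ x. ennreal (Q powr p * exp (- e * x)) * indicator {0..} x \<partial>lborel)"
    proof (intro nn_integral_mono)
      fix x :: real
      show "ennreal (\<bar>indicator {0<..} x * (x powr \<kappa> * taylor r F 0 x * ?w x)\<bar> powr p) \<le> ennreal (Q powr p * exp (- e * x)) * indicator {0..} x"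
      proof (cases "x > 0")
        case x: True
        define y where "y = x powr lam"
        have y0: "y \<ge> 0" by (simp add: y_def)
        have xy: "x \<le> 1 + y"
        proof (cases "x \<le> 1")
          case False
          then have "x powr 1 \<le> x powr lam" using lam by (intro powr_mono) auto
          then show ?thesis using False by (simp add: y_def)
        qed (use y0 in linarith)
        have "\<bar>taylor r F 0 x\<bar> \<le> (\<Sum>j<r. \<bar>F j 0 * (x - 0) ^ j / fact j\<bar>)"
          unfolding taylor_def by (rule sum_abs)
        also have "\<dots> \<le> (\<Sum>j<r. D * (1 + y) ^ r)"
        proof (intro sum_mono)
          fix j assume j: "j \<in> {..<r}"
          have "x ^ j \<le> (1 + y) ^ j" using x xy by (intro power_mono) auto
          also have "\<dots> \<le> (1 + y) ^ r" using j y0 by (intro power_increasing) auto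
          finally have 1: "x ^ j \<le> (1 + y) ^ r" .
          have "\<bar>F j 0\<bar> * x ^ j / fact j \<le> D * (1 + y) ^ r / 1"
            using F j 1 x D y0 by (intro frac_le mult_mono) (auto simp: fact_ge_1)
          then show "\<bar>F j 0 * (x - 0) ^ j / fact j\<bar> \<le> D * (1 + y) ^ r"
            using x by (simp add: abs_mult)
        qed
        also have "\<dots> = real r * D * (1 + y) powr r" using y0 by (simp add: powr_realpow)
        finally have T: "\<bar>taylor r F 0 x\<bar> \<le> real r * D * (1 + y) powr r" .
        have X: "x powr \<kappa> \<le> (1 + y) powr \<kappa>" using x xy \<kappa> by (intro powr_mono2) auto
        have "\<bar>x powr \<kappa> * taylor r F 0 x * ?w x\<bar> = x powr \<kappa> * \<bar>taylor r F 0 x\<bar> * ?w x"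
          using freud_weight_pos[of lam a b x] by (simp add: abs_mult)
        also have "\<dots> \<le> (1 + y) powr \<kappa> * (real r * D * (1 + y) powr r) * ?w x"
          using freud_weight_pos[of lam a b x] D by (intro mult_right_mono mult_mono X T) auto
        also have "\<dots> = real r * D * exp b * ((1 + y) powr (\<kappa> + r) * exp (- a * y))"
        proof -
          have "?w x = exp b * exp (- a * y)"
            using x by (simp add: freud_weight_def y_def flip: exp_add)
          then show ?thesis by (simp add: powr_add mult_ac)
        qed
        also have "\<dots> \<le> real r * D * exp b * (M * exp (- (a / 2) * y))"
          using D by (intro mult_left_mono M y0) auto
        also have "\<dots> \<le> real r * D * exp b * (M * exp (a / 2 - (a / 2) * x))"
        proof -
          have "(a / 2) * x \<le> (a / 2) * (1 + y)" using xy lam by (intro mult_left_mono) auto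
          then show ?thesis using D M by (intro mult_left_mono) (auto simp: algebra_simps)
        qed
        also have "\<dots> = Q * exp (- (a / 2) * x)"
        proof -
          have "exp (a / 2 - (a / 2) * x) = exp (a / 2) * exp (- (a / 2) * x)"
            by (simp flip: exp_add)
          then show ?thesis by (simp only: Q_def mult_ac)
        qed
        finally have "\<bar>x powr \<kappa> * taylor r F 0 x * ?w x\<bar> powr p \<le> (Q * exp (- (a / 2) * x)) powr p"
          using p by (intro powr_mono2) auto
        also have "\<dots> = Q powr p * exp (- e * x)"
        proof -
          have "(Q * exp (- (a / 2) * x)) powr p = Q powr p * exp (- (a / 2) * x) powr p"
            by (rule powr_mult)
          then show ?thesis by (simp add: exp_powr_real e_def mult_ac)
        qed
        finally show ?thesis using x by (simp add: ennreal_leI)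
      qed (use p in simp)
    qed
    also have "\<dots> = ennreal (0 - - (Q powr p * exp (- e * 0) / e))"
    proof (rule nn_integral_FTC_atLeast[where F = "\<lambda>x. - (Q powr p * exp (- e * x) / e)"])
      fix x :: real
      have "((\<lambda>x. exp (- e * x)) has_real_derivative exp (- e * x) * (- e * 1)) (at x)"
        by (rule DERIV_chain2[OF DERIV_exp DERIV_cmult[OF DERIV_ident]])
      from DERIV_minus[OF DERIV_cmult[OF this, of "Q powr p / e"]]
      show "((\<lambda>x. - (Q powr p * exp (- e * x) / e)) has_real_derivative Q powr p * exp (- e * x)) (at x)"
        using e by simp
    next
      have "filterlim (\<lambda>x::real. e * x) at_top at_top"
        using e by (intro filterlim_tendsto_pos_mult_at_top[OF tendsto_const]) (auto simp: filterlim_ident)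
      then have "filterlim (\<lambda>x::real. - (e * x)) at_bot at_top"
        by (simp add: filterlim_uminus_at_top)
      from filterlim_compose[OF exp_at_bot this]
      have "((\<lambda>x. - (Q powr p * exp (- (e * x)) / e)) \<longlongrightarrow> - (Q powr p * 0 / e)) at_top"
        using e by (intro tendsto_intros) auto
      then show "((\<lambda>x. - (Q powr p * exp (- e * x) / e)) \<longlongrightarrow> 0) at_top" by simp
    qed auto
    also have "\<dots> \<le> ennreal (Q powr p / e + 1)" by (intro ennreal_leI) simp
    finally show ?thesis .
  qed
  have "Q powr p / e + 1 > 0" using e by (smt (verit) divide_nonneg_pos powr_ge_zero)
  with le show ?thesis by blast
qed

lemma tail_right:
  fixes lam a b p :: real and r :: nat
  assumes lam: "lam > 1" "a > 0" and p: "p \<ge> 1"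
  shows "\<exists>C>0. \<forall>F. sobolev_chain (Suc r) F \<longrightarrow>
     (\<forall>k\<le>Suc r. pow_int p (\<lambda>x. F k x * freud_weight lam a b x) \<le> 1) \<longrightarrow>
     (\<integral>\<^sup>+ x. ennreal (\<bar>indicator {0<..} x * (\<bar>x\<bar> powr ((lam - 1) * Suc r) * F 0 x * freud_weight lam a b x)\<bar> powr p) \<partial>lborel) \<le> ennreal C"
proof -
  let ?w = "freud_weight lam a b" and ?\<kappa> = "(lam - 1) * Suc r"
  define D where "D = 2 * (1 + ?w 1 powr (- p))"
  obtain C1 where C1: "C1 > 0" "\<And>F. sobolev_chain (Suc r) F \<Longrightarrow>
     pow_int p (\<lambda>x. F (Suc r) x * ?w x) \<le> 1 \<Longrightarrow>
     pow_int p (\<lambda>x. indicator {0<..} x * (x powr ?\<kappa> * (F 0 x - taylor (Suc r) F 0 x) * ?w x)) \<le> ennreal C1"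
    using tail_right_remainder[OF lam p, of r b] by blast
  have "D \<ge> 0" "?\<kappa> \<ge> 0" using lam by (auto simp: D_def)
  then obtain C2 where C2: "C2 > 0" "\<And>F. (\<forall>k<Suc r. \<bar>F k 0\<bar> \<le> D) \<Longrightarrow>
     pow_int p (\<lambda>x. indicator {0<..} x * (x powr ?\<kappa> * taylor (Suc r) F 0 x * ?w x)) \<le> ennreal C2"
    using tail_right_polynomial[OF lam p, of D ?\<kappa> "Suc r" b] by blast
  show ?thesis
  proof (intro exI[of _ "2 powr p * (C1 + C2)"] conjI allI impI)
    show "0 < 2 powr p * (C1 + C2)" using C1 C2 by simp
    fix F assume F: "sobolev_chain (Suc r) F"
      and n: "\<forall>k\<le>Suc r. pow_int p (\<lambda>x. F k x * ?w x) \<le> 1"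
    have [measurable]: "F 0 \<in> borel_measurable borel"
      by (rule sobolev_chain_measurable[OF F]) simp
    have [measurable]: "taylor (Suc r) F 0 \<in> borel_measurable borel"
      by (intro borel_measurable_continuous_onI taylor_continuous)
    let ?u1 = "\<lambda>x. indicator {0<..} x * (x powr ?\<kappa> * (F 0 x - taylor (Suc r) F 0 x) * ?w x)"
    let ?u2 = "\<lambda>x. indicator {0<..} x * (x powr ?\<kappa> * taylor (Suc r) F 0 x * ?w x)"
    have D: "\<forall>k<Suc r. \<bar>F k 0\<bar> \<le> D"
    proof (intro allI impI)
      fix k assume k: "k < Suc r"
      then have "primitive (F k) (F (Suc k))" using F by (simp add: sobolev_chain_def)
      then show "\<bar>F k 0\<bar> \<le> D" unfolding D_def
        by (rule primitive_value_at_0[OF lam p]) (use n k in auto)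
    qed
    have "(\<integral>\<^sup>+ x. ennreal (\<bar>indicator {0<..} x * (\<bar>x\<bar> powr ?\<kappa> * F 0 x * ?w x)\<bar> powr p) \<partial>lborel)
      \<le> (\<integral>\<^sup>+ x. ennreal (2 powr p) * (ennreal (\<bar>?u1 x\<bar> powr p) + ennreal (\<bar>?u2 x\<bar> powr p)) \<partial>lborel)"
    proof (intro nn_integral_mono)
      fix x :: real
      have "indicator {0<..} x * (\<bar>x\<bar> powr ?\<kappa> * F 0 x * ?w x) = ?u1 x + ?u2 x"
        by (auto simp: indicator_def algebra_simps)
      then have "\<bar>indicator {0<..} x * (\<bar>x\<bar> powr ?\<kappa> * F 0 x * ?w x)\<bar> powr p \<le> (\<bar>?u1 x\<bar> + \<bar>?u2 x\<bar>) powr p"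
        using p by (intro powr_mono2) (auto simp del: of_nat_Suc intro: abs_triangle_ineq)
      also have "\<dots> \<le> 2 powr p * (\<bar>?u1 x\<bar> powr p + \<bar>?u2 x\<bar> powr p)"
        using p by (intro powr_add_le) auto
      finally show "ennreal (\<bar>indicator {0<..} x * (\<bar>x\<bar> powr ?\<kappa> * F 0 x * ?w x)\<bar> powr p)
        \<le> ennreal (2 powr p) * (ennreal (\<bar>?u1 x\<bar> powr p) + ennreal (\<bar>?u2 x\<bar> powr p))"
        by (simp add: ennreal_leI del: of_nat_Suc flip: ennreal_plus ennreal_mult)
    qed
    also have "\<dots> = ennreal (2 powr p) * (pow_int p ?u1 + pow_int p ?u2)"
      by (subst nn_integral_cmult, measurable, subst nn_integral_add, measurable)
    also have "\<dots> \<le> ennreal (2 powr p) * (ennreal C1 + ennreal C2)"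
      by (rule mult_left_mono[OF add_mono[OF C1(2)[OF F n[rule_format, OF order_refl]] C2(2)[where F = F, OF D]]]) simp
    also have "\<dots> = ennreal (2 powr p * (C1 + C2))"
      using C1 C2 by (simp flip: ennreal_plus ennreal_mult)
    finally show "(\<integral>\<^sup>+ x. ennreal (\<bar>indicator {0<..} x * (\<bar>x\<bar> powr ?\<kappa> * F 0 x * ?w x)\<bar> powr p) \<partial>lborel) \<le> ennreal (2 powr p * (C1 + C2))" .
  qed
qed

text \<open>The left half-line reduces to the right one by reflection, which preserves chains up to signs and fixes the weight.\<close>

lemma weighted_decay:
  fixes lam a b p :: real and r :: nat
  assumes lam: "lam > 1" "a > 0" and p: "p \<ge> 1"
  shows "\<exists>C>0. \<forall>F. sobolev_chain (Suc r) F \<longrightarrow>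
     (\<forall>k\<le>Suc r. pow_int p (\<lambda>x. F k x * freud_weight lam a b x) \<le> 1) \<longrightarrow>
     (\<integral>\<^sup>+ x. ennreal ((\<bar>x\<bar> powr ((lam - 1) * Suc r) * \<bar>F 0 x * freud_weight lam a b x\<bar>) powr p) \<partial>lborel) \<le> ennreal C"
proof -
  let ?w = "freud_weight lam a b" and ?\<kappa> = "(lam - 1) * Suc r"
  have w: "?w (- x) = ?w x" for x by (simp add: freud_weight_def)
  obtain C where C: "C > 0" "\<And>F. sobolev_chain (Suc r) F \<Longrightarrow>
     (\<forall>k\<le>Suc r. pow_int p (\<lambda>x. F k x * ?w x) \<le> 1) \<Longrightarrow>
     (\<integral>\<^sup>+ x. ennreal (\<bar>indicator {0<..} x * (\<bar>x\<bar> powr ?\<kappa> * F 0 x * ?w x)\<bar> powr p) \<partial>lborel) \<le> ennreal C"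
    using tail_right[OF lam p, of r b] by blast
  show ?thesis
  proof (intro exI[of _ "2 * C"] conjI allI impI)
    show "0 < 2 * C" using C by simp
    fix F assume F: "sobolev_chain (Suc r) F"
      and n: "\<forall>k\<le>Suc r. pow_int p (\<lambda>x. F k x * ?w x) \<le> 1"
    have m[measurable]: "k \<le> Suc r \<Longrightarrow> F k \<in> borel_measurable borel" for k
      by (rule sobolev_chain_measurable[OF F])
    have [measurable]: "F 0 \<in> borel_measurable borel" by (rule m) simp
    let ?G = "\<lambda>k x. (-1) ^ k * F k (- x)"
    let ?u = "\<lambda>F x. indicator {0<..} x * (\<bar>x\<bar> powr ?\<kappa> * F 0 x * ?w x)"
    have "pow_int p (\<lambda>x. ?G k x * ?w x) \<le> 1" if k: "k \<le> Suc r" for k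
    proof -
      have [measurable]: "F k \<in> borel_measurable borel" by (rule m[OF k])
      have "pow_int p (\<lambda>x. ?G k x * ?w x)
        = pow_int p (\<lambda>x. F k (- x) * ?w (- x))"
        by (simp add: w abs_mult power_abs)
      also have "\<dots> = pow_int p (\<lambda>x. F k x * ?w x)"
        by (rule nn_integral_reflect) measurable
      finally show ?thesis using n k by simp
    qed
    then have 2: "pow_int p (\<lambda>x. ?u ?G x) \<le> ennreal C"
      by (intro C(2) sobolev_chain_reflect[OF F]) auto
    have 1: "pow_int p (\<lambda>x. ?u F x) \<le> ennreal C"
      by (intro C(2) F n)
    have "(\<integral>\<^sup>+ x. ennreal ((\<bar>x\<bar> powr ?\<kappa> * \<bar>F 0 x * ?w x\<bar>) powr p) \<partial>lborel)
      \<le> (\<integral>\<^sup>+ x. ennreal (\<bar>?u F x\<bar> powr p) + ennreal (\<bar>?u ?G (- x)\<bar> powr p) \<partial>lborel)"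
    proof (intro nn_integral_mono)
      fix x :: real
      have wx: "?w x > 0" by (rule freud_weight_pos)
      consider "x > 0" | "x < 0" | "x = 0" by linarith
      then show "ennreal ((\<bar>x\<bar> powr ?\<kappa> * \<bar>F 0 x * ?w x\<bar>) powr p)
          \<le> ennreal (\<bar>?u F x\<bar> powr p) + ennreal (\<bar>?u ?G (- x)\<bar> powr p)"
        by cases (use p wx in \<open>auto simp: abs_mult w mult_ac\<close>)
    qed
    also have "\<dots> = pow_int p (\<lambda>x. ?u F x) + pow_int p (\<lambda>x. ?u ?G (- x))"
      by (rule nn_integral_add) measurable
    also have "pow_int p (\<lambda>x. ?u ?G (- x)) = pow_int p (\<lambda>x. ?u ?G x)"
      by (rule nn_integral_reflect) measurable
    also have "pow_int p (\<lambda>x. ?u F x) + pow_int p (\<lambda>x. ?u ?G x) \<le> ennreal C + ennreal C"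
      by (intro add_mono 1 2)
    also have "\<dots> = ennreal (2 * C)" using C by (simp flip: ennreal_plus)
    finally show "(\<integral>\<^sup>+ x. ennreal ((\<bar>x\<bar> powr ?\<kappa> * \<bar>F 0 x * ?w x\<bar>) powr p) \<partial>lborel) \<le> ennreal (2 * C)" .
  qed
qed

section \<open>Piecewise Taylor approximation\<close>

text \<open>The left end point of the cell that contains \<open>x\<close> in the grid of mesh \<open>h\<close> starting at \<open>- \<xi>\<close>.\<close>

definition node :: "real \<Rightarrow> real \<Rightarrow> real \<Rightarrow> real" where
  "node \<xi> h x = h * real_of_int \<lfloor>(x + \<xi>) / h\<rfloor> - \<xi>"

lemma node_bounds:
  assumes "h > 0"
  shows "node \<xi> h x \<le> x" "x < node \<xi> h x + h" "- \<xi> \<le> x \<Longrightarrow> - \<xi> \<le> node \<xi> h x"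
proof -
  have "real_of_int \<lfloor>(x + \<xi>) / h\<rfloor> \<le> (x + \<xi>) / h" by linarith
  then have "h * real_of_int \<lfloor>(x + \<xi>) / h\<rfloor> \<le> h * ((x + \<xi>) / h)"
    using assms by (intro mult_left_mono) auto
  then have "h * real_of_int \<lfloor>(x + \<xi>) / h\<rfloor> \<le> x + \<xi>" using assms by simp
  then show "node \<xi> h x \<le> x" by (simp add: node_def)
  have "(x + \<xi>) / h < real_of_int \<lfloor>(x + \<xi>) / h\<rfloor> + 1" by linarith
  then have "x + \<xi> < h * (real_of_int \<lfloor>(x + \<xi>) / h\<rfloor> + 1)" using assms by (simp add: field_simps)
  then show "x < node \<xi> h x + h" by (simp add: node_def algebra_simps)
  assume "- \<xi> \<le> x"
  then show "- \<xi> \<le> node \<xi> h x" using assms by (simp add: node_def)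
qed

lemma node_unique:
  assumes h: "h > 0" and t: "node \<xi> h x \<le> t" "t < node \<xi> h x + h"
  shows "\<lfloor>(t + \<xi>) / h\<rfloor> = \<lfloor>(x + \<xi>) / h\<rfloor>"
  unfolding floor_eq_iff using t h by (simp add: node_def field_simps)

lemma cell_measure:
  assumes h: "h > 0"
  shows "(\<integral>\<^sup>+ t. ennreal (if \<lfloor>(x + \<xi>) / h\<rfloor> = \<lfloor>(t + \<xi>) / h\<rfloor> then c else 0) \<partial>lborel) = ennreal c * ennreal h"
proof -
  have "(if \<lfloor>(x + \<xi>) / h\<rfloor> = \<lfloor>(t + \<xi>) / h\<rfloor> then c else 0) = c * indicator {node \<xi> h x..<node \<xi> h x + h} t" for t
  proof -
    have "\<lfloor>(x + \<xi>) / h\<rfloor> = \<lfloor>(t + \<xi>) / h\<rfloor> \<longleftrightarrow> t \<in> {node \<xi> h x..<node \<xi> h x + h}"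
      using node_unique[OF h, of \<xi> x t] node_bounds(1,2)[OF h, where \<xi> = \<xi> and x = t] unfolding node_def by auto
    then show ?thesis by simp
  qed
  then have "(\<integral>\<^sup>+ t. ennreal (if \<lfloor>(x + \<xi>) / h\<rfloor> = \<lfloor>(t + \<xi>) / h\<rfloor> then c else 0) \<partial>lborel)
    = (\<integral>\<^sup>+ t. ennreal c * indicator {node \<xi> h x..<node \<xi> h x + h} t \<partial>lborel)"
    by (intro nn_integral_cong) (auto simp: indicator_def)
  also have "\<dots> = ennreal c * ennreal h"
    using h by (subst nn_integral_cmult_indicator) auto
  finally show ?thesis .
qed

text \<open>The kernel is a multiple of \<open>h ^ r\<close> times the indicator of two points being in the same cell; its rows and columns have mass of order
  \<open>h ^ Suc r\<close>. The bound on \<open>\<xi> powr (lam - 1) * h\<close> keeps the weight comparable within a cell.\<close>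

lemma piecewise_taylor_error:
  fixes lam a b p :: real and r :: nat
  assumes lam: "lam > 1" "a > 0" and p: "p \<ge> 1"
  shows "\<exists>C>0. \<forall>F \<xi> h. sobolev_chain (Suc r) F \<longrightarrow>
     pow_int p (\<lambda>x. F (Suc r) x * freud_weight lam a b x) \<le> 1 \<longrightarrow>
     \<xi> > 0 \<longrightarrow> h > 0 \<longrightarrow> \<xi> powr (lam - 1) * h \<le> 2 \<longrightarrow>
     pow_int p (\<lambda>x. indicator {-\<xi>..<\<xi>} x * ((F 0 x - taylor (Suc r) F (node \<xi> h x) x) * freud_weight lam a b x))
       \<le> ennreal (C * h powr (Suc r * p))"
proof -
  let ?w = "freud_weight lam a b"
  define c where "c = exp (a * lam * 2)"
  have c: "c > 0" by (simp add: c_def)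
  show ?thesis
  proof (intro exI[of _ "2 powr p * c powr p"] conjI allI impI)
    show "0 < 2 powr p * c powr p" using c by simp
    fix F :: "nat \<Rightarrow> real \<Rightarrow> real" and \<xi> h :: real
    assume F: "sobolev_chain (Suc r) F"
      and n: "pow_int p (\<lambda>x. F (Suc r) x * ?w x) \<le> 1"
      and \<xi>: "\<xi> > 0" and h: "h > 0" and \<xi>h: "\<xi> powr (lam - 1) * h \<le> 2"
    have [measurable]: "F (Suc r) \<in> borel_measurable borel"
      by (rule sobolev_chain_measurable[OF F]) simp
    define K where "K x t = (if \<lfloor>(x + \<xi>) / h\<rfloor> = \<lfloor>(t + \<xi>) / h\<rfloor> then c * h ^ r else 0)" for x t
    have "case_prod K = (\<lambda>(x,t). if real_of_int \<lfloor>(x + \<xi>) / h\<rfloor> = real_of_int \<lfloor>(t + \<xi>) / h\<rfloor> then c * h ^ r else 0)"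
      by (auto simp: K_def fun_eq_iff)
    then have Km: "case_prod K \<in> borel_measurable (borel \<Otimes>\<^sub>M borel)" by simp
    have K0: "0 \<le> K x t" for x t using c h by (simp add: K_def)
    define A where "A = c * h ^ Suc r"
    have A: "A > 0" using c h by (simp add: A_def)
    have row: "(\<integral>\<^sup>+ t. ennreal (K x t) \<partial>lborel) \<le> ennreal A" for x
      unfolding K_def using cell_measure[OF h, of x \<xi> "c * h ^ r"] h c
      by (simp add: A_def mult_ac flip: ennreal_mult)
    have "K x t = K t x" for x t by (simp add: K_def eq_commute)
    then have col: "(\<integral>\<^sup>+ x. ennreal (K x t) \<partial>lborel) \<le> ennreal A" for t using row[of t] by simp
    let ?u = "\<lambda>x. indicator {-\<xi>..<\<xi>} x * ((F 0 x - taylor (Suc r) F (node \<xi> h x) x) * ?w x)"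
    have "pow_int p ?u
      \<le> ennreal (2 powr p * A powr (p - 1) * A) * pow_int p (\<lambda>t. F (Suc r) t * ?w t)"
    proof (rule Schur_test[OF Km _ K0 _ p A less_imp_le[OF A] row col])
      fix x
      show "ennreal \<bar>?u x\<bar> \<le> (\<integral>\<^sup>+ t. ennreal (K x t * \<bar>F (Suc r) t * ?w t\<bar>) \<partial>lborel)"
      proof (cases "x \<in> {-\<xi>..<\<xi>}")
        case x: True
        let ?c = "node \<xi> h x"
        note nb = node_bounds[OF h, where \<xi> = \<xi> and x = x]
        have "ennreal \<bar>?u x\<bar> = ennreal (?w x) * ennreal \<bar>F 0 x - taylor (Suc r) F ?c x\<bar>"
          using x freud_weight_pos[of lam a b x]
          by (simp add: abs_mult mult_ac less_imp_le flip: ennreal_mult)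
        also have "\<dots> \<le> ennreal (?w x) * (\<integral>\<^sup>+ t. ennreal (indicator {?c<..x} t * (x - t) ^ r / fact r * \<bar>F (Suc r) t\<bar>) \<partial>lborel)"
          using nb by (intro mult_left_mono taylor_remainder[OF F]) auto
        also have "\<dots> = (\<integral>\<^sup>+ t. ennreal (?w x) * ennreal (indicator {?c<..x} t * (x - t) ^ r / fact r * \<bar>F (Suc r) t\<bar>) \<partial>lborel)"
          by (intro nn_integral_cmult[symmetric]) measurable
        also have "\<dots> \<le> (\<integral>\<^sup>+ t. ennreal (K x t * \<bar>F (Suc r) t * ?w t\<bar>) \<partial>lborel)"
        proof (intro nn_integral_mono)
          fix t
          show "ennreal (?w x) * ennreal (indicator {?c<..x} t * (x - t) ^ r / fact r * \<bar>F (Suc r) t\<bar>)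
            \<le> ennreal (K x t * \<bar>F (Suc r) t * ?w t\<bar>)"
          proof (cases "t \<in> {?c<..x}")
            case t: True
            have K: "K x t = c * h ^ r"
              using node_unique[OF h, of \<xi> x t] t nb by (auto simp: K_def)
            have xt: "x - t \<le> h" "0 \<le> x - t" using t nb by auto
            have "\<xi> powr (lam - 1) * \<bar>x - t\<bar> \<le> \<xi> powr (lam - 1) * h"
              using xt by (intro mult_left_mono) auto
            then have "\<xi> powr (lam - 1) * \<bar>x - t\<bar> \<le> 2" using \<xi>h by linarith
            then have w: "?w x \<le> c * ?w t"
              unfolding c_def using x t nb
              by (intro freud_weight_comparable[OF lam, of _ \<xi>]) auto
            have "(x - t) ^ r / fact r \<le> h ^ r / 1"
              using xt by (intro frac_le power_mono) (auto simp: fact_ge_1)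
            then have "?w x * ((x - t) ^ r / fact r) \<le> (c * ?w t) * h ^ r"
              using w freud_weight_pos[of lam a b x] xt c freud_weight_pos[of lam a b t]
              by (intro mult_mono) auto
            from mult_right_mono[OF this, of "\<bar>F (Suc r) t\<bar>"]
            have "?w x * ((x - t) ^ r / fact r * \<bar>F (Suc r) t\<bar>) \<le> K x t * \<bar>F (Suc r) t * ?w t\<bar>"
              using freud_weight_pos[of lam a b t] by (simp add: K abs_mult mult_ac)
            then show ?thesis using t freud_weight_pos[of lam a b x]
              by (simp add: ennreal_leI less_imp_le flip: ennreal_mult')
          qed simp
        qed
        finally show ?thesis .
      qed simp
    qed auto
    also have "\<dots> \<le> ennreal (2 powr p * A powr (p - 1) * A) * 1"
      by (intro mult_left_mono n) auto
    also have "2 powr p * A powr (p - 1) * A = 2 powr p * A powr p"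
      using A by (simp add: powr_diff)
    also have "A powr p = c powr p * (h ^ Suc r) powr p"
      unfolding A_def by (rule powr_mult)
    also have "(h ^ Suc r) powr p = h powr (Suc r * p)"
      using h by (simp add: powr_powr del: power_Suc of_nat_Suc flip: powr_realpow)
    finally show "pow_int p ?u \<le> ennreal (2 powr p * c powr p * h powr (Suc r * p))"
      by (simp add: mult.assoc del: of_nat_Suc)
  qed
qed

lemma integral_power_decay:
  fixes s :: real
  assumes s: "s > 1"
  shows "(\<integral>\<^sup>+ y. ennreal (max 1 \<bar>y\<bar> powr (- s)) \<partial>lborel) \<le> ennreal (2 + 2 / (s - 1))"
proof -
  define f where "f y = ennreal (y powr (- s)) * indicator {1..} y" for y :: real
  have [measurable]: "f \<in> borel_measurable borel" unfolding f_def[abs_def] by measurable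
  have f: "(\<integral>\<^sup>+ y. f y \<partial>lborel) = ennreal (0 - - (1 powr (1 - s) / (s - 1)))"
    unfolding f_def
  proof (rule nn_integral_FTC_atLeast[where F = "\<lambda>y. - (y powr (1 - s) / (s - 1))"])
    fix y :: real assume "1 \<le> y"
    then have "((\<lambda>y. - (y powr (1 - s) / (s - 1))) has_real_derivative - ((1 - s) * y powr (1 - s - 1) / (s - 1))) (at y)"
      using s by (auto intro!: derivative_eq_intros)
    also have "- ((1 - s) * y powr (1 - s - 1) / (s - 1)) = y powr (- s)"
      using s by (simp add: field_simps)
    finally show "((\<lambda>y. - (y powr (1 - s) / (s - 1))) has_real_derivative y powr (- s)) (at y)" .
  next
    have "((\<lambda>y::real. y powr (1 - s)) \<longlongrightarrow> 0) at_top"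
      using s by (intro tendsto_neg_powr filterlim_ident) auto
    from tendsto_minus[OF tendsto_divide[OF this tendsto_const, of "s - 1"]]
    show "((\<lambda>y. - (y powr (1 - s) / (s - 1))) \<longlongrightarrow> 0) at_top" using s by simp
  qed auto
  have "(\<integral>\<^sup>+ y. ennreal (max 1 \<bar>y\<bar> powr (- s)) \<partial>lborel) \<le> (\<integral>\<^sup>+ y. indicator {-1..1::real} y + (f y + f (- y)) \<partial>lborel)"
  proof (intro nn_integral_mono)
    fix y :: real
    consider "\<bar>y\<bar> \<le> 1" | "y > 1" | "y < -1" by linarith
    then show "ennreal (max 1 \<bar>y\<bar> powr (- s)) \<le> indicator {-1..1} y + (f y + f (- y))"
    proof cases
      case 1
      then show ?thesis by (auto simp: max_def indicator_def intro: order_trans[OF _ le_add_same_cancel1[THEN iffD2]])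
    qed (auto simp: f_def max_def)
  qed
  also have "\<dots> = 2 + ((\<integral>\<^sup>+ y. f y \<partial>lborel) + (\<integral>\<^sup>+ y. f (- y) \<partial>lborel))"
    by (simp add: nn_integral_add)
  also have "(\<integral>\<^sup>+ y. f (- y) \<partial>lborel) = (\<integral>\<^sup>+ y. f y \<partial>lborel)" by (rule nn_integral_reflect) simp
  also have "2 + ((\<integral>\<^sup>+ y. f y \<partial>lborel) + (\<integral>\<^sup>+ y. f y \<partial>lborel)) = ennreal (2 + 2 / (s - 1))"
  proof -
    have "ennreal 2 + (ennreal (1 / (s - 1)) + ennreal (1 / (s - 1))) = ennreal (2 + (1 / (s - 1) + 1 / (s - 1)))"
      using s by (simp del: ennreal_numeral flip: ennreal_plus)
    then show ?thesis unfolding f using s by simp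
  qed
  finally show ?thesis .
qed

text \<open>The pointwise splitting with level \<open>\<mu> x = \<xi> powr (- \<kappa> - 1 / p) * max 1 (\<bar>x\<bar> / \<xi>) powr (- B)\<close>. The exponent \<open>B\<close> has to
  satisfy \<open>B * q > 1\<close>, for \<open>\<mu> powr q\<close> to be integrable, and \<open>B * (p - q) \<le> \<kappa> * p\<close>, for the given weight to dominate
  \<open>\<mu> powr (q - p)\<close>; both are possible because \<open>\<kappa> > 1 / q - 1 / p\<close>.\<close>

lemma weighted_Lp_to_Lq:
  fixes p q \<kappa> D :: real
  assumes q: "1 \<le> q" "q \<le> p" and \<kappa>: "\<kappa> > 1 / q - 1 / p" "\<kappa> \<ge> 0" and D: "D > 0"
  shows "\<exists>C>0. \<forall>\<xi> E. \<xi> > 0 \<longrightarrow> E \<in> borel_measurable borel \<longrightarrow>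
    (\<integral>\<^sup>+ x. ennreal ((max \<xi> \<bar>x\<bar> powr \<kappa> * \<bar>E x\<bar>) powr p) \<partial>lborel) \<le> ennreal D \<longrightarrow>
    pow_int q E \<le> ennreal (C * \<xi> powr (1 - q / p - \<kappa> * q))"
proof -
  (* For p = q the second condition on B is void; otherwise B is the largest admissible value. *)
  define B where "B = (if p = q then 2 / q else \<kappa> * p / (p - q))"
  have Bq: "B * q > 1"
  proof (cases "p = q")
    case False
    then have "\<kappa> * (p * q) > p - q" using \<kappa> q by (simp add: field_simps)
    then show ?thesis using False q by (simp add: B_def field_simps)
  qed (use q in \<open>simp add: B_def\<close>)
  have Bp: "B * (p - q) \<le> \<kappa> * p" using \<kappa> q by (auto simp: B_def)
  define I where "I = 2 + 2 / (B * q - 1)"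
  have I: "I > 0" using Bq by (simp add: I_def add_pos_pos)
  show ?thesis
  proof (intro exI[of _ "I + D"] conjI allI impI)
    show "0 < I + D" using I D by simp
    fix \<xi> :: real and E :: "real \<Rightarrow> real"
    assume \<xi>: "\<xi> > 0" and E[measurable]: "E \<in> borel_measurable borel"
      and bd: "(\<integral>\<^sup>+ x. ennreal ((max \<xi> \<bar>x\<bar> powr \<kappa> * \<bar>E x\<bar>) powr p) \<partial>lborel) \<le> ennreal D"
    define v where "v x = max 1 (\<bar>x\<bar> / \<xi>)" for x
    have v1: "v x \<ge> 1" for x by (simp add: v_def)
    have [measurable]: "v \<in> borel_measurable borel" unfolding v_def[abs_def] by measurable
    define \<mu> where "\<mu> x = \<xi> powr (- \<kappa> - 1 / p) * v x powr (- B)" for x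
    have \<mu>: "\<mu> x > 0" for x using \<xi> v1[of x] by (simp add: \<mu>_def)
    define e where "e = 1 - q / p - \<kappa> * q"
    have \<mu>q: "\<mu> x powr q = \<xi> powr (e - 1) * v x powr (- (B * q))" for x
    proof -
      have "\<mu> x powr q = (\<xi> powr (- \<kappa> - 1 / p)) powr q * (v x powr (- B)) powr q"
        unfolding \<mu>_def by (rule powr_mult)
      also have "(- \<kappa> - 1 / p) * q = e - 1" by (simp add: e_def algebra_simps)
      then have "(\<xi> powr (- \<kappa> - 1 / p)) powr q = \<xi> powr (e - 1)" by (simp add: powr_powr)
      finally show ?thesis by (simp add: powr_powr)
    qed
    have \<mu>p: "\<mu> x powr (q - p) * \<bar>E x\<bar> powr p \<le> \<xi> powr e * (max \<xi> \<bar>x\<bar> powr \<kappa> * \<bar>E x\<bar>) powr p" for x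
    proof -
      have "\<mu> x powr (q - p) = (\<xi> powr (- \<kappa> - 1 / p)) powr (q - p) * (v x powr (- B)) powr (q - p)"
        unfolding \<mu>_def by (rule powr_mult)
      also have "\<dots> = \<xi> powr ((- \<kappa> - 1 / p) * (q - p)) * v x powr (B * (p - q))"
        by (simp add: powr_powr algebra_simps)
      also have "\<dots> \<le> \<xi> powr ((- \<kappa> - 1 / p) * (q - p)) * v x powr (\<kappa> * p)"
        using v1[of x] Bp by (intro mult_left_mono powr_mono) auto
      also have "(- \<kappa> - 1 / p) * (q - p) = e + \<kappa> * p" using q by (simp add: e_def field_simps)
      also have "\<xi> powr (e + \<kappa> * p) * v x powr (\<kappa> * p) = \<xi> powr e * (\<xi> * v x) powr (\<kappa> * p)"
        by (simp add: powr_add powr_mult)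
      also have "\<xi> * v x = max \<xi> \<bar>x\<bar>" using \<xi> by (auto simp: v_def max_def field_simps)
      finally have "\<mu> x powr (q - p) * \<bar>E x\<bar> powr p \<le> \<xi> powr e * max \<xi> \<bar>x\<bar> powr (\<kappa> * p) * \<bar>E x\<bar> powr p"
        by (intro mult_right_mono) auto
      also have "\<dots> = \<xi> powr e * (max \<xi> \<bar>x\<bar> powr \<kappa> * \<bar>E x\<bar>) powr p"
        by (simp add: powr_mult powr_powr)
      finally show ?thesis .
    qed
    have Iv: "(\<integral>\<^sup>+ x. ennreal (v x powr (- (B * q))) \<partial>lborel) \<le> ennreal (\<xi> * I)"
    proof -
      have "(\<integral>\<^sup>+ x. ennreal (v x powr (- (B * q))) \<partial>lborel) = ennreal \<bar>\<xi>\<bar> * (\<integral>\<^sup>+ x. ennreal (v (0 + \<xi> * x) powr (- (B * q))) \<partial>lborel)"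
        using \<xi> by (intro nn_integral_real_affine) auto
      also have "(\<lambda>x. v (0 + \<xi> * x)) = (\<lambda>x. max 1 \<bar>x\<bar>)" using \<xi> by (simp add: v_def abs_mult)
      then have "(\<integral>\<^sup>+ x. ennreal (v (0 + \<xi> * x) powr (- (B * q))) \<partial>lborel) = (\<integral>\<^sup>+ x. ennreal (max 1 \<bar>x\<bar> powr (- (B * q))) \<partial>lborel)"
        by (simp add: fun_eq_iff)
      also have "ennreal \<bar>\<xi>\<bar> * \<dots> \<le> ennreal \<bar>\<xi>\<bar> * ennreal I"
        unfolding I_def by (intro mult_left_mono integral_power_decay Bq) auto
      finally show ?thesis using \<xi> I by (simp flip: ennreal_mult)
    qed
    have "pow_int q E
      \<le> (\<integral>\<^sup>+ x. ennreal (\<xi> powr (e - 1)) * ennreal (v x powr (- (B * q))) + ennreal (\<xi> powr e) * ennreal ((max \<xi> \<bar>x\<bar> powr \<kappa> * \<bar>E x\<bar>) powr p) \<partial>lborel)"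
    proof (intro nn_integral_mono)
      fix x
      have "\<bar>E x\<bar> powr q \<le> \<mu> x powr q + \<mu> x powr (q - p) * \<bar>E x\<bar> powr p"
        using q by (intro powr_le_split \<mu>) auto
      also have "\<dots> \<le> \<xi> powr (e - 1) * v x powr (- (B * q)) + \<xi> powr e * (max \<xi> \<bar>x\<bar> powr \<kappa> * \<bar>E x\<bar>) powr p"
        using \<mu>q[of x] \<mu>p[of x] by simp
      finally show "ennreal (\<bar>E x\<bar> powr q) \<le> ennreal (\<xi> powr (e - 1)) * ennreal (v x powr (- (B * q))) + ennreal (\<xi> powr e) * ennreal ((max \<xi> \<bar>x\<bar> powr \<kappa> * \<bar>E x\<bar>) powr p)"
        by (simp add: ennreal_leI flip: ennreal_plus ennreal_mult)
    qed
    also have "\<dots> = ennreal (\<xi> powr (e - 1)) * (\<integral>\<^sup>+ x. ennreal (v x powr (- (B * q))) \<partial>lborel)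
      + ennreal (\<xi> powr e) * (\<integral>\<^sup>+ x. ennreal ((max \<xi> \<bar>x\<bar> powr \<kappa> * \<bar>E x\<bar>) powr p) \<partial>lborel)"
      by (simp add: nn_integral_add nn_integral_cmult)
    also have "\<dots> \<le> ennreal (\<xi> powr (e - 1)) * ennreal (\<xi> * I) + ennreal (\<xi> powr e) * ennreal D"
      by (intro add_mono mult_left_mono Iv bd) auto
    also have "\<dots> = ennreal (\<xi> powr (e - 1) * (\<xi> * I) + \<xi> powr e * D)"
      using \<xi> I D by (simp flip: ennreal_plus ennreal_mult)
    also have "\<xi> powr (e - 1) * (\<xi> * I) + \<xi> powr e * D = (I + D) * \<xi> powr e"
      using \<xi> by (simp add: powr_diff algebra_simps)
    finally show "pow_int q E \<le> ennreal ((I + D) * \<xi> powr (1 - q / p - \<kappa> * q))"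
      by (simp add: e_def)
  qed
qed

definition cell_taylor :: "nat \<Rightarrow> real \<Rightarrow> nat \<Rightarrow> (nat \<Rightarrow> real \<Rightarrow> real) \<Rightarrow> real \<Rightarrow> real" where
  "cell_taylor r \<xi> m F x = indicator {-\<xi>..<\<xi>} x * taylor r F (node \<xi> (2 * \<xi> / m) x) x"

text \<open>The mesh \<open>2 * \<xi> / m\<close> with \<open>\<xi> = m powr (1 / lam)\<close> gives \<open>\<xi> powr (lam - 1) * h = 2\<close>, so that the error inside and
  the decay outside carry the same weight \<open>max \<xi> \<bar>x\<bar> powr \<kappa>\<close>. The first conclusion, without any
  approximation, serves for numbers \<open>n\<close> smaller than the degree of smoothness.\<close>

lemma approximation_error:
  fixes lam a b p q :: real and r :: nat
  assumes lam: "lam > 1" "a > 0" and q: "1 \<le> q" "q \<le> p" and \<rho>: "width_exponent lam (Suc r) p q > 0"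
  shows "\<exists>C>0. \<forall>F. sobolev_chain (Suc r) F \<longrightarrow>
     (\<forall>k\<le>Suc r. pow_int p (\<lambda>x. F k x * freud_weight lam a b x) \<le> 1) \<longrightarrow>
     pow_int q (\<lambda>x. F 0 x * freud_weight lam a b x) \<le> ennreal C \<and>
     (\<forall>m\<ge>1. cell_taylor (Suc r) (real m powr (1 / lam)) m F \<in> borel_measurable borel \<longrightarrow>
       pow_int q (\<lambda>x. (F 0 x - cell_taylor (Suc r) (real m powr (1 / lam)) m F x) * freud_weight lam a b x)
         \<le> ennreal (C * real m powr (- width_exponent lam (Suc r) p q * q)))"
proof -
  let ?w = "freud_weight lam a b"
  have p: "p \<ge> 1" using q by simp
  define \<kappa> where "\<kappa> = (lam - 1) * Suc r"
  have \<kappa>0: "\<kappa> > 0" using lam by (simp add: \<kappa>_def)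
  have \<rho>\<kappa>: "width_exponent lam (Suc r) p q = (\<kappa> - (1 / q - 1 / p)) / lam"
    using lam q by (auto simp: width_exponent_def r_lam_def delta_exponent_def \<kappa>_def field_simps)
  have \<kappa>: "\<kappa> > 1 / q - 1 / p" using \<rho> lam by (simp add: \<rho>\<kappa> zero_less_divide_iff)
  obtain C1 where C1: "C1 > 0" "\<And>F. sobolev_chain (Suc r) F \<Longrightarrow>
     (\<forall>k\<le>Suc r. pow_int p (\<lambda>x. F k x * ?w x) \<le> 1) \<Longrightarrow>
     (\<integral>\<^sup>+ x. ennreal ((\<bar>x\<bar> powr \<kappa> * \<bar>F 0 x * ?w x\<bar>) powr p) \<partial>lborel) \<le> ennreal C1"
    using weighted_decay[OF lam p, of r b] unfolding \<kappa>_def by blast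
  obtain C2 where C2: "C2 > 0" "\<And>F \<xi> h. sobolev_chain (Suc r) F \<Longrightarrow>
     pow_int p (\<lambda>x. F (Suc r) x * ?w x) \<le> 1 \<Longrightarrow>
     \<xi> > 0 \<Longrightarrow> h > 0 \<Longrightarrow> \<xi> powr (lam - 1) * h \<le> 2 \<Longrightarrow>
     pow_int p (\<lambda>x. indicator {-\<xi>..<\<xi>} x * ((F 0 x - taylor (Suc r) F (node \<xi> h x) x) * ?w x))
       \<le> ennreal (C2 * h powr (Suc r * p))"
    using piecewise_taylor_error[OF lam p, of r b] by blast
  define D where "D = C1 + 1 + C2 * 2 powr (Suc r * p)"
  have D: "D > 0" using C1 C2 by (simp add: D_def add_pos_nonneg)
  obtain C3 where C3: "C3 > 0" "\<And>\<xi> E. \<xi> > 0 \<Longrightarrow> E \<in> borel_measurable borel \<Longrightarrow>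
    (\<integral>\<^sup>+ x. ennreal ((max \<xi> \<bar>x\<bar> powr \<kappa> * \<bar>E x\<bar>) powr p) \<partial>lborel) \<le> ennreal D \<Longrightarrow>
    pow_int q E \<le> ennreal (C3 * \<xi> powr (1 - q / p - \<kappa> * q))"
    using weighted_Lp_to_Lq[OF q \<kappa> less_imp_le[OF \<kappa>0] D] by blast
  show ?thesis
  proof (intro exI[of _ C3] conjI allI impI)
    show "0 < C3" by (rule C3)
    fix F assume F: "sobolev_chain (Suc r) F"
      and n: "\<forall>k\<le>Suc r. pow_int p (\<lambda>x. F k x * ?w x) \<le> 1"
    have F0[measurable]: "F 0 \<in> borel_measurable borel"
      by (rule sobolev_chain_measurable[OF F]) simp
    have n0: "pow_int p (\<lambda>x. F 0 x * ?w x) \<le> 1"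
      and nr: "pow_int p (\<lambda>x. F (Suc r) x * ?w x) \<le> 1" using n by auto
    note dec = C1(2)[OF F n]
    have "(\<integral>\<^sup>+ x. ennreal ((max 1 \<bar>x\<bar> powr \<kappa> * \<bar>F 0 x * ?w x\<bar>) powr p) \<partial>lborel)
      \<le> (\<integral>\<^sup>+ x. ennreal ((\<bar>x\<bar> powr \<kappa> * \<bar>F 0 x * ?w x\<bar>) powr p) + ennreal (\<bar>F 0 x * ?w x\<bar> powr p) \<partial>lborel)"
    proof (intro nn_integral_mono)
      fix x :: real
      show "ennreal ((max 1 \<bar>x\<bar> powr \<kappa> * \<bar>F 0 x * ?w x\<bar>) powr p) \<le> ennreal ((\<bar>x\<bar> powr \<kappa> * \<bar>F 0 x * ?w x\<bar>) powr p) + ennreal (\<bar>F 0 x * ?w x\<bar> powr p)"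
        by (cases "\<bar>x\<bar> \<le> 1") (auto simp: max_def)
    qed
    also have "\<dots> = (\<integral>\<^sup>+ x. ennreal ((\<bar>x\<bar> powr \<kappa> * \<bar>F 0 x * ?w x\<bar>) powr p) \<partial>lborel) + pow_int p (\<lambda>x. F 0 x * ?w x)"
      by (rule nn_integral_add) measurable
    also have "\<dots> \<le> ennreal C1 + 1" by (intro add_mono dec n0)
    also have "\<dots> \<le> ennreal D" using C1 C2 by (simp add: D_def ennreal_leI flip: ennreal_1 ennreal_plus)
    finally have "pow_int q (\<lambda>x. F 0 x * ?w x) \<le> ennreal (C3 * 1 powr (1 - q / p - \<kappa> * q))"
      by (intro C3(2)) auto
    then show "pow_int q (\<lambda>x. F 0 x * ?w x) \<le> ennreal C3" by simp
    fix m :: nat assume m: "1 \<le> m"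
    define \<xi> h where "\<xi> = real m powr (1 / lam)" and "h = 2 * \<xi> / m"
    have \<xi>: "\<xi> > 0" and h: "h > 0" using m by (auto simp: \<xi>_def h_def)
    have "\<xi> powr lam = m" using m lam by (simp add: \<xi>_def powr_powr)
    then have \<xi>h: "\<xi> powr (lam - 1) * h = 2" using m \<xi> by (simp add: h_def powr_diff)
    let ?P = "cell_taylor (Suc r) (real m powr (1 / lam)) m F"
    assume P[measurable]: "?P \<in> borel_measurable borel"
    let ?u1 = "\<lambda>x. indicator {-\<xi>..<\<xi>} x * ((F 0 x - taylor (Suc r) F (node \<xi> h x) x) * ?w x)"
    have u1_eq: "?u1 x = indicator {-\<xi>..<\<xi>} x * ((F 0 x - ?P x) * ?w x)" for x
      by (auto simp: indicator_def cell_taylor_def \<xi>_def h_def)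
    have u1: "pow_int p ?u1 \<le> ennreal (C2 * h powr (Suc r * p))"
      by (rule C2(2)[OF F nr \<xi> h]) (simp add: \<xi>h)
    have [measurable]: "(\<lambda>x. ?u1 x) \<in> borel_measurable borel" unfolding u1_eq by measurable
    have "(\<integral>\<^sup>+ x. ennreal ((max \<xi> \<bar>x\<bar> powr \<kappa> * \<bar>(F 0 x - ?P x) * ?w x\<bar>) powr p) \<partial>lborel)
      \<le> (\<integral>\<^sup>+ x. ennreal ((\<bar>x\<bar> powr \<kappa> * \<bar>F 0 x * ?w x\<bar>) powr p) + ennreal (\<xi> powr (\<kappa> * p)) * ennreal (\<bar>?u1 x\<bar> powr p) \<partial>lborel)"
    proof (intro nn_integral_mono)
      fix x :: real
      show "ennreal ((max \<xi> \<bar>x\<bar> powr \<kappa> * \<bar>(F 0 x - ?P x) * ?w x\<bar>) powr p)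
        \<le> ennreal ((\<bar>x\<bar> powr \<kappa> * \<bar>F 0 x * ?w x\<bar>) powr p) + ennreal (\<xi> powr (\<kappa> * p)) * ennreal (\<bar>?u1 x\<bar> powr p)"
      proof (cases "x \<in> {-\<xi>..<\<xi>}")
        case True
        then have "max \<xi> \<bar>x\<bar> = \<xi>" by (auto simp: max_def)
        then have "(max \<xi> \<bar>x\<bar> powr \<kappa> * \<bar>(F 0 x - ?P x) * ?w x\<bar>) powr p = \<xi> powr (\<kappa> * p) * \<bar>?u1 x\<bar> powr p"
          unfolding u1_eq using True by (simp add: powr_mult powr_powr)
        then show ?thesis by (simp add: ennreal_mult)
      next
        case False
        then have "max \<xi> \<bar>x\<bar> = \<bar>x\<bar>" by (auto simp: max_def)
        moreover have "?P x = 0" using False by (auto simp: cell_taylor_def \<xi>_def)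
        ultimately show ?thesis by simp
      qed
    qed
    also have "\<dots> = (\<integral>\<^sup>+ x. ennreal ((\<bar>x\<bar> powr \<kappa> * \<bar>F 0 x * ?w x\<bar>) powr p) \<partial>lborel) + ennreal (\<xi> powr (\<kappa> * p)) * pow_int p ?u1"
      by (subst nn_integral_add, measurable, subst nn_integral_cmult, measurable)
    also have "\<dots> \<le> ennreal C1 + ennreal (\<xi> powr (\<kappa> * p)) * ennreal (C2 * h powr (Suc r * p))"
      by (intro add_mono mult_left_mono dec u1) auto
    also have "\<dots> = ennreal (C1 + C2 * (\<xi> powr (\<kappa> * p) * h powr (Suc r * p)))"
      using C1 C2 by (simp add: mult_ac flip: ennreal_plus ennreal_mult)
    also have "\<xi> powr (\<kappa> * p) * h powr (Suc r * p) = (\<xi> powr (lam - 1) * h) powr (Suc r * p)"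
      by (simp add: powr_mult powr_powr \<kappa>_def mult.assoc)
    also have "\<dots> = 2 powr (Suc r * p)" by (simp only: \<xi>h)
    also have "ennreal (C1 + C2 * 2 powr (Suc r * p)) \<le> ennreal D" by (intro ennreal_leI) (simp add: D_def)
    finally have "pow_int q (\<lambda>x. (F 0 x - ?P x) * ?w x) \<le> ennreal (C3 * \<xi> powr (1 - q / p - \<kappa> * q))"
      by (intro C3(2) \<xi>) auto
    also have "\<xi> powr (1 - q / p - \<kappa> * q) = real m powr (- width_exponent lam (Suc r) p q * q)"
    proof -
      have "1 / lam * (1 - q / p - \<kappa> * q) = - width_exponent lam (Suc r) p q * q"
        using q lam by (simp add: \<rho>\<kappa> field_simps)
      then show ?thesis by (simp add: \<xi>_def powr_powr)
    qed
    finally show "pow_int q (\<lambda>x. (F 0 x - ?P x) * ?w x) \<le> ennreal (C3 * real m powr (- width_exponent lam (Suc r) p q * q))" .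
  qed
qed

section \<open>The upper bound for linear widths\<close>

lemma subspace_dim_leI:
  assumes "subspace S" "S \<subseteq> span B" "finite B" "card B \<le> n"
  shows "subspace_dim_le n S"
proof -
  obtain B' where B': "B' \<subseteq> S" "independent B'" "S \<subseteq> span B'"
    using maximal_independent_subset[of S] by blast
  have "finite B' \<and> card B' \<le> card B"
    using B' assms by (intro independent_span_bound) auto
  moreover have "S = span B'"
    using B' assms by (metis span_minimal subset_antisym)
  ultimately show ?thesis using assms unfolding subspace_dim_le_def by (intro exI[of _ B']) auto
qed

text \<open>The range of an admissible operator is an admissible subspace.\<close>

lemma kolmogorov_width_le_linear_width:
  assumes "F \<subseteq> X"
  shows "kolmogorov_width X N F n \<le> linear_width X N F n"
  unfolding linear_width_def
proof (rule INF_greatest)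
  fix A assume A: "A \<in> {A. linear_operator_on X A \<and> subspace_dim_le n (A ` X)}"
  have "kolmogorov_width X N F n \<le> (SUP f\<in>F. INF g\<in>A ` X. N (f - g))"
    unfolding kolmogorov_width_def using A by (intro INF_lower) (auto simp: linear_operator_on_def)
  also have "\<dots> \<le> (SUP f\<in>F. N (f - A f))"
    using assms by (intro SUP_mono) (blast intro: INF_lower)
  finally show "kolmogorov_width X N F n \<le> (SUP f\<in>F. N (f - A f))" .
qed

definition chain_space :: "nat \<Rightarrow> meas_fun set" where
  "chain_space r = {mf (F 0) |F. sobolev_chain r F}"

lemma mf_sum:
  assumes "finite J" "\<And>j. j \<in> J \<Longrightarrow> g j \<in> borel_measurable borel"
  shows "(\<Sum>j\<in>J. a j *\<^sub>R mf (g j)) = mf (\<lambda>x. \<Sum>j\<in>J. a j * g j x)"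
  using assms
proof (induction J)
  case (insert j J)
  then show ?case by (simp add: mf_scaleR mf_arith borel_measurable_sum)
qed (simp add: mf_zero)

lemma sobolev_chain_zero: "sobolev_chain r (\<lambda>_ _. 0)"
  by (simp add: sobolev_chain_def primitive_def loc_int_continuous set_lebesgue_integral_def)

text \<open>Point values of derivatives are defined for chains, while the operator has to act linearly on classes. Fixing one chain
  for every member of a basis of \<open>chain_space r\<close> and extending linearly makes the operator linear by construction; the
  chain of a linear combination is then the combination of the fixed chains.\<close>

lemma sampling_operator_exists:
  fixes e :: "'j \<Rightarrow> meas_fun" and \<kappa> :: "'j \<Rightarrow> nat" and y :: "'j \<Rightarrow> real"
  assumes J: "finite J"
  obtains A where "linear A" "range A \<subseteq> span (e ` J)"
    "\<And>f. f \<in> chain_space r \<Longrightarrow>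
      \<exists>F. sobolev_chain r F \<and> f = mf (F 0) \<and> A f = (\<Sum>j\<in>J. F (\<kappa> j) (y j) *\<^sub>R e j)"
proof -
  obtain B where B: "B \<subseteq> chain_space r" "independent B" "chain_space r \<subseteq> span B"
    using maximal_independent_subset[of "chain_space r"] by blast
  have "\<exists>F. sobolev_chain r F \<and> b = mf (F 0)" if "b \<in> B" for b
    using that B(1) by (auto simp: chain_space_def)
  then obtain \<Phi> where \<Phi>: "\<And>b. b \<in> B \<Longrightarrow> sobolev_chain r (\<Phi> b)" "\<And>b. b \<in> B \<Longrightarrow> b = mf (\<Phi> b 0)"
    by metis
  define v where "v b = (\<Sum>j\<in>J. \<Phi> b (\<kappa> j) (y j) *\<^sub>R e j)" for b
  define A where "A = construct B v"
  have lin: "linear A" unfolding A_def by (rule linear_construct[OF B(2)])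
  have "\<exists>F. sobolev_chain r F \<and> f = mf (F 0) \<and> A f = (\<Sum>j\<in>J. F (\<kappa> j) (y j) *\<^sub>R e j)"
    if "f \<in> span B" for f
    using that
  proof (induction rule: span_induct_alt)
    case base
    show ?case using sobolev_chain_zero mf_zero linear_0[OF lin] by fastforce
  next
    case (step c b g)
    then obtain G where G: "sobolev_chain r G" "g = mf (G 0)" "A g = (\<Sum>j\<in>J. G (\<kappa> j) (y j) *\<^sub>R e j)"
      by blast
    define F where "F k x = c * \<Phi> b k x + G k x" for k x
    have "sobolev_chain r F" unfolding F_def[abs_def]
      by (intro sobolev_chain_add sobolev_chain_cmult \<Phi> G step)
    moreover have "c *\<^sub>R b + g = mf (F 0)"
    proof -
      have [measurable]: "\<Phi> b 0 \<in> borel_measurable borel" "G 0 \<in> borel_measurable borel"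
        using sobolev_chain_measurable[OF \<Phi>(1)[OF step(1)]] sobolev_chain_measurable[OF G(1)] by auto
      have "c *\<^sub>R b = mf (\<lambda>x. c * \<Phi> b 0 x)"
        using \<Phi>(2)[OF step(1)] mf_scaleR[of "\<Phi> b 0" c] by simp
      then show ?thesis by (simp add: G(2) mf_arith F_def[abs_def])
    qed
    moreover have "A (c *\<^sub>R b + g) = (\<Sum>j\<in>J. F (\<kappa> j) (y j) *\<^sub>R e j)"
    proof -
      have "A b = v b" unfolding A_def by (rule construct_basis[OF B(2) step(1)])
      then show ?thesis
        by (simp add: linear_add[OF lin] linear_scale[OF lin] G(3) v_def F_def scaleR_sum_right
            scaleR_add_left sum.distrib)
    qed
    ultimately show ?case by blast
  qed
  moreover have "range A \<subseteq> span (e ` J)"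
  proof -
    have "v ` B \<subseteq> span (e ` J)" unfolding v_def
      by (intro image_subsetI span_sum span_scale span_base imageI)
    then have "span (v ` B) \<subseteq> span (e ` J)" by (simp add: span_minimal)
    moreover have "A f \<in> span (v ` B)" for f unfolding A_def by (rule construct_in_span[OF B(2)])
    ultimately show ?thesis by blast
  qed
  ultimately show ?thesis using lin B(3) by (intro that) auto
qed

definition cell_monomial :: "real \<Rightarrow> real \<Rightarrow> nat \<Rightarrow> nat \<Rightarrow> real \<Rightarrow> real" where
  "cell_monomial \<xi> h i k x =
    indicator {- \<xi> + real i * h..<- \<xi> + real i * h + h} x * ((x - (- \<xi> + real i * h)) ^ k / fact k)"

lemma cell_monomial_measurable [measurable]: "cell_monomial \<xi> h i k \<in> borel_measurable borel"
  unfolding cell_monomial_def[abs_def] by measurable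

lemma cell_monomial_in_Lp:
  assumes "a > 0" "h > 0" "q > 0"
  shows "mf (cell_monomial \<xi> h i k) \<in> Lp_weight q (freud_weight lam a b)"
proof -
  define c where "c = - \<xi> + real i * h"
  define M where "M = (h ^ k * exp b) powr q"
  have "pow_int q (\<lambda>x. cell_monomial \<xi> h i k x * freud_weight lam a b x)
      \<le> (\<integral>\<^sup>+ x. ennreal M * indicator {c..<c + h} x \<partial>lborel)"
  proof (intro nn_integral_mono)
    fix x
    show "ennreal (\<bar>cell_monomial \<xi> h i k x * freud_weight lam a b x\<bar> powr q) \<le> ennreal M * indicator {c..<c + h} x"
    proof (cases "x \<in> {c..<c + h}")
      case True
      have "(x - c) ^ k / fact k \<le> h ^ k / 1"
        using True by (intro frac_le power_mono) (auto simp: fact_ge_1)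
      moreover have "freud_weight lam a b x \<le> exp b" using assms by (simp add: freud_weight_def)
      ultimately have "(x - c) ^ k / fact k * freud_weight lam a b x \<le> h ^ k * exp b"
        using True freud_weight_pos[of lam a b x] assms by (intro mult_mono) auto
      then have "((x - c) ^ k / fact k * freud_weight lam a b x) powr q \<le> M"
        unfolding M_def using True assms freud_weight_pos[of lam a b x] by (intro powr_mono2) auto
      then show ?thesis using True freud_weight_pos[of lam a b x]
        by (simp add: cell_monomial_def c_def abs_mult ennreal_leI)
    next
      case False
      then show ?thesis by (simp add: cell_monomial_def c_def)
    qed
  qed
  also have "\<dots> < \<infinity>" using assms by (subst nn_integral_cmult_indicator) (auto simp: ennreal_mult_less_top)
  finally show ?thesis by (simp add: Lp_weight_iff Lp_weight_integral_mf)
qed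

lemma cell_taylor_eq_sum:
  assumes \<xi>: "\<xi> > 0" and m: "m \<ge> 1"
  shows "cell_taylor r \<xi> m F x
    = (\<Sum>(i,k)\<in>{..<m} \<times> {..<r}. F k (- \<xi> + real i * (2 * \<xi> / m)) * cell_monomial \<xi> (2 * \<xi> / m) i k x)"
proof -
  define h where "h = 2 * \<xi> / m"
  have h: "h > 0" "real m * h = 2 * \<xi>" using \<xi> m by (auto simp: h_def)
  have "(\<Sum>(i,k)\<in>{..<m} \<times> {..<r}. F k (- \<xi> + real i * h) * cell_monomial \<xi> h i k x)
      = (\<Sum>i<m. indicator {- \<xi> + real i * h..<- \<xi> + real i * h + h} x * taylor r F (- \<xi> + real i * h) x)"
    by (simp add: sum.cartesian_product[symmetric] cell_monomial_def taylor_def sum_distrib_left mult_ac)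
  also have "\<dots> = cell_taylor r \<xi> m F x"
  proof (cases "x \<in> {-\<xi>..<\<xi>}")
    case True
    define j where "j = \<lfloor>(x + \<xi>) / h\<rfloor>"
    have j0: "0 \<le> j" using True h by (auto simp: j_def)
    have "(x + \<xi>) / h < m" using True h by (simp add: divide_less_eq)
    then have "j < int m" by (simp add: j_def floor_less_iff)
    define i0 where "i0 = nat j"
    have i0: "i0 < m" "real i0 = real_of_int j" using j0 \<open>j < int m\<close> by (auto simp: i0_def)
    have nd: "node \<xi> h x = - \<xi> + real i0 * h" by (simp add: node_def j_def[symmetric] i0)
    note nb = node_bounds[OF h(1), where \<xi> = \<xi> and x = x]
    have ind: "indicator {- \<xi> + real i * h..<- \<xi> + real i * h + h} x = (if i = i0 then 1 else (0::real))" for i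
    proof -
      have "x \<in> {- \<xi> + real i * h..<- \<xi> + real i * h + h} \<longleftrightarrow> i = i0"
      proof
        assume "x \<in> {- \<xi> + real i * h..<- \<xi> + real i * h + h}"
        then have "\<lfloor>(x + \<xi>) / h\<rfloor> = int i" using h by (simp add: floor_eq_iff field_simps)
        then show "i = i0" by (simp add: i0_def j_def)
      qed (use nb nd in auto)
      then show ?thesis by (auto simp: indicator_def)
    qed
    have "(\<Sum>i<m. indicator {- \<xi> + real i * h..<- \<xi> + real i * h + h} x * taylor r F (- \<xi> + real i * h) x)
      = (\<Sum>i<m. if i = i0 then taylor r F (- \<xi> + real i * h) x else 0)"
      unfolding ind by (intro sum.cong refl) auto
    also have "\<dots> = taylor r F (- \<xi> + real i0 * h) x" using i0 by simp
    finally show ?thesis using True nd by (simp add: cell_taylor_def flip: h_def)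
  next
    case False
    have "x \<notin> {- \<xi> + real i * h..<- \<xi> + real i * h + h}" if "i < m" for i
    proof
      assume "x \<in> {- \<xi> + real i * h..<- \<xi> + real i * h + h}"
      then have l: "- \<xi> + real i * h \<le> x" "x < - \<xi> + real i * h + h" by auto
      have "real (Suc i) * h \<le> real m * h" using that h by (intro mult_right_mono) auto
      then have "real i * h + h \<le> 2 * \<xi>" using h(2) by (simp add: algebra_simps)
      moreover have "0 \<le> real i * h" using h by simp
      ultimately have "- \<xi> \<le> x \<and> x < \<xi>" using l by linarith
      with False show False by simp
    qed
    then show ?thesis using False by (simp add: cell_taylor_def)
  qed
  finally show ?thesis by (simp add: h_def)
qed

text \<open>With \<open>m = n div Suc r\<close> cells and \<open>Suc r\<close> Taylor coefficients on each of them the operator has rank at most \<open>n\<close>, and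
  \<open>m\<close> is comparable with \<open>n\<close>. If \<open>n < Suc r\<close> the zero operator suffices.\<close>

lemma linear_width_upper_bound:
  fixes lam a b p q :: real and r :: nat
  assumes lam: "lam > 1" "a > 0" and q: "1 \<le> q" "q \<le> p" and \<rho>: "width_exponent lam (Suc r) p q > 0"
  defines "w \<equiv> freud_weight lam a b"
  shows "\<exists>C>0. sobolev_ball (Suc r) p w \<subseteq> Lp_weight q w \<and>
    (\<forall>n\<ge>1. linear_width (Lp_weight q w) (Lp_weight_norm q w) (sobolev_ball (Suc r) p w) n
       \<le> ennreal (C * real n powr (- width_exponent lam (Suc r) p q)))"
proof -
  let ?X = "Lp_weight q w" and ?ball = "sobolev_ball (Suc r) p w" and ?N = "Lp_weight_norm q w"
  define \<rho> where "\<rho> = width_exponent lam (Suc r) p q"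
  have \<rho>0: "\<rho> > 0" using assms by (simp add: \<rho>_def)
  have [measurable]: "w \<in> borel_measurable borel" by (simp add: w_def)
  have sX: "subspace ?X" using q by (intro subspace_Lp_weight) auto
  obtain C where C: "C > 0" and C1: "\<And>F. sobolev_chain (Suc r) F \<Longrightarrow>
     (\<forall>k\<le>Suc r. pow_int p (\<lambda>x. F k x * w x) \<le> 1) \<Longrightarrow>
     pow_int q (\<lambda>x. F 0 x * w x) \<le> ennreal C"
   and C2: "\<And>F m. sobolev_chain (Suc r) F \<Longrightarrow>
     (\<forall>k\<le>Suc r. pow_int p (\<lambda>x. F k x * w x) \<le> 1) \<Longrightarrow> m \<ge> 1 \<Longrightarrow>
       cell_taylor (Suc r) (real m powr (1 / lam)) m F \<in> borel_measurable borel \<Longrightarrow>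
       pow_int q (\<lambda>x. (F 0 x - cell_taylor (Suc r) (real m powr (1 / lam)) m F x) * w x)
         \<le> ennreal (C * real m powr (- \<rho> * q))"
    using approximation_error[OF lam q \<rho>, of b] unfolding w_def[symmetric] \<rho>_def[symmetric] by blast
  (* The extension of the operator produces some chain of f, not necessarily the one given by membership in the ball;
     uniqueness of weak derivatives transfers the norm bounds. *)
  have ball: "\<forall>k\<le>Suc r. pow_int p (\<lambda>x. F k x * w x) \<le> 1"
    if f: "f \<in> ?ball" and F: "sobolev_chain (Suc r) F" "f = mf (F 0)" for f F
  proof (intro allI impI)
    fix k assume k: "k \<le> Suc r"
    have "p \<ge> 1" using q by simp
    from sobolev_ball_chain[OF f this] obtain G where G: "sobolev_chain (Suc r) G" "f = mf (G 0)"
      "\<And>k. k \<le> Suc r \<Longrightarrow> pow_int p (\<lambda>x. G k x * w x) \<le> 1" by metis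
    have "mf (F k) = mf (G k)"
      using sobolev_chain_weak_deriv[OF F(1) k] sobolev_chain_weak_deriv[OF G(1) k] F(2) G(2) by simp
    then show "pow_int p (\<lambda>x. F k x * w x) \<le> 1"
      using G(3)[OF k] Lp_weight_integral_mf[OF sobolev_chain_measurable[OF F(1) k], of p w]
        Lp_weight_integral_mf[OF sobolev_chain_measurable[OF G(1) k], of p w] by simp
  qed
  have in_chain: "f \<in> chain_space (Suc r)" if "f \<in> ?ball" for f
  proof -
    have "p \<ge> 1" using q by simp
    from sobolev_ball_chain[OF that this] obtain F where "sobolev_chain (Suc r) F" "f = mf (F 0)" by metis
    then show ?thesis unfolding chain_space_def by blast
  qed
  have Nf: "?N f \<le> ennreal (C powr (1 / q))" "f \<in> ?X" if f: "f \<in> ?ball" for f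
  proof -
    obtain F where F: "sobolev_chain (Suc r) F" "f = mf (F 0)" using in_chain[OF f] by (auto simp: chain_space_def)
    have "Lp_weight_integral q w f \<le> ennreal C"
      using C1[OF F(1) ball[OF f F]] sobolev_chain_measurable[OF F(1), of 0] by (simp add: F(2) Lp_weight_integral_mf)
    moreover have "(C powr (1 / q)) powr q = C" using C q by (simp add: powr_powr)
    ultimately show "?N f \<le> ennreal (C powr (1 / q))" "f \<in> ?X"
      using q by (auto intro!: Lp_weight_norm_le simp: Lp_weight_iff intro: le_less_trans)
  qed
  define C' where "C' = C powr (1 / q) * (2 * Suc r) powr \<rho>"
  have C': "C' > 0" using C by (simp add: C'_def)
  have "linear_width ?X ?N ?ball n \<le> ennreal (C' * real n powr (- \<rho>))" if n: "n \<ge> 1" for n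
  proof -
    have "\<exists>A. linear_operator_on ?X A \<and> subspace_dim_le n (A ` ?X) \<and>
       (\<forall>f\<in>?ball. ?N (f - A f) \<le> ennreal (C' * real n powr (- \<rho>)))"
    proof (cases "n < Suc r")
      case True
      have "real n powr \<rho> \<le> (2 * Suc r) powr \<rho>" using True \<rho>0 by (intro powr_mono2) auto
      then have "1 \<le> (2 * Suc r) powr \<rho> * real n powr (- \<rho>)"
        using n by (simp add: powr_minus field_simps)
      then have "C powr (1 / q) * 1 \<le> C powr (1 / q) * ((2 * Suc r) powr \<rho> * real n powr (- \<rho>))"
        by (intro mult_left_mono) auto
      then have le: "C powr (1 / q) \<le> C' * real n powr (- \<rho>)" by (simp add: C'_def mult_ac)
      show ?thesis
      proof (intro exI[of _ "\<lambda>_. 0"] conjI ballI)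
        show "linear_operator_on ?X (\<lambda>_. 0)"
          using subspace_0[OF sX] by (auto simp: linear_operator_on_def)
        show "subspace_dim_le n ((\<lambda>_. 0) ` ?X)"
          using subspace_0[OF sX] by (intro subspace_dim_leI[of _ "{}"]) (auto simp: subspace_def)
        fix f assume "f \<in> ?ball"
        from Nf(1)[OF this] show "?N (f - 0) \<le> ennreal (C' * real n powr (- \<rho>))"
          using le by (simp add: ennreal_leI order_trans)
      qed
    next
      case False
      define m where "m = n div Suc r"
      have m: "m \<ge> 1" using False by (simp add: m_def div_greater_zero_iff Suc_le_eq)
      have mn: "m * Suc r \<le> n" unfolding m_def by (rule div_times_less_eq_dividend)
      have "n < Suc r * (m + 1)" using dividend_less_times_div[of "Suc r" n] by (simp add: m_def)
      also have "\<dots> \<le> Suc r * (2 * m)" using m by (intro mult_left_mono) auto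
      finally have nm: "real n \<le> 2 * Suc r * real m" by (simp flip: of_nat_mult of_nat_le_iff del: of_nat_Suc)
      define \<xi> where "\<xi> = real m powr (1 / lam)"
      have \<xi>: "\<xi> > 0" using m by (simp add: \<xi>_def)
      define h where "h = 2 * \<xi> / m"
      have h: "h > 0" using \<xi> m by (simp add: h_def)
      define J where "J = {..<m} \<times> {..<Suc r}"
      define e where "e = (\<lambda>(i,k). mf (cell_monomial \<xi> h i k))"
      have J: "finite J" "card J = m * Suc r" by (auto simp: J_def card_cartesian_product)
      obtain A where A: "linear A" "range A \<subseteq> span (e ` J)"
        "\<And>f. f \<in> chain_space (Suc r) \<Longrightarrow>
          \<exists>F. sobolev_chain (Suc r) F \<and> f = mf (F 0) \<and> A f = (\<Sum>j\<in>J. F (snd j) (- \<xi> + real (fst j) * h) *\<^sub>R e j)"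
        using sampling_operator_exists[OF J(1), of e "Suc r" snd "\<lambda>j. - \<xi> + real (fst j) * h"] by blast
      have "e ` J \<subseteq> ?X" using cell_monomial_in_Lp[OF lam(2) h] q by (auto simp: e_def w_def)
      then have spX: "span (e ` J) \<subseteq> ?X" using sX by (rule span_minimal)
      show ?thesis
      proof (intro exI[of _ A] conjI ballI)
        show "linear_operator_on ?X A"
          using A(1,2) spX by (auto simp: linear_operator_on_def linear_add linear_scale)
        show "subspace_dim_le n (A ` ?X)"
        proof (rule subspace_dim_leI)
          show "subspace (A ` ?X)" by (rule linear_subspace_image[OF A(1) sX])
          show "A ` ?X \<subseteq> span (e ` J)" using A(2) by auto
          show "finite (e ` J)" using J by simp
          show "card (e ` J) \<le> n" using card_image_le[OF J(1), of e] J(2) mn by linarith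
        qed
        fix f assume f: "f \<in> ?ball"
        obtain F where F: "sobolev_chain (Suc r) F" "f = mf (F 0)"
          "A f = (\<Sum>j\<in>J. F (snd j) (- \<xi> + real (fst j) * h) *\<^sub>R e j)" using A(3)[OF in_chain[OF f]] by blast
        let ?P = "cell_taylor (Suc r) \<xi> m F"
        have P: "?P = (\<lambda>x. \<Sum>j\<in>J. F (snd j) (- \<xi> + real (fst j) * h) * cell_monomial \<xi> h (fst j) (snd j) x)"
          using cell_taylor_eq_sum[OF \<xi> m, of "Suc r" F] unfolding h_def J_def by (simp add: fun_eq_iff case_prod_beta)
        have Pm: "?P \<in> borel_measurable borel" unfolding P by measurable
        have Af: "A f = mf ?P"
          unfolding P F(3) e_def case_prod_beta using J(1) by (intro mf_sum) auto
        have F0: "F 0 \<in> borel_measurable borel" by (rule sobolev_chain_measurable[OF F(1)]) simp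
        have "f - A f = mf (\<lambda>x. F 0 x - ?P x)" using mf_arith(2)[OF F0 Pm] Af F(2) by simp
        then have "Lp_weight_integral q w (f - A f) = pow_int q (\<lambda>x. (F 0 x - ?P x) * w x)"
          using F0 Pm by (simp add: Lp_weight_integral_mf)
        also have "\<dots> \<le> ennreal (C * real m powr (- \<rho> * q))"
          using C2[OF F(1) ball[OF f F(1,2)] m] Pm by (simp add: \<xi>_def)
        also have "C * real m powr (- \<rho> * q) = (C powr (1 / q) * real m powr (- \<rho>)) powr q"
          using C q by (simp add: powr_mult powr_powr)
        finally have "?N (f - A f) \<le> ennreal (C powr (1 / q) * real m powr (- \<rho>))"
          using q by (intro Lp_weight_norm_le) auto
        also have "\<dots> \<le> ennreal (C' * real n powr (- \<rho>))"
        proof (rule ennreal_leI)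
          have "real n powr \<rho> \<le> (2 * Suc r * real m) powr \<rho>" using nm \<rho>0 by (intro powr_mono2) auto
          also have "\<dots> = (2 * Suc r) powr \<rho> * real m powr \<rho>" by (rule powr_mult)
          finally have "real m powr (- \<rho>) \<le> (2 * Suc r) powr \<rho> * real n powr (- \<rho>)"
            using n m by (simp add: powr_minus field_simps)
          from mult_left_mono[OF this, of "C powr (1 / q)"]
          show "C powr (1 / q) * real m powr (- \<rho>) \<le> C' * real n powr (- \<rho>)"
            by (simp add: C'_def mult_ac)
        qed
        finally show "?N (f - A f) \<le> ennreal (C' * real n powr (- \<rho>))" .
      qed
    qed
    then obtain A where A: "linear_operator_on ?X A" "subspace_dim_le n (A ` ?X)"
       "\<And>f. f \<in> ?ball \<Longrightarrow> ?N (f - A f) \<le> ennreal (C' * real n powr (- \<rho>))" by blast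
    have "linear_width ?X ?N ?ball n \<le> (SUP f\<in>?ball. ?N (f - A f))"
      unfolding linear_width_def using A(1,2) by (intro INF_lower) auto
    also have "\<dots> \<le> ennreal (C' * real n powr (- \<rho>))" by (intro SUP_least A(3))
    finally show ?thesis .
  qed
  with C' Nf(2) show ?thesis unfolding \<rho>_def by blast
qed

section \<open>Sections of the cube\<close>

text \<open>Gaussian elimination: an equation with a nonzero coefficient removes itself and one unknown.\<close>

lemma homogeneous_system_solution:
  fixes A :: "'k \<Rightarrow> 'i \<Rightarrow> real"
  assumes "finite K" "finite I" "card K < card I"
  shows "\<exists>z. (\<exists>i\<in>I. z i \<noteq> 0) \<and> (\<forall>k\<in>K. (\<Sum>i\<in>I. A k i * z i) = 0)"
  using assms
proof (induction K arbitrary: I A)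
  case empty
  then obtain i where "i \<in> I" by fastforce
  then show ?case by (intro exI[of _ "\<lambda>_. 1"]) auto
next
  case (insert k0 K)
  show ?case
  proof (cases "\<forall>i\<in>I. A k0 i = 0")
    case True
    have "card K < card I" using insert.prems insert.hyps by simp
    from insert.IH[OF insert.prems(1) this, of A] True show ?thesis by auto
  next
    case False
    then obtain i0 where i0: "i0 \<in> I" "A k0 i0 \<noteq> 0" by blast
    have c: "card K < card (I - {i0})" using insert.prems insert.hyps i0 by simp
    from insert.IH[OF _ c, of "\<lambda>k i. A k i - A k i0 * A k0 i / A k0 i0"] insert.prems
    obtain z where z: "\<exists>i\<in>I - {i0}. z i \<noteq> 0"
      "\<And>k. k \<in> K \<Longrightarrow> (\<Sum>i\<in>I - {i0}. (A k i - A k i0 * A k0 i / A k0 i0) * z i) = 0" by auto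
    define s where "s = (\<Sum>i\<in>I - {i0}. A k0 i * z i)"
    define z' where "z' = z(i0 := - s / A k0 i0)"
    have sum': "(\<Sum>i\<in>I. A k i * z' i) = - (A k i0 * s / A k0 i0) + (\<Sum>i\<in>I - {i0}. A k i * z i)" for k
    proof -
      have "(\<Sum>i\<in>I. A k i * z' i) = A k i0 * z' i0 + (\<Sum>i\<in>I - {i0}. A k i * z' i)"
        using insert.prems i0 by (intro sum.remove) auto
      also have "(\<Sum>i\<in>I - {i0}. A k i * z' i) = (\<Sum>i\<in>I - {i0}. A k i * z i)"
        by (intro sum.cong) (auto simp: z'_def)
      finally show ?thesis by (simp add: z'_def)
    qed
    have "(\<Sum>i\<in>I. A k i * z' i) = 0" if "k \<in> insert k0 K" for k
    proof (cases "k = k0")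
      case True
      then show ?thesis using sum'[of k0] i0 by (simp add: s_def)
    next
      case False
      have "(\<Sum>i\<in>I - {i0}. (A k i - A k i0 * A k0 i / A k0 i0) * z i)
        = (\<Sum>i\<in>I - {i0}. A k i * z i - (A k i0 / A k0 i0) * (A k0 i * z i))"
        by (intro sum.cong refl) (simp add: left_diff_distrib)
      then have "(\<Sum>i\<in>I - {i0}. (A k i - A k i0 * A k0 i / A k0 i0) * z i)
        = (\<Sum>i\<in>I - {i0}. A k i * z i) - A k i0 * s / A k0 i0"
        by (simp only: s_def sum_subtractf sum_distrib_left[symmetric]) simp
      then show ?thesis using sum'[of k] z(2)[of k] that False by simp
    qed
    moreover have "\<exists>i\<in>I. z' i \<noteq> 0" using z(1) by (auto simp: z'_def)
    ultimately show ?thesis by blast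
  qed
qed

text \<open>Moving from \<open>y\<close> in the direction \<open>z\<close>, the first coordinate to reach the boundary of the cube stops the motion.\<close>

lemma push_to_cube_boundary:
  fixes y z :: "'i \<Rightarrow> real"
  assumes J: "finite J" and y: "\<And>i. i \<in> J \<Longrightarrow> \<bar>y i\<bar> \<le> 1" and z: "\<exists>i\<in>J. z i \<noteq> 0"
  obtains t where "\<And>i. i \<in> J \<Longrightarrow> \<bar>y i + t * z i\<bar> \<le> 1" "\<exists>i\<in>J. \<bar>y i + t * z i\<bar> = 1"
proof -
  (* The time at which coordinate i reaches the face of the cube towards which z i points. *)
  define T where "T = (\<lambda>i. (1 - sgn (z i) * y i) / \<bar>z i\<bar>) ` {i\<in>J. z i \<noteq> 0}"
  have T: "finite T" "T \<noteq> {}" using J z by (auto simp: T_def)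
  define t where "t = Min T"
  have nonneg: "0 \<le> 1 - sgn (z i) * y i" if "i \<in> J" for i
    using y[OF that] by (auto simp: sgn_if abs_if split: if_splits)
  have t0: "t \<ge> 0" unfolding t_def using T nonneg by (auto simp: T_def)
  have abs_s: "\<bar>y i + t * z i\<bar> = \<bar>sgn (z i) * y i + t * \<bar>z i\<bar>\<bar>" if "z i \<noteq> 0" for i
    using that by (auto simp: sgn_if abs_if)
  have le: "\<bar>y i + t * z i\<bar> \<le> 1" if i: "i \<in> J" for i
  proof (cases "z i = 0")
    case False
    have "t \<le> (1 - sgn (z i) * y i) / \<bar>z i\<bar>" unfolding t_def using T(1) i False by (intro Min_le) (auto simp: T_def)
    then have 1: "t * \<bar>z i\<bar> \<le> 1 - sgn (z i) * y i" using False by (simp add: field_simps)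
    have "- 1 \<le> sgn (z i) * y i" using y[OF i] by (auto simp: sgn_if abs_if split: if_splits)
    moreover have "0 \<le> t * \<bar>z i\<bar>" using t0 by simp
    ultimately show ?thesis unfolding abs_s[OF False] using 1 by (simp add: abs_le_iff)
  qed (use y i in simp)
  have "t \<in> T" unfolding t_def using T by (rule Min_in)
  then obtain i where i: "i \<in> J" "z i \<noteq> 0" "t = (1 - sgn (z i) * y i) / \<bar>z i\<bar>" by (auto simp: T_def)
  then have "sgn (z i) * y i + t * \<bar>z i\<bar> = 1" by simp
  then have "\<bar>y i + t * z i\<bar> = 1" unfolding abs_s[OF i(2)] by simp
  with le i(1) show ?thesis by (intro that[of t]) auto
qed

text \<open>Take a solution in the cube with as many coordinates on the boundary as possible. If there were fewer than
  \<open>card I - card K\<close> of them, the remaining coordinates would admit a nonzero solution of the homogeneous system, and moving along it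
  would bring another coordinate to the boundary.\<close>

lemma cube_section_vertex:
  fixes A :: "'k \<Rightarrow> 'i \<Rightarrow> real"
  assumes K: "finite K" and I: "finite I"
  obtains y where "\<And>i. i \<in> I \<Longrightarrow> \<bar>y i\<bar> \<le> 1" "\<And>k. k \<in> K \<Longrightarrow> (\<Sum>i\<in>I. A k i * y i) = 0"
    "card I - card K \<le> card {i\<in>I. \<bar>y i\<bar> = 1}"
proof -
  define P where "P y \<longleftrightarrow> (\<forall>i\<in>I. \<bar>y i\<bar> \<le> 1) \<and> (\<forall>k\<in>K. (\<Sum>i\<in>I. A k i * y i) = 0)" for y
  define T where "T y = {i\<in>I. \<bar>y i :: real\<bar> = 1}" for y
  have "P (\<lambda>_. 0)" by (simp add: P_def)
  moreover have bound: "\<forall>y. P y \<longrightarrow> card (T y) < Suc (card I)"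
    using I by (auto simp: T_def less_Suc_eq_le intro: card_mono)
  ultimately obtain y where y: "P y" "\<And>y'. P y' \<Longrightarrow> card (T y') \<le> card (T y)"
    using ex_has_greatest_nat[of P "\<lambda>_. 0" "\<lambda>y. card (T y)" "Suc (card I)"] by blast
  have "card I - card K \<le> card (T y)"
  proof (rule ccontr)
    assume "\<not> card I - card K \<le> card (T y)"
    moreover have "card (I - T y) = card I - card (T y)"
      using I by (intro card_Diff_subset) (auto simp: T_def)
    ultimately have "card K < card (I - T y)" by linarith
    from homogeneous_system_solution[OF K _ this, of A] I
    obtain z where z: "\<exists>i\<in>I - T y. z i \<noteq> 0" "\<And>k. k \<in> K \<Longrightarrow> (\<Sum>i\<in>I - T y. A k i * z i) = 0" by auto
    obtain t where t: "\<And>i. i \<in> I - T y \<Longrightarrow> \<bar>y i + t * z i\<bar> \<le> 1" "\<exists>i\<in>I - T y. \<bar>y i + t * z i\<bar> = 1"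
    proof (rule push_to_cube_boundary[of "I - T y" y z])
      show "finite (I - T y)" using I by simp
      show "\<bar>y i\<bar> \<le> 1" if "i \<in> I - T y" for i using y(1) that by (simp add: P_def)
    qed (use z in blast)+
    define y' where "y' i = (if i \<in> T y then y i else y i + t * z i)" for i
    have TI: "T y \<subseteq> I" by (auto simp: T_def)
    have "(\<Sum>i\<in>I. A k i * y' i) = 0" if k: "k \<in> K" for k
    proof -
      have "(\<Sum>i\<in>I. A k i * y' i) = (\<Sum>i\<in>I. A k i * y i + (if i \<in> I - T y then t * (A k i * z i) else 0))"
        by (intro sum.cong) (auto simp: y'_def algebra_simps)
      also have "\<dots> = (\<Sum>i\<in>I. A k i * y i) + (\<Sum>i\<in>I - T y. t * (A k i * z i))"
      proof -
        have "(\<Sum>i\<in>I. if i \<in> I - T y then t * (A k i * z i) else 0) = (\<Sum>i\<in>I - T y. t * (A k i * z i))"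
          using I by (intro sum.mono_neutral_cong_right) auto
        then show ?thesis by (simp only: sum.distrib)
      qed
      also have "\<dots> = 0" using y(1) z(2)[OF k] k by (simp add: P_def flip: sum_distrib_left)
      finally show ?thesis .
    qed
    moreover have "\<bar>y' i\<bar> \<le> 1" if "i \<in> I" for i
      using y(1) t(1)[of i] that by (auto simp: y'_def P_def)
    ultimately have "P y'" by (simp add: P_def)
    moreover have "card (T y) < card (T y')"
    proof (rule psubset_card_mono)
      show "finite (T y')" using I by (simp add: T_def)
      show "T y \<subset> T y'" using t(2) by (auto simp: T_def y'_def)
    qed
    ultimately show False using y(2) by fastforce
  qed
  with y(1) show ?thesis by (intro that[of y]) (auto simp: P_def T_def)
qed

section \<open>Combinations of bumps on a grid\<close>

text \<open>The support lies in the interior of the unit interval, so that translates belonging to different cells do not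
  interact even at common end points.\<close>

definition bump_deriv :: "nat \<Rightarrow> real \<Rightarrow> real" where
  "bump_deriv k = (deriv ^^ k) (bump (1/4) (3/4) 1)"

lemma bump_deriv_derivative: "(bump_deriv k has_real_derivative bump_deriv (Suc k) x) (at x)"
  using smooth_gen_deriv(2)[OF smooth_gen_derivs[OF smooth_gen_bump[of "1/4" "3/4" 1]]]
  by (simp add: bump_deriv_def)

lemma bump_deriv_continuous: "continuous_on S (bump_deriv k)"
  using bump_deriv_derivative by (meson DERIV_isCont continuous_at_imp_continuous_on)

lemma bump_deriv_support: "x \<notin> {1/4..3/4} \<Longrightarrow> bump_deriv k x = 0"
proof (induction k arbitrary: x)
  case 0
  then have "x \<notin> {1/4<..<3/4}" by auto
  from bump_eq_0[OF this, of 1] show ?case by (simp add: bump_deriv_def)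
next
  case (Suc k)
  have "((\<lambda>_. 0) has_real_derivative 0) (at x)" by simp
  then have "(bump_deriv k has_real_derivative 0) (at x)"
    by (rule has_field_derivative_transform_within_open[of _ _ _ "- {1/4..3/4}"]) (use Suc in auto)
  with bump_deriv_derivative[of k x] show ?case by (rule DERIV_unique)
qed

lemma bump_deriv_bounded:
  obtains B where "B > 0" "\<And>k x. k \<le> R \<Longrightarrow> \<bar>bump_deriv k x\<bar> \<le> B"
proof -
  have "\<exists>b. \<forall>x. \<bar>bump_deriv k x\<bar> \<le> b" for k
  proof -
    have "compact (bump_deriv k ` {1/4..3/4})"
      by (intro compact_continuous_image bump_deriv_continuous) auto
    then obtain b where b: "\<And>x. x \<in> {1/4..3/4} \<Longrightarrow> \<bar>bump_deriv k x\<bar> \<le> b"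
      by (metis (no_types, lifting) bounded_iff compact_imp_bounded image_eqI real_norm_def)
    then have "\<bar>bump_deriv k x\<bar> \<le> max b 0" for x
      using bump_deriv_support[of x k] by (cases "x \<in> {1/4..3/4}") (force simp: le_max_iff_disj)+
    then show ?thesis by blast
  qed
  then obtain b where b: "\<And>k x. \<bar>bump_deriv k x\<bar> \<le> b k" by metis
  have b0: "0 \<le> b k" for k using b[of k 0] by linarith
  show ?thesis
  proof
    show "0 < 1 + (\<Sum>k\<le>R. b k)" using b0 by (simp add: add_pos_nonneg sum_nonneg)
    fix k x assume "k \<le> R"
    then have "b k \<le> (\<Sum>k\<le>R. b k)" using b0 by (intro member_le_sum) auto
    with b[of k x] show "\<bar>bump_deriv k x\<bar> \<le> 1 + (\<Sum>k\<le>R. b k)" by linarith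
  qed
qed

lemma bump_integral_pos: "integrable lborel (bump_deriv 0)" "0 < (\<integral>x. bump_deriv 0 x \<partial>lborel)"
proof -
  have "integrable lborel (\<lambda>x. 1 * bump_deriv 0 x)"
    by (rule loc_int_times_integrable[where R = 2])
      (auto intro: loc_int_continuous bump_deriv_continuous bump_deriv_support)
  then show i: "integrable lborel (bump_deriv 0)" by simp
  have nn: "0 \<le> bump_deriv 0 x" for x by (simp add: bump_deriv_def bump_nonneg)
  have "(\<integral>x. bump_deriv 0 x \<partial>lborel) \<noteq> 0"
  proof
    assume "(\<integral>x. bump_deriv 0 x \<partial>lborel) = 0"
    then have "AE x in lborel. bump_deriv 0 x = 0"
      using integral_nonneg_eq_0_iff_AE[OF i] nn by simp
    then have "AE x\<in>{1/4<..<3/4::real} in lborel. False"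
      by eventually_elim (auto simp: bump_deriv_def bump_def flat_def)
    then have "emeasure lborel {1/4<..<3/4::real} = 0"
      by (subst (asm) AE_iff_measurable[of "{1/4<..<3/4}"]) auto
    then show False by simp
  qed
  moreover have "0 \<le> (\<integral>x. bump_deriv 0 x \<partial>lborel)" using nn by simp
  ultimately show "0 < (\<integral>x. bump_deriv 0 x \<partial>lborel)" by linarith
qed

definition cell :: "real \<Rightarrow> nat \<Rightarrow> real set" where
  "cell h i = {real i * h..<real i * h + h}"

lemma cell_measurable [measurable]: "cell h i \<in> sets borel"
  by (simp add: cell_def)

lemma cell_iff: "h > 0 \<Longrightarrow> x \<in> cell h i \<longleftrightarrow> \<lfloor>x / h\<rfloor> = int i"
  by (auto simp: cell_def floor_eq_iff field_simps)

lemma sum_indicator_cells: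
  assumes "h > 0"
  shows "(\<Sum>i<M. indicator (cell h i) x) = (indicator {0..<real M * h} x :: real)"
proof (induction M)
  case (Suc M)
  define c where "c = real M * h"
  have c: "0 \<le> c" "real (Suc M) * h = c + h"
    using assms by (simp_all add: c_def algebra_simps)
  show ?case unfolding sum.lessThan_Suc Suc.IH unfolding cell_def c_def[symmetric] c(2)
    using assms c(1) by (auto simp: indicator_def)
qed simp

lemma scaled_bump_in_cell:
  assumes "h > 0" "bump_deriv k (x / h - real i) \<noteq> 0"
  shows "x \<in> cell h i"
proof -
  have "x / h - real i \<in> {1/4..3/4}" using assms(2) bump_deriv_support by blast
  then have "1/4 \<le> x / h - real i" "x / h - real i \<le> 3/4" by simp_all
  then have "real i \<le> x / h" "x / h < real i + 1" by linarith+
  then show ?thesis unfolding cell_iff[OF assms(1)] floor_eq_iff by simp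
qed

text \<open>The \<open>k\<close>-th derivative of the combination of rescaled bumps with coefficients \<open>s\<close>.\<close>

definition bump_comb :: "real \<Rightarrow> nat \<Rightarrow> (nat \<Rightarrow> real) \<Rightarrow> nat \<Rightarrow> real \<Rightarrow> real" where
  "bump_comb h M s k x = (\<Sum>i<M. s i * (inverse h ^ k * bump_deriv k (x / h - real i)))"

lemma bump_comb_derivative:
  assumes "h > 0"
  shows "(bump_comb h M s k has_real_derivative bump_comb h M s (Suc k) x) (at x)"
  unfolding bump_comb_def
proof (rule DERIV_sum)
  fix i
  have "((\<lambda>x. x / h - real i) has_real_derivative inverse h) (at x)"
    by (auto intro!: derivative_eq_intros simp: divide_inverse)
  from DERIV_cmult[OF DERIV_cmult[OF DERIV_chain2[OF bump_deriv_derivative this], of "inverse h ^ k"], of "s i"]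
  show "((\<lambda>x. s i * (inverse h ^ k * bump_deriv k (x / h - real i))) has_real_derivative
     s i * (inverse h ^ Suc k * bump_deriv (Suc k) (x / h - real i))) (at x)"
    by (simp add: mult_ac)
qed

lemma bump_comb_continuous: "h > 0 \<Longrightarrow> continuous_on UNIV (bump_comb h M s k)"
  by (intro continuous_at_imp_continuous_on ballI DERIV_isCont[OF bump_comb_derivative])

lemma bump_comb_chain: "h > 0 \<Longrightarrow> sobolev_chain R (bump_comb h M s)"
  unfolding sobolev_chain_def
  by (intro conjI allI impI primitive_C1 bump_comb_derivative bump_comb_continuous
      loc_int_continuous[OF bump_comb_continuous])

lemma bump_comb_on_cell:
  assumes h: "h > 0" and i: "i < M"
  shows "indicator (cell h i) x * bump_comb h M s 0 x = s i * bump_deriv 0 (x / h - real i)"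
proof (cases "x \<in> cell h i")
  case True
  have "s j * (inverse h ^ 0 * bump_deriv 0 (x / h - real j)) = (if j = i then s i * bump_deriv 0 (x / h - real i) else 0)" for j
    using scaled_bump_in_cell[OF h, of 0 x j] True by (auto simp: cell_iff[OF h])
  then have "bump_comb h M s 0 x = (\<Sum>j<M. if j = i then s i * bump_deriv 0 (x / h - real i) else 0)"
    unfolding bump_comb_def by (intro sum.cong refl)
  also have "\<dots> = s i * bump_deriv 0 (x / h - real i)" using i by simp
  finally show ?thesis using True by simp
next
  case False
  then show ?thesis using scaled_bump_in_cell[OF h, of 0 x i] by auto
qed

lemma bump_comb_cell_integral:
  assumes h: "h > 0" and i: "i < M"
  shows "integrable lborel (\<lambda>x. indicator (cell h i) x * bump_comb h M s 0 x)"
    "(\<integral>x. indicator (cell h i) x * bump_comb h M s 0 x \<partial>lborel) = s i * (h * (\<integral>x. bump_deriv 0 x \<partial>lborel))"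
proof -
  have e: "(\<lambda>x. bump_deriv 0 (x / h - real i)) = (\<lambda>x. bump_deriv 0 (- real i + inverse h * x))"
    by (simp add: divide_inverse mult.commute)
  have h': "inverse h \<noteq> 0" using h by simp
  have i1: "integrable lborel (\<lambda>x. bump_deriv 0 (x / h - real i))"
    unfolding e by (rule lborel_integrable_real_affine[OF bump_integral_pos(1) h'])
  have "(\<integral>x. bump_deriv 0 x \<partial>lborel) = \<bar>inverse h\<bar> *\<^sub>R (\<integral>x. bump_deriv 0 (- real i + inverse h * x) \<partial>lborel)"
    by (rule lborel_integral_real_affine[OF h'])
  then have i2: "(\<integral>x. bump_deriv 0 (x / h - real i) \<partial>lborel) = h * (\<integral>x. bump_deriv 0 x \<partial>lborel)"
    unfolding e using h by (simp add: field_simps del: minus_add_distrib)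
  show "integrable lborel (\<lambda>x. indicator (cell h i) x * bump_comb h M s 0 x)"
    "(\<integral>x. indicator (cell h i) x * bump_comb h M s 0 x \<partial>lborel) = s i * (h * (\<integral>x. bump_deriv 0 x \<partial>lborel))"
    using i1 i2 unfolding bump_comb_on_cell[OF h i] by simp_all
qed

lemma bump_comb_weighted_bound:
  assumes h: "h > 0" and B: "\<And>x. \<bar>bump_deriv k x\<bar> \<le> B" and w0: "\<And>x. 0 \<le> w x" and c: "c \<ge> 0"
    and s: "\<And>i x. i < M \<Longrightarrow> x \<in> cell h i \<Longrightarrow> \<bar>s i\<bar> * w x \<le> c"
  shows "\<bar>bump_comb h M s k x * w x\<bar> \<le> c * B * inverse h ^ k * indicator {0..<real M * h} x"
proof -
  have "\<bar>bump_comb h M s k x * w x\<bar> = \<bar>\<Sum>i<M. s i * (inverse h ^ k * bump_deriv k (x / h - real i)) * w x\<bar>"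
    by (simp add: bump_comb_def sum_distrib_right)
  also have "\<dots> \<le> (\<Sum>i<M. \<bar>s i * (inverse h ^ k * bump_deriv k (x / h - real i)) * w x\<bar>)" by (rule sum_abs)
  also have "\<dots> \<le> (\<Sum>i<M. c * B * inverse h ^ k * indicator (cell h i) x)"
  proof (intro sum_mono)
    fix i assume i: "i \<in> {..<M}"
    show "\<bar>s i * (inverse h ^ k * bump_deriv k (x / h - real i)) * w x\<bar> \<le> c * B * inverse h ^ k * indicator (cell h i) x"
    proof (cases "x \<in> cell h i")
      case True
      have "\<bar>s i\<bar> * w x * (\<bar>bump_deriv k (x / h - real i)\<bar> * inverse h ^ k) \<le> c * (B * inverse h ^ k)"
        using s[of i x] i True B h w0[of x] c by (intro mult_mono mult_right_mono) auto
      then show ?thesis using True h w0[of x] by (simp add: abs_mult mult_ac)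
    next
      case False
      then show ?thesis using scaled_bump_in_cell[OF h, of k x i] by auto
    qed
  qed
  also have "\<dots> = c * B * inverse h ^ k * indicator {0..<real M * h} x"
    by (simp add: sum_indicator_cells[OF h] flip: sum_distrib_left)
  finally show ?thesis .
qed

section \<open>The lower bound for Kolmogorov widths\<close>

lemma Lp_weight_integrable_on_interval:
  assumes lam: "lam > 1" "a > 0" and q: "q \<ge> 1" and V[measurable]: "V \<in> borel_measurable borel"
    and mem: "mf V \<in> Lp_weight q (freud_weight lam a b)"
  shows "integrable lborel (\<lambda>x. indicator {0..<X} x * V x)"
proof (rule integrableI_bounded)
  let ?w = "freud_weight lam a b"
  define K where "K = ?w X powr (- q)"
  have "(\<integral>\<^sup>+ x. ennreal (norm (indicator {0..<X} x * V x)) \<partial>lborel)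
    \<le> (\<integral>\<^sup>+ x. indicator {0..<X} x + ennreal K * ennreal (\<bar>V x * ?w x\<bar> powr q) \<partial>lborel)"
  proof (intro nn_integral_mono)
    fix x
    show "ennreal (norm (indicator {0..<X} x * V x)) \<le> indicator {0..<X} x + ennreal K * ennreal (\<bar>V x * ?w x\<bar> powr q)"
    proof (cases "x \<in> {0..<X}")
      case True
      have "x powr lam \<le> X powr lam" using True lam by (intro powr_mono2) auto
      then have w: "?w X \<le> ?w x" using True lam by (auto simp: freud_weight_def)
      have "\<bar>V x\<bar> \<le> 1 + \<bar>V x\<bar> powr q"
        using powr_le_split[of "\<bar>V x\<bar>" 1 1 q] q by (cases "V x = 0") auto
      also have "\<bar>V x\<bar> powr q = K * (\<bar>V x\<bar> * ?w X) powr q"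
        using freud_weight_pos[of lam a b X] by (simp add: K_def powr_mult powr_minus)
      also have "\<dots> \<le> K * \<bar>V x * ?w x\<bar> powr q"
        using w q freud_weight_pos[of lam a b X] unfolding K_def
        by (intro mult_left_mono powr_mono2) (auto simp: abs_mult intro!: mult_left_mono)
      finally have "ennreal \<bar>V x\<bar> \<le> ennreal (1 + K * \<bar>V x * ?w x\<bar> powr q)" by (intro ennreal_leI) simp
      then show ?thesis using True by (simp add: ennreal_mult K_def)
    qed simp
  qed
  also have "\<dots> = emeasure lborel {0..<X} + ennreal K * Lp_weight_integral q ?w (mf V)"
    by (simp add: nn_integral_add nn_integral_cmult Lp_weight_integral_mf)
  also have "\<dots> < \<infinity>"
    using mem by (cases "0 \<le> X") (simp_all add: Lp_weight_iff ennreal_mult_less_top)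
  finally show "(\<integral>\<^sup>+ x. ennreal (norm (indicator {0..<X} x * V x)) \<partial>lborel) < \<infinity>" .
qed measurable

text \<open>On an interval of length \<open>X\<close>, splitting at the level \<open>\<mu>\<close> loses at most \<open>\<mu> * X\<close>, half of the given lower bound for the \<open>L\<^sub>1\<close> norm.\<close>

lemma L1_to_Lq_lower:
  fixes f :: "real \<Rightarrow> real"
  assumes [measurable]: "f \<in> borel_measurable borel" and q: "q \<ge> 1" and X: "X > 0" and \<mu>: "\<mu> > 0"
    and l1: "ennreal (2 * \<mu> * X) \<le> (\<integral>\<^sup>+ x. ennreal (indicator {0..<X} x * \<bar>f x\<bar>) \<partial>lborel)"
  shows "ennreal ((\<mu> * X powr (1 / q)) powr q) \<le> pow_int q f"
proof (cases "pow_int q f = \<infinity>")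
  case False
  then obtain j where j: "pow_int q f = ennreal j" "j \<ge> 0"
    by (cases "pow_int q f") auto
  have "ennreal (2 * \<mu> * X) \<le> (\<integral>\<^sup>+ x. ennreal (indicator {0..<X} x * \<bar>f x\<bar>) \<partial>lborel)" by (rule l1)
  also have "\<dots> \<le> (\<integral>\<^sup>+ x. ennreal \<mu> * indicator {0..<X} x + ennreal (\<mu> powr (1 - q)) * ennreal (\<bar>f x\<bar> powr q) \<partial>lborel)"
  proof (intro nn_integral_mono)
    fix x
    have "\<bar>f x\<bar> \<le> \<mu> + \<mu> powr (1 - q) * \<bar>f x\<bar> powr q"
      using powr_le_split[of "\<bar>f x\<bar>" \<mu> 1 q] q \<mu> by (cases "f x = 0") auto
    then have "ennreal \<bar>f x\<bar> \<le> ennreal (\<mu> + \<mu> powr (1 - q) * \<bar>f x\<bar> powr q)" by (rule ennreal_leI)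
    then show "ennreal (indicator {0..<X} x * \<bar>f x\<bar>) \<le> ennreal \<mu> * indicator {0..<X} x + ennreal (\<mu> powr (1 - q)) * ennreal (\<bar>f x\<bar> powr q)"
      using \<mu> by (cases "x \<in> {0..<X}") (simp_all add: ennreal_mult)
  qed
  also have "\<dots> = ennreal \<mu> * ennreal X + ennreal (\<mu> powr (1 - q)) * ennreal j"
    using X by (simp add: nn_integral_add nn_integral_cmult j)
  also have "\<dots> = ennreal (\<mu> * X + \<mu> powr (1 - q) * j)"
    using \<mu> X j by (simp add: ennreal_mult)
  finally have "2 * \<mu> * X \<le> \<mu> * X + \<mu> powr (1 - q) * j"
    using \<mu> X j by (subst (asm) ennreal_le_iff) auto
  then have "\<mu> * X \<le> \<mu> powr (1 - q) * j" by (simp add: mult.commute[of X])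
  then have "\<mu> powr (q - 1) * (\<mu> * X) \<le> \<mu> powr (q - 1) * (\<mu> powr (1 - q) * j)"
    by (intro mult_left_mono) auto
  also have "\<dots> = j" using \<mu> by (simp add: mult.assoc[symmetric] flip: powr_add)
  also have "\<mu> powr (q - 1) * (\<mu> * X) = (\<mu> * X powr (1 / q)) powr q"
  proof -
    have "(\<mu> * X powr (1 / q)) powr q = \<mu> powr q * (X powr (1 / q)) powr q" by (rule powr_mult)
    then show ?thesis using \<mu> X q by (simp add: powr_powr powr_diff)
  qed
  finally show ?thesis unfolding j(1) by (rule ennreal_leI)
qed simp

text \<open>The functional is defined by integrals of functions, not of classes. Carrying a representative through the induction
  over the span avoids having to define it on classes.\<close>

lemma annihilated_by_cell_functional:
  fixes h :: real and M :: nat and \<beta> :: "nat \<Rightarrow> real" and V :: "meas_fun \<Rightarrow> real \<Rightarrow> real"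
  assumes h: "h > 0"
    and V: "\<And>v. v \<in> S \<Longrightarrow> V v \<in> borel_measurable borel" "\<And>v. v \<in> S \<Longrightarrow> v = mf (V v)"
    and int: "\<And>v i. v \<in> S \<Longrightarrow> i < M \<Longrightarrow> integrable lborel (\<lambda>x. indicator (cell h i) x * V v x)"
    and 0: "\<And>v. v \<in> S \<Longrightarrow> (\<Sum>i<M. \<beta> i * (\<integral>x. indicator (cell h i) x * V v x \<partial>lborel)) = 0"
    and g: "g \<in> span S"
  shows "\<exists>G. G \<in> borel_measurable borel \<and> g = mf G \<and>
    (\<forall>i<M. integrable lborel (\<lambda>x. indicator (cell h i) x * G x)) \<and>
    (\<Sum>i<M. \<beta> i * (\<integral>x. indicator (cell h i) x * G x \<partial>lborel)) = 0"
  using g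
proof (induction rule: span_induct_alt)
  case base
  show ?case by (intro exI[of _ "\<lambda>_. 0"]) (simp add: mf_zero)
next
  case (step c v g)
  then obtain G where G: "G \<in> borel_measurable borel" "g = mf G"
    "\<And>i. i < M \<Longrightarrow> integrable lborel (\<lambda>x. indicator (cell h i) x * G x)"
    "(\<Sum>i<M. \<beta> i * (\<integral>x. indicator (cell h i) x * G x \<partial>lborel)) = 0" by blast
  define H where "H x = c * V v x + G x" for x
  have e: "indicator (cell h i) x * H x = c * (indicator (cell h i) x * V v x) + indicator (cell h i) x * G x" for i x
    by (simp add: H_def algebra_simps)
  have "H \<in> borel_measurable borel" unfolding H_def[abs_def] using V(1)[OF step(1)] G(1) by measurable
  moreover have "c *\<^sub>R v + g = mf H"
  proof -
    have "c *\<^sub>R v = mf (\<lambda>x. c * V v x)"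
      using V(2)[OF step(1)] mf_scaleR[OF V(1)[OF step(1)], of c] by simp
    then show ?thesis using V(1)[OF step(1)] G(1) by (simp add: G(2) mf_arith H_def[abs_def])
  qed
  moreover have "integrable lborel (\<lambda>x. indicator (cell h i) x * H x)" if "i < M" for i
    unfolding e using int[OF step(1) that] G(3)[OF that] by simp
  moreover have "(\<Sum>i<M. \<beta> i * (\<integral>x. indicator (cell h i) x * H x \<partial>lborel)) = 0"
  proof -
    have "(\<Sum>i<M. \<beta> i * (\<integral>x. indicator (cell h i) x * H x \<partial>lborel))
      = (\<Sum>i<M. c * (\<beta> i * (\<integral>x. indicator (cell h i) x * V v x \<partial>lborel)) + \<beta> i * (\<integral>x. indicator (cell h i) x * G x \<partial>lborel))"
      unfolding e using int[OF step(1)] G(3) by (intro sum.cong refl) (simp add: algebra_simps)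
    also have "\<dots> = 0" using 0[OF step(1)] G(4) by (simp add: sum.distrib flip: sum_distrib_left)
    finally show ?thesis .
  qed
  ultimately show ?case by blast
qed

text \<open>Let \<open>y\<close> be a vertex as in \<open>cube_section_vertex\<close> for the equations given by a subspace of dimension at most \<open>n\<close>, and let \<open>f\<close>
  be the combination of the \<open>2 * n\<close> bumps with coefficients \<open>sgn (y i) / w (real i * h)\<close>. The functional
  that integrates over the cells with coefficients \<open>y i * w (real i * h)\<close> annihilates the subspace and takes on \<open>f\<close> a value proportional to the
  sum of the \<open>\<bar>y i\<bar>\<close>, which is at least \<open>n\<close>. It is bounded by the weighted \<open>L\<^sub>1\<close> norm on \<open>{0..<X}\<close>, so \<open>f\<close> minus any element of
  the subspace has weighted \<open>L\<^sub>1\<close> norm at least of order \<open>X\<close>. The Sobolev norm of \<open>f\<close> is at most of order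
  \<open>X powr (1 / p) / h ^ R\<close>, and \<open>\<gamma>\<close> normalizes it.\<close>

lemma kolmogorov_width_lower_bound:
  fixes lam a b p q :: real and R :: nat
  assumes lam: "lam > 1" "a > 0" and q: "1 \<le> q" "q \<le> p"
  defines "w \<equiv> freud_weight lam a b"
  shows "\<exists>c>0. \<forall>n\<ge>1. ennreal (c * real n powr (- width_exponent lam R p q))
     \<le> kolmogorov_width (Lp_weight q w) (Lp_weight_norm q w) (sobolev_ball R p w) n"
proof -
  let ?X = "Lp_weight q w" and ?ball = "sobolev_ball R p w" and ?N = "Lp_weight_norm q w"
  have p: "p \<ge> 1" using q by simp
  have [measurable]: "w \<in> borel_measurable borel" by (simp add: w_def)
  have wpos: "0 < w x" for x by (simp add: w_def freud_weight_pos)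
  obtain B where B: "B > 0" "\<And>k x. k \<le> R \<Longrightarrow> \<bar>bump_deriv k x\<bar> \<le> B"
    using bump_deriv_bounded[of R] by metis
  define I0 where "I0 = (\<integral>x. bump_deriv 0 x \<partial>lborel)"
  have I0: "I0 > 0" unfolding I0_def by (rule bump_integral_pos(2))
  define cw where "cw = exp (a * lam * 1)"
  have cw: "cw > 0" by (simp add: cw_def)
  define c where "c = I0 / (4 * cw) / (cw * B) / (real (Suc R) powr (1 / p) * 2 ^ R)"
  have c: "c > 0" using I0 cw B by (simp add: c_def)
  have "ennreal (c * real n powr (- width_exponent lam R p q)) \<le> kolmogorov_width ?X ?N ?ball n"
    if n: "n \<ge> 1" for n
  proof -
    define X where "X = real n powr (1 / lam)"
    define M where "M = 2 * n"
    define h where "h = X / M"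
    have X: "X > 0" using n by (simp add: X_def)
    have h: "h > 0" and Mh: "real M * h = X" using n X by (simp_all add: h_def M_def)
    have "X \<le> real n powr 1" unfolding X_def using n lam by (intro powr_mono) auto
    then have h1: "h \<le> 1" using n by (simp add: h_def M_def field_simps)
    have "X powr lam = n" using n lam by (simp add: X_def powr_powr)
    then have Xh: "X powr (lam - 1) * h = 1 / 2" using n X by (simp add: h_def M_def powr_diff)
    have cellX: "0 \<le> real i * h" "real i * h \<le> X" "x \<in> cell h i \<Longrightarrow> 0 \<le> x \<and> x < X \<and> \<bar>x - real i * h\<bar> \<le> h"
      if i: "i < M" for i x
    proof -
      show 0: "0 \<le> real i * h" using h by simp
      have "real (Suc i) * h \<le> real M * h" using i h by (intro mult_right_mono) auto
      then have 1: "real i * h + h \<le> X" using Mh by (simp add: algebra_simps)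
      then show "real i * h \<le> X" using h by linarith
      assume "x \<in> cell h i"
      then have "real i * h \<le> x" "x < real i * h + h" by (auto simp: cell_def)
      with 0 1 show "0 \<le> x \<and> x < X \<and> \<bar>x - real i * h\<bar> \<le> h" by linarith
    qed
    have wcomp: "w x \<le> cw * w (real i * h)" "w (real i * h) \<le> cw * w x" if i: "i < M" and x: "x \<in> cell h i" for i x
    proof -
      have "X powr (lam - 1) * \<bar>x - real i * h\<bar> \<le> X powr (lam - 1) * h"
        using cellX(3)[OF i x] by (intro mult_left_mono) auto
      then have "X powr (lam - 1) * \<bar>x - real i * h\<bar> \<le> 1" using Xh by linarith
      moreover from this have "X powr (lam - 1) * \<bar>real i * h - x\<bar> \<le> 1" by (simp only: abs_minus_commute)
      moreover have "\<bar>x\<bar> \<le> X" "\<bar>real i * h\<bar> \<le> X" using cellX(1,2)[OF i] cellX(3)[OF i x] by auto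
      ultimately show "w x \<le> cw * w (real i * h)" "w (real i * h) \<le> cw * w x"
        unfolding w_def cw_def by - (rule freud_weight_comparable[OF lam, of _ X]; assumption)+
    qed
    define \<gamma> where "\<gamma> = h ^ R / (cw * B) / (X powr (1 / p) * real (Suc R) powr (1 / p))"
    have \<gamma>: "\<gamma> > 0" using h cw B X by (simp add: \<gamma>_def)
    (* The weighted L1 distance will be at least 2 * \<mu> * X. *)
    define \<mu> where "\<mu> = \<gamma> * I0 / (4 * cw)"
    have \<mu>: "\<mu> > 0" using \<gamma> I0 cw by (simp add: \<mu>_def)
    have rate: "\<mu> * X powr (1 / q) = c * real n powr (- width_exponent lam R p q)"
    proof -
      have hR: "h ^ R = real n powr ((1 / lam - 1) * R) / 2 ^ R"
      proof -
        have "h = real n powr (1 / lam - 1) / 2" using n by (simp add: h_def M_def X_def powr_diff)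
        then have "h ^ R = (real n powr (1 / lam - 1)) ^ R / 2 ^ R" by (simp only: power_divide)
        also have "(real n powr (1 / lam - 1)) ^ R = real n powr ((1 / lam - 1) * R)"
          using n by (simp add: powr_power mult.commute)
        finally show ?thesis .
      qed
      have Xq: "X powr (1 / q) / X powr (1 / p) = real n powr (1 / lam * (1 / q - 1 / p))"
        using n by (simp add: X_def powr_powr right_diff_distrib powr_diff)
      have ex: "(1 / lam - 1) * R + 1 / lam * (1 / q - 1 / p) = - width_exponent lam R p q"
        using q by (auto simp: width_exponent_def r_lam_def delta_exponent_def algebra_simps)
      have "\<mu> * X powr (1 / q) = c * (h ^ R * 2 ^ R * (X powr (1 / q) / X powr (1 / p)))"
        by (simp add: \<mu>_def \<gamma>_def c_def mult_ac)
      also have "h ^ R * 2 ^ R * (X powr (1 / q) / X powr (1 / p)) = real n powr (- width_exponent lam R p q)"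
        unfolding hR Xq ex[symmetric] by (simp add: powr_add)
      finally show ?thesis .
    qed
    show ?thesis unfolding kolmogorov_width_def
    proof (rule INF_greatest)
      fix L assume "L \<in> {L. L \<subseteq> ?X \<and> subspace_dim_le n L}"
      then obtain S where LX: "L \<subseteq> ?X" and S: "finite S" "card S \<le> n" "L = span S"
        by (auto simp: subspace_dim_le_def)
      have SX: "S \<subseteq> ?X" using LX S(3) span_superset by blast
      have "\<exists>V. V \<in> borel_measurable borel \<and> v = mf V" for v by (metis borel_representative)
      then obtain V where V: "\<And>v. V v \<in> borel_measurable borel" "\<And>v. v = mf (V v)" by metis
      have Vint: "integrable lborel (\<lambda>x. indicator (cell h i) x * V v x)" if "v \<in> S" "i < M" for v i
      proof -
        have "mf (V v) \<in> ?X" using that SX V(2) by (metis subsetD)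
        then have "integrable lborel (\<lambda>x. indicator {0..<X} x * V v x)"
          unfolding w_def using V(1) by (intro Lp_weight_integrable_on_interval[OF lam q(1)]) auto
        from integrable_mult_indicator[OF _ this, of "cell h i"]
        have "integrable lborel (\<lambda>x. indicator (cell h i) x * (indicator {0..<X} x * V v x))" by simp
        also have "(\<lambda>x. indicator (cell h i) x * (indicator {0..<X} x * V v x)) = (\<lambda>x. indicator (cell h i) x * V v x)"
          using cellX(3)[OF that(2)] by (auto simp: fun_eq_iff indicator_def)
        finally show ?thesis .
      qed
      obtain y where y: "\<And>i. i \<in> {..<M} \<Longrightarrow> \<bar>y i\<bar> \<le> 1"
        "\<And>v. v \<in> S \<Longrightarrow> (\<Sum>i<M. (w (real i * h) * (\<integral>x. indicator (cell h i) x * V v x \<partial>lborel)) * y i) = 0"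
        "card {..<M} - card S \<le> card {i\<in>{..<M}. \<bar>y i\<bar> = 1}"
        using cube_section_vertex[OF S(1) finite_lessThan[of M],
            of "\<lambda>v i. w (real i * h) * (\<integral>x. indicator (cell h i) x * V v x \<partial>lborel)"] by blast
      (* Dividing by the weight at the node makes all bumps have the same size in the weighted norms. *)
      define s where "s i = sgn (y i) / w (real i * h)" for i
      define F where "F = bump_comb h M s"
      define G where "G k x = \<gamma> * F k x" for k x
      have chF: "sobolev_chain R F" unfolding F_def by (rule bump_comb_chain[OF h])
      have chG: "sobolev_chain R G" unfolding G_def[abs_def] by (rule sobolev_chain_cmult[OF chF])
      have sw: "\<bar>s i\<bar> * w x \<le> cw" if "i < M" "x \<in> cell h i" for i x
      proof -
        have "\<bar>s i\<bar> * w x \<le> (1 / w (real i * h)) * (cw * w (real i * h))"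
          using wcomp(1)[OF that] wpos[of "real i * h"] wpos[of x] cw
          by (intro mult_mono) (auto simp: s_def abs_mult abs_sgn_eq divide_simps)
        then show ?thesis using wpos[of "real i * h"] by simp
      qed
      have ball: "mf (G 0) \<in> ?ball"
      proof (rule sobolev_chain_in_ball[OF chG p])
        fix k assume k: "k \<le> R"
        define Z where "Z = \<gamma> * (cw * B * inverse h ^ R)"
        have Z: "Z \<ge> 0" using \<gamma> cw B h by (simp add: Z_def)
        have "pow_int p (\<lambda>x. G k x * w x) \<le> (\<integral>\<^sup>+ x. ennreal (Z powr p) * indicator {0..<X} x \<partial>lborel)"
        proof (intro nn_integral_mono)
          fix x
          have hk: "inverse h ^ k \<le> inverse h ^ R" using h h1 k by (intro power_increasing) (auto simp: one_le_inverse)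
          have "\<bar>G k x * w x\<bar> = \<gamma> * \<bar>F k x * w x\<bar>" using \<gamma> by (simp add: G_def abs_mult)
          also have "\<dots> \<le> \<gamma> * (cw * B * inverse h ^ k * indicator {0..<real M * h} x)"
            unfolding F_def using \<gamma> cw wpos B(2)[OF k] sw
            by (intro mult_left_mono bump_comb_weighted_bound[OF h]) (auto intro: less_imp_le)
          also have "\<dots> \<le> \<gamma> * (cw * B * inverse h ^ R * indicator {0..<real M * h} x)"
            using hk \<gamma> cw B by (intro mult_left_mono mult_right_mono) auto
          finally have "\<bar>G k x * w x\<bar> \<le> Z * indicator {0..<X} x" by (simp add: Z_def Mh)
          then have "\<bar>G k x * w x\<bar> powr p \<le> (Z * indicator {0..<X} x) powr p" using p by (intro powr_mono2) auto
          also have "\<dots> = Z powr p * indicator {0..<X} x" using p by (auto simp: indicator_def)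
          finally have "ennreal (\<bar>G k x * w x\<bar> powr p) \<le> ennreal (Z powr p * indicator {0..<X} x)" by (rule ennreal_leI)
          then show "ennreal (\<bar>G k x * w x\<bar> powr p) \<le> ennreal (Z powr p) * indicator {0..<X} x"
            by (cases "x \<in> {0..<X}") auto
        qed
        also have "\<dots> = ennreal (Z powr p * X)" using X by (simp add: nn_integral_cmult_indicator ennreal_mult)
        also have "Z = inverse (X powr (1 / p) * real (Suc R) powr (1 / p))"
          using h cw B by (simp add: Z_def \<gamma>_def field_simps)
        also have "\<dots> = (X * real (Suc R)) powr (- (1 / p))"
          by (simp add: powr_mult powr_minus del: of_nat_Suc)
        also have "((X * real (Suc R)) powr (- (1 / p))) powr p = inverse (X * real (Suc R))"
        proof -
          have "- (1 / p) * p = - 1" using p by simp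
          then have "((X * real (Suc R)) powr (- (1 / p))) powr p = (X * real (Suc R)) powr (- 1)"
            by (simp only: powr_powr)
          then show ?thesis using X by (simp only: powr_minus) simp
        qed
        also have "inverse (X * real (Suc R)) * X = 1 / real (Suc R)"
          using X by (simp add: divide_simps del: of_nat_Suc)
        finally show "pow_int p (\<lambda>x. G k x * w x) \<le> ennreal (1 / real (Suc R))" .
      qed
      have dist: "ennreal (\<mu> * X powr (1 / q)) \<le> ?N (mf (G 0) - g)" if g: "g \<in> L" for g
      proof -
        have "\<exists>U. U \<in> borel_measurable borel \<and> g = mf U \<and>
            (\<forall>i<M. integrable lborel (\<lambda>x. indicator (cell h i) x * U x)) \<and>
            (\<Sum>i<M. (y i * w (real i * h)) * (\<integral>x. indicator (cell h i) x * U x \<partial>lborel)) = 0"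
        proof (rule annihilated_by_cell_functional[OF h, where S = S and V = V])
          fix v assume "v \<in> S"
          from y(2)[OF this]
          show "(\<Sum>i<M. (y i * w (real i * h)) * (\<integral>x. indicator (cell h i) x * V v x \<partial>lborel)) = 0"
            by (simp only: mult_ac)
        qed (use V Vint g S(3) in auto)
        then obtain U where U[measurable]: "U \<in> borel_measurable borel" and gU: "g = mf U"
          and Uint: "\<And>i. i < M \<Longrightarrow> integrable lborel (\<lambda>x. indicator (cell h i) x * U x)"
          and U0: "(\<Sum>i<M. (y i * w (real i * h)) * (\<integral>x. indicator (cell h i) x * U x \<partial>lborel)) = 0"
          by blast
        have [measurable]: "G 0 \<in> borel_measurable borel" by (rule sobolev_chain_measurable[OF chG]) simp
        define E where "E x = G 0 x - U x" for x
        let ?E = "\<lambda>i. \<integral>x. indicator (cell h i) x * E x \<partial>lborel"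
        let ?U = "\<lambda>i. \<integral>x. indicator (cell h i) x * U x \<partial>lborel"
        let ?f = "\<lambda>i x. ennreal (indicator (cell h i) x * \<bar>E x * w x\<bar>)"
        have [measurable]: "E \<in> borel_measurable borel" unfolding E_def[abs_def] by measurable
        have Ee: "indicator (cell h i) x * E x = \<gamma> * (indicator (cell h i) x * F 0 x) - indicator (cell h i) x * U x" for i x
          by (simp add: E_def G_def algebra_simps)
        have Eint: "integrable lborel (\<lambda>x. indicator (cell h i) x * E x)"
          "?E i = \<gamma> * (s i * (h * I0)) - ?U i"
          if i: "i < M" for i
          unfolding Ee F_def I0_def using bump_comb_cell_integral[OF h i, of s] Uint[OF i] by simp_all
        define D where "D = (\<Sum>i<M. (y i * w (real i * h)) * ?E i)"
        have "D = (\<Sum>i<M. \<gamma> * h * I0 * \<bar>y i\<bar> - (y i * w (real i * h)) * ?U i)"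
          unfolding D_def
        proof (intro sum.cong refl)
          fix i assume "i \<in> {..<M}"
          then have i: "i < M" by simp
          have "y i * w (real i * h) * s i = \<bar>y i\<bar>"
            using wpos[of "real i * h"] by (simp add: s_def abs_sgn)
          then have "y i * w (real i * h) * (\<gamma> * (s i * (h * I0))) = \<gamma> * h * I0 * \<bar>y i\<bar>"
            by (metis (no_types, lifting) mult.assoc mult.commute)
          then show "y i * w (real i * h) * ?E i
            = \<gamma> * h * I0 * \<bar>y i\<bar> - y i * w (real i * h) * ?U i"
            unfolding Eint(2)[OF i] right_diff_distrib by simp
        qed
        also have "\<dots> = \<gamma> * h * I0 * (\<Sum>i<M. \<bar>y i\<bar>)" using U0 by (simp add: sum_subtractf flip: sum_distrib_left)
        also have "\<dots> \<ge> \<gamma> * h * I0 * real n"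
        proof -
          have "n \<le> card {i\<in>{..<M}. \<bar>y i\<bar> = 1}" using y(3) S(2) by (simp add: M_def)
          then have "real n \<le> (\<Sum>i\<in>{i\<in>{..<M}. \<bar>y i\<bar> = 1}. 1)" by simp
          also have "\<dots> = (\<Sum>i\<in>{i\<in>{..<M}. \<bar>y i\<bar> = 1}. \<bar>y i\<bar>)" by (intro sum.cong) auto
          also have "\<dots> \<le> (\<Sum>i<M. \<bar>y i\<bar>)" by (intro sum_mono2) auto
          finally show ?thesis using \<gamma> h I0 by (intro mult_left_mono) auto
        qed
        finally have "\<gamma> * h * I0 * real n \<le> D" .
        moreover have "\<gamma> * h * I0 * real n = \<gamma> * I0 * X / 2"
          unfolding Mh[symmetric] by (simp add: M_def)
        ultimately have D: "\<gamma> * I0 * X / 2 \<le> D" by simp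
        (* D is at most cw times the weighted L1 norm of E, since the weight at a node and in its cell are comparable. *)
        have "ennreal (cw * (2 * \<mu> * X)) \<le> ennreal D"
        proof (rule ennreal_leI)
          have "cw * (2 * \<mu> * X) = \<gamma> * I0 * X / 2" using cw by (simp add: \<mu>_def)
          then show "cw * (2 * \<mu> * X) \<le> D" using D by linarith
        qed
        also have "\<dots> \<le> ennreal (\<Sum>i<M. w (real i * h) * \<bar>?E i\<bar>)"
        proof (rule ennreal_leI, unfold D_def, rule sum_mono)
          fix i assume i: "i \<in> {..<M}"
          have "y i * w (real i * h) * ?E i
              \<le> \<bar>y i * w (real i * h) * ?E i\<bar>"
            by (rule abs_ge_self)
          also have "\<dots> = \<bar>y i\<bar> * (w (real i * h) * \<bar>?E i\<bar>)"
            by (simp only: abs_mult mult.assoc abs_of_pos[OF wpos])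
          also have "\<dots> \<le> 1 * (w (real i * h) * \<bar>?E i\<bar>)"
            using y(1)[OF i] wpos[of "real i * h"] by (intro mult_right_mono) auto
          finally show "y i * w (real i * h) * ?E i \<le> w (real i * h) * \<bar>?E i\<bar>" by simp
        qed
        also have "\<dots> = (\<Sum>i<M. ennreal (w (real i * h)) * ennreal \<bar>?E i\<bar>)"
          using wpos by (simp add: ennreal_mult less_imp_le flip: sum_ennreal)
        also have "\<dots> \<le> (\<Sum>i<M. ennreal cw * (\<integral>\<^sup>+ x. ?f i x \<partial>lborel))"
        proof (rule sum_mono)
          fix i assume "i \<in> {..<M}"
          then have i: "i < M" by simp
          have "ennreal (w (real i * h)) * ennreal \<bar>?E i\<bar>
            \<le> ennreal (w (real i * h)) * (\<integral>\<^sup>+ x. ennreal (norm (indicator (cell h i) x * E x)) \<partial>lborel)"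
            using integral_norm_bound_ennreal[OF Eint(1)[OF i]] by (intro mult_left_mono) auto
          also have "\<dots> = (\<integral>\<^sup>+ x. ennreal (w (real i * h)) * ennreal (norm (indicator (cell h i) x * E x)) \<partial>lborel)"
            by (intro nn_integral_cmult[symmetric]) measurable
          also have "\<dots> \<le> (\<integral>\<^sup>+ x. ennreal cw * ?f i x \<partial>lborel)"
          proof (intro nn_integral_mono)
            fix x
            show "ennreal (w (real i * h)) * ennreal (norm (indicator (cell h i) x * E x)) \<le> ennreal cw * ?f i x"
            proof (cases "x \<in> cell h i")
              case True
              have "w (real i * h) * \<bar>E x\<bar> \<le> cw * w x * \<bar>E x\<bar>" using wcomp(2)[OF i True] by (intro mult_right_mono) auto
              then have "w (real i * h) * \<bar>E x\<bar> \<le> cw * \<bar>E x * w x\<bar>" using wpos[of x] by (simp add: abs_mult mult_ac)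
              then show ?thesis using True wpos[of "real i * h"] cw by (simp add: ennreal_leI less_imp_le flip: ennreal_mult)
            qed simp
          qed
          also have "\<dots> = ennreal cw * (\<integral>\<^sup>+ x. ?f i x \<partial>lborel)"
            by (intro nn_integral_cmult) measurable
          finally show "ennreal (w (real i * h)) * ennreal \<bar>?E i\<bar>
            \<le> ennreal cw * (\<integral>\<^sup>+ x. ?f i x \<partial>lborel)" .
        qed
        also have "\<dots> = ennreal cw * (\<integral>\<^sup>+ x. (\<Sum>i<M. ?f i x) \<partial>lborel)"
          by (subst nn_integral_sum) (auto simp: sum_distrib_left)
        also have "(\<lambda>x. \<Sum>i<M. ?f i x) = (\<lambda>x. ennreal (indicator {0..<X} x * \<bar>E x * w x\<bar>))"
        proof
          fix x
          have "(\<Sum>i<M. ?f i x) = ennreal ((\<Sum>i<M. indicator (cell h i) x) * \<bar>E x * w x\<bar>)"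
            unfolding sum_distrib_right by (rule sum_ennreal) simp
          then show "(\<Sum>i<M. ?f i x) = ennreal (indicator {0..<X} x * \<bar>E x * w x\<bar>)"
            unfolding sum_indicator_cells[OF h] Mh .
        qed
        finally have "ennreal cw * ennreal (2 * \<mu> * X) \<le> ennreal cw * (\<integral>\<^sup>+ x. ennreal (indicator {0..<X} x * \<bar>E x * w x\<bar>) \<partial>lborel)"
          using cw \<mu> X by (simp add: ennreal_mult)
        then have "ennreal (2 * \<mu> * X) \<le> (\<integral>\<^sup>+ x. ennreal (indicator {0..<X} x * \<bar>E x * w x\<bar>) \<partial>lborel)"
          using cw by (simp add: ennreal_mult_le_mult_iff)
        then have "ennreal ((\<mu> * X powr (1 / q)) powr q) \<le> pow_int q (\<lambda>x. E x * w x)"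
          using q X \<mu> by (intro L1_to_Lq_lower) auto
        also have "\<dots> = Lp_weight_integral q w (mf (G 0) - g)"
          unfolding gU by (simp add: mf_arith Lp_weight_integral_mf E_def)
        finally show ?thesis using q \<mu> by (intro Lp_weight_norm_ge) auto
      qed
      have "ennreal (c * real n powr (- width_exponent lam R p q)) \<le> (INF g\<in>L. ?N (mf (G 0) - g))"
        unfolding rate[symmetric] by (intro INF_greatest dist)
      also have "\<dots> \<le> (SUP f\<in>?ball. INF g\<in>L. ?N (f - g))" by (rule SUP_upper[OF ball])
      finally show "ennreal (c * real n powr (- width_exponent lam R p q)) \<le> (SUP f\<in>?ball. INF g\<in>L. ?N (f - g))" .
    qed
  qed
  with c show ?thesis by blast
qed

lemma same_orderI:
  assumes "c > 0" "C > 0" "\<And>n. n \<ge> 1 \<Longrightarrow> ennreal c * B n \<le> A n" "\<And>n. n \<ge> 1 \<Longrightarrow> A n \<le> ennreal C * B n"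
  shows "same_order A B"
  using assms unfolding same_order_def by blast

theorem corollary2p4:
  fixes lam a b p q :: real and r :: nat
  assumes "lam > 1" and "a > 0" and "r \<ge> 1"
    and "1 \<le> q" and "q \<le> p"
    and "width_exponent lam r p q > 0"
  shows
    "same_order
       (linear_width (Lp_weight q (freud_weight lam a b)) (Lp_weight_norm q (freud_weight lam a b))
          (sobolev_ball r p (freud_weight lam a b)))
       (kolmogorov_width (Lp_weight q (freud_weight lam a b)) (Lp_weight_norm q (freud_weight lam a b))
          (sobolev_ball r p (freud_weight lam a b)))
     \<and> same_order
       (kolmogorov_width (Lp_weight q (freud_weight lam a b)) (Lp_weight_norm q (freud_weight lam a b))
          (sobolev_ball r p (freud_weight lam a b)))
       (\<lambda>n. ennreal (real n powr (- width_exponent lam r p q)))"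
proof -
  obtain r' where r': "r = Suc r'" using \<open>r \<ge> 1\<close> by (cases r) auto
  let ?w = "freud_weight lam a b" and ?\<rho> = "width_exponent lam r p q"
  let ?l = "linear_width (Lp_weight q ?w) (Lp_weight_norm q ?w) (sobolev_ball r p ?w)"
  let ?d = "kolmogorov_width (Lp_weight q ?w) (Lp_weight_norm q ?w) (sobolev_ball r p ?w)"
  obtain C where C: "C > 0" "sobolev_ball r p ?w \<subseteq> Lp_weight q ?w"
    "\<And>n. n \<ge> 1 \<Longrightarrow> ?l n \<le> ennreal (C * real n powr (- ?\<rho>))"
    using linear_width_upper_bound[OF assms(1,2,4,5), of r' b] assms(6) unfolding r' by blast
  obtain c where c: "c > 0" "\<And>n. n \<ge> 1 \<Longrightarrow> ennreal (c * real n powr (- ?\<rho>)) \<le> ?d n"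
    using kolmogorov_width_lower_bound[OF assms(1,2,4,5), of r b] by blast
  have dl: "?d n \<le> ?l n" for n by (rule kolmogorov_width_le_linear_width[OF C(2)])
  have ld: "?l n \<le> ennreal (C / c) * ?d n" if n: "n \<ge> 1" for n
  proof -
    have "?l n \<le> ennreal (C * real n powr (- ?\<rho>))" by (rule C(3)[OF n])
    also have "\<dots> = ennreal (C / c) * ennreal (c * real n powr (- ?\<rho>))"
      using c(1) C(1) by (simp flip: ennreal_mult)
    also have "\<dots> \<le> ennreal (C / c) * ?d n" by (intro mult_left_mono c(2)[OF n]) simp
    finally show ?thesis .
  qed
  have "same_order ?l ?d"
    by (rule same_orderI[of 1 "C / c"]) (use dl ld c(1) C(1) in auto)
  moreover have "same_order ?d (\<lambda>n. ennreal (real n powr (- ?\<rho>)))"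
  proof (rule same_orderI[OF c(1) C(1)])
    fix n :: nat assume n: "1 \<le> n"
    show "ennreal c * ennreal (real n powr (- ?\<rho>)) \<le> ?d n"
      using c(2)[OF n] c(1) by (simp add: ennreal_mult)
    show "?d n \<le> ennreal C * ennreal (real n powr (- ?\<rho>))"
      using order_trans[OF dl C(3)[OF n]] C(1) by (simp add: ennreal_mult)
  qed
  ultimately show ?thesis by blast
qed

end
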